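(* Let $r>0$. For any graded ideal $I\subset\mathcal{P}_d$ there exists an isomorphism of locally convex algebras $$\varprojlim\,(\mathcal{A}_d^x/\overline{I},\ \widetilde{\phi_{xy}})_{0<x<r}\;\cong\;\mathcal{F}_d^r/\overline{I}.$$ In particular, there exists an isomorphism of locally convex algebras $\varprojlim\,(\mathcal{A}_d^x,\phi_{xy})_{0<x<r}\cong\mathcal{F}_d^r$.
   Context: Fix a natural number $d\geq 1$. The full Fock space $\mathcal{F}(\mathbb{C}^d)$ is the Hilbert direct sum of $(\mathbb{C}^d)^{\otimes k}$, $k\geq 0$. The creation operators $s_j$ ($1\le j\le d$) are the isometries $e_{i_1}\otimes\cdots\otimes e_{i_k}\mapsto e_j\otimes e_{i_1}\otimes\cdots\otimes e_{i_k}$ on $\mathcal{F}(\mathbb{C}^d)$. $\mathcal{P}_d$ is the unital algebra generated by $s_1,\dots,s_d$ (a free algebra on these generators), graded by $\mathcal{P}_d^k=\operatorname{span}\{s_{i_1}\cdots s_{i_k}\}$; $\mathcal{A}_d$ is its operator-norm closure in $\mathcal{B}(\mathcal{F}(\mathbb{C}^d))$. A graded ideal is a two-sided ideal of the form $I=\bigoplus_{k\geq 1}I^k$ with $I^k\subset\mathcal{P}_d^k$. For $0<x<r$ put $\mathcal{A}_d^x=\mathcal{A}_d$. For $0<x<y<r$, $\phi_{xy}:\mathcal{A}_d^y\to\mathcal{A}_d^x$ is the (unique) contractive unital homomorphism with $\phi_{xy}(s_i)=\frac{x}{y}s_i$ for all $i$, and $\widetilde{\phi_{xy}}:\mathcal{A}_d^y/\overline{I}\to\mathcal{A}_d^x/\overline{I}$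 is the induced homomorphism, where $\overline{I}$ is the closure of $I$ in $\mathcal{A}_d$. Inverse limits are taken in the category of locally convex algebras. Let $\mathbb{F}_d^+$ be the free unital semigroup on $g_1,\dots,g_d$; for $\alpha=g_{i_1}\cdots g_{i_k}$ put $|\alpha|=k$, $z_\alpha=z_{i_1}\cdots z_{i_k}$ (noncommuting formal variables) and $T_\alpha=T_{i_1}\cdots T_{i_k}$ for operators $T_1,\dots,T_d$. For a formal free series $F=\sum_\alpha a_\alpha z_\alpha$ ($a_\alpha\in\mathbb{C}$) put $F_k=\sum_{|\alpha|=k}a_\alpha z_\alpha$, so $F_k(T_1,\dots,T_d)=\sum_{|\alpha|=k}a_\alpha T_\alpha$. Let $H$ be an infinite-dimensional Hilbert space and $[\mathcal{B}(H)^d]_r=\{(T_1,\dots,T_d)\in\mathcal{B}(H)^d:\|T_1T_1^*+\cdots+T_dT_d^*\|<r^2\}$. Then $\mathcal{F}_d^r$ is the algebra (multiplication of formal free series) of all formal free series $F$ such that $\sum_{k\geq 0}\|F_k(T_1,\dots,T_d)\|<\infty$ for all $(T_1,\dots,T_d)\in[\mathcal{B}(H)^d]_r$, with the locally convex topology given by the norms $\|F\|_x=\sup_{(T_1,\dots,T_d)\in[\mathcal{B}(H)^d]_x}\|\sum_{k\geq 0}F_k(T_1,\dots,T_d)\|$, $0<x<r$. $\mathcal{P}_d$ is identified with a dense subalgebra of $\mathcal{F}_d^r$ by $s_i\mapsto z_i$. In $\mathcal{F}_d^r/\overline{I}$, $\overline{I}$ denotes the closure of $I$ in $\mathcal{F}_d^r$,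 and the quotient has the quotient topology. An isomorphism of locally convex algebras is an algebra isomorphism that is a homeomorphism. *)

theory Defs
  imports "HOL-Analysis.Analysis" "HOL-Algebra.QuotRing" "HOL-Algebra.Module"
begin

section \<open>Complex Hilbert spaces and their bounded operators\<close>

class scaleC = scaleR +
  fixes scaleC :: "complex \<Rightarrow> 'a \<Rightarrow> 'a" (infixr \<open>*\<^sub>C\<close> 75)
  assumes scaleC_of_real: "complex_of_real r *\<^sub>C x = r *\<^sub>R x"

class complex_vector = real_vector + scaleC +
  assumes scaleC_add_right: "c *\<^sub>C (x + y) = c *\<^sub>C x + c *\<^sub>C y"
    and scaleC_add_left: "(b + c) *\<^sub>C x = b *\<^sub>C x + c *\<^sub>C x"
    and scaleC_scaleC: "b *\<^sub>C (c *\<^sub>C x) = (b * c) *\<^sub>C x"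

lemma scaleC_one [simp]: "1 *\<^sub>C (x::'a::complex_vector) = x"
  using scaleC_of_real[of 1 x] by simp

global_interpretation complex_vector:
  vector_space "scaleC :: complex \<Rightarrow> 'a \<Rightarrow> 'a::complex_vector"
  by unfold_locales
    (simp_all add: scaleC_add_right scaleC_add_left scaleC_scaleC)

text \<open>The real structure of a complex Hilbert space is the underlying one: its inner product is
  \<^term>\<open>\<lambda>x y. Re (cinner x y)\<close>, so that the norm is the one induced by \<open>cinner\<close>.\<close>

class complex_hilbert = complex_vector + real_inner + complete_space +
  fixes cinner :: "'a \<Rightarrow> 'a \<Rightarrow> complex"
  assumes cinner_commute: "cinner x y = cnj (cinner y x)"
    and cinner_add_left: "cinner (x + y) z = cinner x z + cinner y z"
    and cinner_scaleC_left: "cinner (c *\<^sub>C x) y = c * cinner x y"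
    and inner_eq_Re_cinner: "inner x y = Re (cinner x y)"

lemma cinner_self: "cinner x x = complex_of_real ((norm (x::'a::complex_hilbert))\<^sup>2)"
proof (rule complex_eqI)
  show "Im (cinner x x) = Im (complex_of_real ((norm x)\<^sup>2))"
    using arg_cong[OF cinner_commute[of x x], of Im] by simp
qed (simp add: power2_norm_eq_inner flip: inner_eq_Re_cinner)

lemma norm_scaleC: "norm (c *\<^sub>C (x::'a::complex_hilbert)) = cmod c * norm x"
proof -
  have "cinner (c *\<^sub>C x) (c *\<^sub>C x) = c * cnj (c * cinner x x)"
    by (metis cinner_scaleC_left cinner_commute)
  also have "\<dots> = complex_of_real ((cmod c * norm x)\<^sup>2)"
    by (simp add: cinner_self power_mult_distrib mult.assoc[symmetric] flip: complex_norm_square)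
  finally have "(norm (c *\<^sub>C x))\<^sup>2 = (cmod c * norm x)\<^sup>2"
    unfolding cinner_self of_real_eq_iff .
  then show ?thesis
    by (simp add: power2_eq_iff_nonneg)
qed

lemma bounded_linear_scaleC: "bounded_linear (\<lambda>x::'a::complex_hilbert. c *\<^sub>C x)"
proof (rule bounded_linear_intro)
  fix x y :: 'a and r :: real
  show "c *\<^sub>C (x + y) = c *\<^sub>C x + c *\<^sub>C y"
    by (rule scaleC_add_right)
  show "c *\<^sub>C (r *\<^sub>R x) = r *\<^sub>R (c *\<^sub>C x)"
    by (simp add: scaleC_scaleC mult.commute flip: scaleC_of_real)
  show "norm (c *\<^sub>C x) \<le> norm x * cmod c"
    by (simp add: norm_scaleC mult.commute)
qed

instantiation blinfun :: (real_normed_vector, complex_hilbert) complex_vector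
begin

lift_definition scaleC_blinfun :: "complex \<Rightarrow> ('a \<Rightarrow>\<^sub>L 'b) \<Rightarrow> ('a \<Rightarrow>\<^sub>L 'b)"
  is "\<lambda>c T x. c *\<^sub>C T x"
  by (rule bounded_linear_compose[OF bounded_linear_scaleC])

instance
  by standard
    (transfer; simp add: fun_eq_iff scaleC_of_real scaleC_add_right scaleC_add_left scaleC_scaleC)+

end

text \<open>The type \<^typ>\<open>'a \<Rightarrow>\<^sub>L 'a\<close> consists of the bounded real-linear operators (with the operator norm).\<close>

definition bounded_ops :: "('a::complex_hilbert \<Rightarrow>\<^sub>L 'a) set"
  where "bounded_ops = {T. \<forall>c x. blinfun_apply T (c *\<^sub>C x) = c *\<^sub>C blinfun_apply T x}"

definition hilbert_adjoint :: "('a::complex_hilbert \<Rightarrow>\<^sub>L 'a) \<Rightarrow> ('a \<Rightarrow>\<^sub>L 'a)"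
  where "hilbert_adjoint T =
    (THE S. \<forall>x y. cinner (blinfun_apply T x) y = cinner x (blinfun_apply S y))"

text \<open>Elements of the free semigroup are lists, with concatenation as product.\<close>

definition word_op :: "('d \<Rightarrow> ('a::complex_hilbert \<Rightarrow>\<^sub>L 'a)) \<Rightarrow> 'd list \<Rightarrow> ('a \<Rightarrow>\<^sub>L 'a)"
  where "word_op T w = foldr (\<lambda>i S. T i o\<^sub>L S) w id_blinfun"


section \<open>Locally convex algebras\<close>

record 'a lc_algebra = "(complex, 'a) module" +
  lctop :: "'a topology"

definition alg_hom :: "('a, 'm) lc_algebra_scheme \<Rightarrow> ('b, 'n) lc_algebra_scheme \<Rightarrow> ('a \<Rightarrow> 'b) set"
  where "alg_hom A B = {h \<in> ring_hom A B.
    \<forall>c. \<forall>a\<in>carrier A. h (c \<odot>\<^bsub>A\<^esub> a) = c \<odot>\<^bsub>B\<^esub> h a}"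

definition lca_iso :: "('a, 'm) lc_algebra_scheme \<Rightarrow> ('b, 'n) lc_algebra_scheme \<Rightarrow> ('a \<Rightarrow> 'b) set"
  where "lca_iso A B = {h \<in> alg_hom A B.
    bij_betw h (carrier A) (carrier B) \<and> homeomorphic_map (lctop A) (lctop B) h}"

definition quotient_topology :: "'a topology \<Rightarrow> ('a \<Rightarrow> 'b) \<Rightarrow> 'b topology"
  where "quotient_topology X f =
    topology (\<lambda>U. U \<subseteq> f ` topspace X \<and> openin X {x \<in> topspace X. f x \<in> U})"

lemma openin_quotient_topology:
  "openin (quotient_topology X f) U \<longleftrightarrow> U \<subseteq> f ` topspace X \<and> openin X {x \<in> topspace X. f x \<in> U}"
proof -
  have "istopology (\<lambda>U. U \<subseteq> f ` topspace X \<and> openin X {x \<in> topspace X. f x \<in> U})"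
    unfolding istopology_def
  proof (intro conjI allI impI)
    fix S T
    assume "S \<subseteq> f ` topspace X \<and> openin X {x \<in> topspace X. f x \<in> S}"
      and "T \<subseteq> f ` topspace X \<and> openin X {x \<in> topspace X. f x \<in> T}"
    then show "S \<inter> T \<subseteq> f ` topspace X" "openin X {x \<in> topspace X. f x \<in> S \<inter> T}"
      using openin_Int[of X "{x \<in> topspace X. f x \<in> S}" "{x \<in> topspace X. f x \<in> T}"]
      by (auto simp: Collect_conj_eq Int_ac)
  next
    fix K
    assume K: "\<forall>S\<in>K. S \<subseteq> f ` topspace X \<and> openin X {x \<in> topspace X. f x \<in> S}"
    then show "\<Union>K \<subseteq> f ` topspace X"
      by auto
    have "{x \<in> topspace X. f x \<in> \<Union>K} = (\<Union>S\<in>K. {x \<in> topspace X. f x \<in> S})"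
      by auto
    then show "openin X {x \<in> topspace X. f x \<in> \<Union>K}"
      using K by auto
  qed
  then show ?thesis
    by (simp add: quotient_topology_def)
qed

definition lca_quotient :: "('a, 'm) lc_algebra_scheme \<Rightarrow> 'a set \<Rightarrow> 'a set lc_algebra"
  where "lca_quotient A J =
    \<lparr>carrier = carrier (A Quot J), mult = mult (A Quot J), one = one (A Quot J),
     zero = zero (A Quot J), add = add (A Quot J),
     smult = (\<lambda>c X. \<Union>a\<in>X. J +>\<^bsub>A\<^esub> (c \<odot>\<^bsub>A\<^esub> a)),
     lctop = quotient_topology (lctop A) (\<lambda>a. J +>\<^bsub>A\<^esub> a)\<rparr>"

text \<open>As in \<^const>\<open>rcoset_mult\<close>, the union is over equal cosets when \<open>h\<close> maps the ideal on the
  source side into \<open>J\<close>.\<close>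

definition induced_map :: "('b, 'n) lc_algebra_scheme \<Rightarrow> 'b set \<Rightarrow> ('a \<Rightarrow> 'b) \<Rightarrow> 'a set \<Rightarrow> 'b set"
  where "induced_map B J h X = (\<Union>a\<in>X. J +>\<^bsub>B\<^esub> h a)"

text \<open>The connecting map \<open>\<psi> x y\<close>, for \<open>x < y\<close>, goes from \<open>A y\<close> to \<open>A x\<close>.\<close>

definition inverse_limit ::
    "'i::linorder set \<Rightarrow> ('i \<Rightarrow> 'a lc_algebra) \<Rightarrow> ('i \<Rightarrow> 'i \<Rightarrow> 'a \<Rightarrow> 'a) \<Rightarrow> ('i \<Rightarrow> 'a) lc_algebra"
  where "inverse_limit X A \<psi> =
    (let L = {a \<in> Pi\<^sub>E X (\<lambda>x. carrier (A x)). \<forall>x\<in>X. \<forall>y\<in>X. x < y \<longrightarrow> \<psi> x y (a y) = a x} in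
    \<lparr>carrier = L,
     mult = (\<lambda>a b. \<lambda>x\<in>X. a x \<otimes>\<^bsub>A x\<^esub> b x), one = (\<lambda>x\<in>X. \<one>\<^bsub>A x\<^esub>),
     zero = (\<lambda>x\<in>X. \<zero>\<^bsub>A x\<^esub>), add = (\<lambda>a b. \<lambda>x\<in>X. a x \<oplus>\<^bsub>A x\<^esub> b x),
     smult = (\<lambda>c a. \<lambda>x\<in>X. c \<odot>\<^bsub>A x\<^esub> a x),
     lctop = subtopology (product_topology (\<lambda>x. lctop (A x)) X) L\<rparr>)"


section \<open>The full Fock space\<close>

text \<open>The tensors \<open>e\<^bsub>i\<^sub>1\<^esub> \<otimes> \<dots> \<otimes> e\<^bsub>i\<^sub>k\<^esub>\<close> form an orthonormal basis of the \<open>k\<close>-th tensor power, so the Hilbert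
  direct sum of all tensor powers is the space of square-summable functions on words. The
  dimension \<open>d\<close> is the cardinality of the finite type \<^typ>\<open>'d\<close>.\<close>

typedef 'd fock = "{f :: 'd list \<Rightarrow> complex. (\<lambda>w. (cmod (f w))\<^sup>2) summable_on UNIV}"
  morphisms fock_coeff Abs_fock
  by (rule exI[of _ "\<lambda>_. 0"]) simp

setup_lifting type_definition_fock

lemma square_summable_add:
  fixes f g :: "'b \<Rightarrow> complex"
  assumes "(\<lambda>w. (cmod (f w))\<^sup>2) summable_on A" "(\<lambda>w. (cmod (g w))\<^sup>2) summable_on A"
  shows "(\<lambda>w. (cmod (f w + g w))\<^sup>2) summable_on A"
proof (rule summable_on_comparison_test)
  show "(\<lambda>w. 2 * (cmod (f w))\<^sup>2 + 2 * (cmod (g w))\<^sup>2) summable_on A"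
    by (intro summable_on_add summable_on_cmult_right assms)
  fix w
  have "(cmod (f w + g w))\<^sup>2 \<le> (cmod (f w) + cmod (g w))\<^sup>2"
    by (intro power_mono norm_triangle_ineq) simp
  also have "\<dots> \<le> 2 * (cmod (f w))\<^sup>2 + 2 * (cmod (g w))\<^sup>2"
    using sum_squares_bound[of "cmod (f w)" "cmod (g w)"] by (simp add: power2_sum)
  finally show "(cmod (f w + g w))\<^sup>2 \<le> 2 * (cmod (f w))\<^sup>2 + 2 * (cmod (g w))\<^sup>2" .
qed simp

lemma square_summable_scale:
  fixes f :: "'b \<Rightarrow> complex"
  assumes "(\<lambda>w. (cmod (f w))\<^sup>2) summable_on A"
  shows "(\<lambda>w. (cmod (c * f w))\<^sup>2) summable_on A"
  using summable_on_cmult_right[OF assms, of "(cmod c)\<^sup>2"] by (simp add: norm_mult power_mult_distrib)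

lemma square_summable_mult:
  fixes f g :: "'b \<Rightarrow> complex"
  assumes "(\<lambda>w. (cmod (f w))\<^sup>2) summable_on A" "(\<lambda>w. (cmod (g w))\<^sup>2) summable_on A"
  shows "(\<lambda>w. f w * cnj (g w)) summable_on A"
proof -
  have "(\<lambda>w. cmod (f w * cnj (g w))) summable_on A"
  proof (rule summable_on_comparison_test)
    show "(\<lambda>w. (cmod (f w))\<^sup>2 + (cmod (g w))\<^sup>2) summable_on A"
      by (intro summable_on_add assms)
    fix w
    show "cmod (f w * cnj (g w)) \<le> (cmod (f w))\<^sup>2 + (cmod (g w))\<^sup>2"
      using sum_squares_bound[of "cmod (f w)" "cmod (g w)"]
        mult_nonneg_nonneg[OF norm_ge_zero[of "f w"] norm_ge_zero[of "g w"]]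
      by (simp only: norm_mult complex_mod_cnj)
  qed simp
  then show ?thesis
    by (rule abs_summable_summable)
qed

instantiation fock :: (type) complex_vector
begin

lift_definition zero_fock :: "'a fock" is "\<lambda>_. 0" by simp
lift_definition plus_fock :: "'a fock \<Rightarrow> 'a fock \<Rightarrow> 'a fock" is "\<lambda>f g w. f w + g w"
  by (rule square_summable_add)
lift_definition uminus_fock :: "'a fock \<Rightarrow> 'a fock" is "\<lambda>f w. - f w" by simp
lift_definition minus_fock :: "'a fock \<Rightarrow> 'a fock \<Rightarrow> 'a fock" is "\<lambda>f g w. f w - g w"
  using square_summable_add[of _ _ "\<lambda>w. - g w" for g] by simp
lift_definition scaleC_fock :: "complex \<Rightarrow> 'a fock \<Rightarrow> 'a fock" is "\<lambda>c f w. c * f w"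
  by (rule square_summable_scale)
lift_definition scaleR_fock :: "real \<Rightarrow> 'a fock \<Rightarrow> 'a fock" is "\<lambda>r f w. complex_of_real r * f w"
  by (rule square_summable_scale)

instance
  by standard (transfer; simp add: fun_eq_iff algebra_simps)+

end

lift_definition fock_cinner :: "'d fock \<Rightarrow> 'd fock \<Rightarrow> complex"
  is "\<lambda>f g. \<Sum>\<^sub>\<infinity>w. f w * cnj (g w)" .

lemma fock_cinner_add: "fock_cinner (x + y) z = fock_cinner x z + fock_cinner y z"
  by transfer (simp add: distrib_right infsum_add square_summable_mult)

lemma fock_cinner_scaleC: "fock_cinner (c *\<^sub>C x) y = c * fock_cinner x y"
  by transfer (simp add: mult.assoc infsum_cmult_right')

lemma fock_cinner_commute: "fock_cinner x y = cnj (fock_cinner y x)"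
  by transfer (simp add: mult.commute flip: infsum_cnj)

lemma square_summable_fock_coeff: "(\<lambda>w. (cmod (fock_coeff x w))\<^sup>2) summable_on A"
  using fock_coeff[of x] summable_on_subset_banach by blast

lemma fock_cinner_self:
  "fock_cinner x x = complex_of_real (\<Sum>\<^sub>\<infinity>w. (cmod (fock_coeff x w))\<^sup>2)"
proof -
  have "fock_cinner x x = (\<Sum>\<^sub>\<infinity>w. complex_of_real ((cmod (fock_coeff x w))\<^sup>2))"
    unfolding fock_cinner.rep_eq by (rule infsum_cong) (rule complex_norm_square[symmetric])
  also have "\<dots> = complex_of_real (\<Sum>\<^sub>\<infinity>w. (cmod (fock_coeff x w))\<^sup>2)"
    by (intro infsumI has_sum_of_real has_sum_infsum square_summable_fock_coeff)
  finally show ?thesis .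
qed

instantiation fock :: (type) real_inner
begin

definition inner_fock :: "'a fock \<Rightarrow> 'a fock \<Rightarrow> real"
  where "inner_fock x y = Re (fock_cinner x y)"
definition norm_fock :: "'a fock \<Rightarrow> real"
  where "norm_fock x = sqrt (inner x x)"
definition sgn_fock :: "'a fock \<Rightarrow> 'a fock"
  where "sgn_fock x = inverse (norm x) *\<^sub>R x"
definition dist_fock :: "'a fock \<Rightarrow> 'a fock \<Rightarrow> real"
  where "dist_fock x y = norm (x - y)"
definition uniformity_fock :: "('a fock \<times> 'a fock) filter"
  where "uniformity_fock = (INF e\<in>{0 <..}. principal {(x, y). dist x y < e})"
definition open_fock :: "'a fock set \<Rightarrow> bool"
  where "open_fock U \<longleftrightarrow> (\<forall>x\<in>U. eventually (\<lambda>(x', y). x' = x \<longrightarrow> y \<in> U) uniformity)"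

instance
proof
  fix x y z :: "'a fock" and r :: real
  show "dist x y = norm (x - y)" by (rule dist_fock_def)
  show "sgn x = inverse (norm x) *\<^sub>R x" by (rule sgn_fock_def)
  show "uniformity = (INF e\<in>{0<..}. principal {(x::'a fock, y). dist x y < e})"
    by (rule uniformity_fock_def)
  show "open U \<longleftrightarrow> (\<forall>x\<in>U. eventually (\<lambda>(x', y). x' = x \<longrightarrow> y \<in> U) uniformity)"
    for U :: "'a fock set"
    by (rule open_fock_def)
  show "inner x y = inner y x"
    using fock_cinner_commute[of x y] by (simp add: inner_fock_def)
  show "inner (x + y) z = inner x z + inner y z"
    by (simp add: inner_fock_def fock_cinner_add)
  show "inner (r *\<^sub>R x) y = r * inner x y"
    by (simp add: inner_fock_def fock_cinner_scaleC flip: scaleC_of_real)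
  show "0 \<le> inner x x"
    by (simp add: inner_fock_def fock_cinner_self infsum_nonneg)
  show "inner x x = 0 \<longleftrightarrow> x = 0"
  proof
    assume "inner x x = 0"
    then have "(cmod (fock_coeff x w))\<^sup>2 = 0" for w
      by (intro nonneg_infsum_le_0D[where A = UNIV and f = "\<lambda>w. (cmod (fock_coeff x w))\<^sup>2"]
            square_summable_fock_coeff)
        (simp_all add: inner_fock_def fock_cinner_self)
    then have "fock_coeff x = fock_coeff 0"
      by (simp add: fun_eq_iff zero_fock.rep_eq)
    then show "x = 0"
      by (simp add: fock_coeff_inject)
  next
    assume "x = 0"
    then show "inner x x = 0"
      by (simp add: inner_fock_def fock_cinner_self zero_fock.rep_eq)
  qed
  show "norm x = sqrt (inner x x)" by (rule norm_fock_def)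
qed

end

lemma norm_fock_square: "(norm x)\<^sup>2 = (\<Sum>\<^sub>\<infinity>w. (cmod (fock_coeff x w))\<^sup>2)"
  by (simp add: power2_norm_eq_inner inner_fock_def fock_cinner_self)

lemma sum_le_norm_fock_square: "finite A \<Longrightarrow> (\<Sum>w\<in>A. (cmod (fock_coeff x w))\<^sup>2) \<le> (norm x)\<^sup>2"
  unfolding norm_fock_square
  by (rule finite_sum_le_infsum) (simp_all add: square_summable_fock_coeff)

lemma norm_fock_coeff_le: "cmod (fock_coeff x w) \<le> norm x"
  by (rule power2_le_imp_le) (use sum_le_norm_fock_square[of "{w}" x] in simp_all)

instance fock :: (type) complete_space
proof
  fix X :: "nat \<Rightarrow> 'a fock"
  assume "Cauchy X"
  have "Cauchy (\<lambda>n. fock_coeff (X n) w)" for w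
  proof (rule CauchyI)
    fix e :: real assume "0 < e"
    then obtain N where N: "\<And>m n. m \<ge> N \<Longrightarrow> n \<ge> N \<Longrightarrow> norm (X m - X n) < e"
      using CauchyD[OF \<open>Cauchy X\<close>] by blast
    have "cmod (fock_coeff (X m) w - fock_coeff (X n) w) < e" if "m \<ge> N" "n \<ge> N" for m n
      using norm_fock_coeff_le[of "X m - X n" w] N[OF that] by (simp add: minus_fock.rep_eq)
    then show "\<exists>N. \<forall>m\<ge>N. \<forall>n\<ge>N. cmod (fock_coeff (X m) w - fock_coeff (X n) w) < e"
      by blast
  qed
  then have "(\<lambda>n. fock_coeff (X n) w) \<longlonglongrightarrow> lim (\<lambda>n. fock_coeff (X n) w)" for w
    by (simp add: Cauchy_convergent_iff convergent_LIMSEQ_iff)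
  then obtain L where L: "\<And>w. (\<lambda>n. fock_coeff (X n) w) \<longlonglongrightarrow> L w"
    by (rule that)
  have fin: "\<exists>N. \<forall>n\<ge>N. \<forall>A. finite A \<longrightarrow> (\<Sum>w\<in>A. (cmod (fock_coeff (X n) w - L w))\<^sup>2) \<le> e\<^sup>2"
    if "0 < e" for e :: real
  proof -
    obtain N where N: "\<And>m n. m \<ge> N \<Longrightarrow> n \<ge> N \<Longrightarrow> norm (X m - X n) < e"
      using CauchyD[OF \<open>Cauchy X\<close> \<open>0 < e\<close>] by blast
    have "(\<Sum>w\<in>A. (cmod (fock_coeff (X n) w - L w))\<^sup>2) \<le> e\<^sup>2" if "n \<ge> N" "finite A" for n A
    proof (rule LIMSEQ_le_const2)
      show "(\<lambda>m. \<Sum>w\<in>A. (cmod (fock_coeff (X n) w - fock_coeff (X m) w))\<^sup>2)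
          \<longlonglongrightarrow> (\<Sum>w\<in>A. (cmod (fock_coeff (X n) w - L w))\<^sup>2)"
        by (intro tendsto_intros L)
      have "(\<Sum>w\<in>A. (cmod (fock_coeff (X n) w - fock_coeff (X m) w))\<^sup>2) \<le> e\<^sup>2" if "m \<ge> N" for m
      proof -
        have "(\<Sum>w\<in>A. (cmod (fock_coeff (X n - X m) w))\<^sup>2) \<le> (norm (X n - X m))\<^sup>2"
          by (rule sum_le_norm_fock_square[OF \<open>finite A\<close>])
        also have "\<dots> \<le> e\<^sup>2"
          using N[OF \<open>n \<ge> N\<close> that] by (intro power_mono) simp_all
        finally show ?thesis
          by (simp add: minus_fock.rep_eq)
      qed
      then show "\<exists>N. \<forall>m\<ge>N. (\<Sum>w\<in>A. (cmod (fock_coeff (X n) w - fock_coeff (X m) w))\<^sup>2) \<le> e\<^sup>2"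
        by blast
    qed
    then show ?thesis
      by blast
  qed
  have summable: "(\<lambda>w. (cmod (fock_coeff (X n) w - L w))\<^sup>2) summable_on UNIV"
    if "\<And>A. finite A \<Longrightarrow> (\<Sum>w\<in>A. (cmod (fock_coeff (X n) w - L w))\<^sup>2) \<le> e\<^sup>2" for n and e :: real
    by (rule nonneg_bdd_above_summable_on) (auto intro!: bdd_aboveI2[of _ _ "e\<^sup>2"] that)
  have L_in: "(\<lambda>w. (cmod (L w))\<^sup>2) summable_on UNIV"
  proof -
    obtain n where "\<And>A. finite A \<Longrightarrow> (\<Sum>w\<in>A. (cmod (fock_coeff (X n) w - L w))\<^sup>2) \<le> 1\<^sup>2"
      using fin[of 1] by auto
    from square_summable_add[OF square_summable_fock_coeff[of "X n"]
        square_summable_scale[OF summable[OF this], of "- 1"]]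
    show ?thesis
      by simp
  qed
  define x where "x = Abs_fock L"
  have x: "fock_coeff x = L"
    unfolding x_def using L_in by (intro Abs_fock_inverse) simp
  have "X \<longlonglongrightarrow> x"
  proof (rule LIMSEQ_I)
    fix e :: real assume "0 < e"
    then obtain N where N: "\<And>n A. n \<ge> N \<Longrightarrow> finite A \<Longrightarrow>
        (\<Sum>w\<in>A. (cmod (fock_coeff (X n) w - L w))\<^sup>2) \<le> (e / 2)\<^sup>2"
      using fin[of "e / 2"] by auto
    have "norm (X n - x) < e" if "n \<ge> N" for n
    proof -
      have "(norm (X n - x))\<^sup>2 \<le> (e / 2)\<^sup>2"
        unfolding norm_fock_square
        by (rule infsum_le_finite_sums[OF square_summable_fock_coeff])
          (simp add: minus_fock.rep_eq x N[OF that])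
      then have "norm (X n - x) \<le> e / 2"
        by (rule power2_le_imp_le) (use \<open>0 < e\<close> in simp)
      then show ?thesis
        using \<open>0 < e\<close> by simp
    qed
    then show "\<exists>N. \<forall>n\<ge>N. norm (X n - x) < e"
      by blast
  qed
  then show "convergent X"
    by (rule convergentI)
qed

instantiation fock :: (type) complex_hilbert
begin

definition cinner_fock :: "'a fock \<Rightarrow> 'a fock \<Rightarrow> complex"
  where "cinner_fock = fock_cinner"

instance
  by standard
    (simp_all add: cinner_fock_def inner_fock_def fock_cinner_add fock_cinner_scaleC
      flip: fock_cinner_commute)

end

text \<open>\<open>fock_basis [i\<^sub>1, \<dots>, i\<^sub>k]\<close> is \<open>e\<^bsub>i\<^sub>1\<^esub> \<otimes> \<dots> \<otimes> e\<^bsub>i\<^sub>k\<^esub>\<close>, and \<open>fock_basis []\<close> is the vacuum vector.\<close>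

lift_definition fock_basis :: "'d list \<Rightarrow> 'd fock" is "\<lambda>w v. of_bool (v = w)"
  by (rule finite_nonzero_values_imp_summable_on) (simp add: of_bool_def)

lift_definition create_vec :: "'d \<Rightarrow> 'd fock \<Rightarrow> 'd fock"
  is "\<lambda>j f w. case w of [] \<Rightarrow> 0 | i # v \<Rightarrow> if i = j then f v else 0"
proof -
  fix j and f :: "'d list \<Rightarrow> complex"
  assume "(\<lambda>w. (cmod (f w))\<^sup>2) summable_on UNIV"
  then have "(\<lambda>w. (cmod (case w of [] \<Rightarrow> 0 | i # v \<Rightarrow> if i = j then f v else 0))\<^sup>2)
      summable_on range ((#) j)"
    by (subst summable_on_reindex) (simp_all add: o_def)
  then show "(\<lambda>w. (cmod (case w of [] \<Rightarrow> 0 | i # v \<Rightarrow> if i = j then f v else 0))\<^sup>2)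
      summable_on UNIV"
    by (rule summable_on_cong_neutral[THEN iffD1, rotated -1]) (auto split: list.splits)
qed

lemma create_vec_basis: "create_vec j (fock_basis w) = fock_basis (j # w)"
  by transfer (auto simp: fun_eq_iff split: list.splits)

lemma norm_create_vec: "norm (create_vec j x) = norm x"
proof -
  have "(norm (create_vec j x))\<^sup>2
      = (\<Sum>\<^sub>\<infinity>w\<in>range ((#) j). (cmod (fock_coeff (create_vec j x) w))\<^sup>2)"
    unfolding norm_fock_square
    by (rule infsum_cong_neutral) (auto simp: create_vec.rep_eq split: list.splits)
  also have "\<dots> = (norm x)\<^sup>2"
    unfolding norm_fock_square
    by (subst infsum_reindex) (simp_all add: o_def create_vec.rep_eq)
  finally show ?thesis
    by (simp add: power2_eq_iff_nonneg)
qed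

lift_definition creation :: "'d \<Rightarrow> ('d fock \<Rightarrow>\<^sub>L 'd fock)" is create_vec
proof (rule bounded_linear_intro)
  fix j :: 'd and x y :: "'d fock" and r :: real
  show "create_vec j (x + y) = create_vec j x + create_vec j y"
    by transfer (auto simp: fun_eq_iff split: list.splits)
  show "create_vec j (r *\<^sub>R x) = r *\<^sub>R create_vec j x"
    by transfer (auto simp: fun_eq_iff split: list.splits)
  show "norm (create_vec j x) \<le> norm x * 1"
    by (simp add: norm_create_vec)
qed


section \<open>The noncommutative disc algebra\<close>

inductive_set fock_polys :: "('d fock \<Rightarrow>\<^sub>L 'd fock) set"
  where
    one: "id_blinfun \<in> fock_polys"
  | gen: "creation j \<in> fock_polys"
  | add: "a \<in> fock_polys \<Longrightarrow> b \<in> fock_polys \<Longrightarrow> a + b \<in> fock_polys"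
  | scale: "a \<in> fock_polys \<Longrightarrow> c *\<^sub>C a \<in> fock_polys"
  | mult: "a \<in> fock_polys \<Longrightarrow> b \<in> fock_polys \<Longrightarrow> a o\<^sub>L b \<in> fock_polys"

definition fock_homog :: "nat \<Rightarrow> ('d fock \<Rightarrow>\<^sub>L 'd fock) set"
  where "fock_homog k = complex_vector.span {word_op creation w | w. length w = k}"

definition operator_algebra :: "('a::complex_hilbert \<Rightarrow>\<^sub>L 'a) set \<Rightarrow> ('a \<Rightarrow>\<^sub>L 'a) lc_algebra"
  where "operator_algebra C =
    \<lparr>carrier = C, mult = (o\<^sub>L), one = id_blinfun, zero = 0, add = (+), smult = scaleC,
     lctop = top_of_set C\<rparr>"

definition disc_algebra :: "('d fock \<Rightarrow>\<^sub>L 'd fock) lc_algebra"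
  where "disc_algebra = operator_algebra (closure fock_polys)"

text \<open>Directness of the sum needs no separate requirement: the spaces \<^term>\<open>fock_homog k\<close> are
  linearly independent. The members of an ideal of the unital algebra \<^const>\<open>fock_polys\<close> are
  closed under complex scalars.\<close>

definition graded_ideal :: "('d fock \<Rightarrow>\<^sub>L 'd fock) set \<Rightarrow> bool"
  where "graded_ideal I \<longleftrightarrow> ideal I (operator_algebra fock_polys) \<and>
    (\<exists>J. (\<forall>k\<ge>1. complex_vector.subspace (J k) \<and> J k \<subseteq> fock_homog k) \<and>
      I = {\<Sum>k\<in>K. p k | K p. finite K \<and> K \<subseteq> {1..} \<and> (\<forall>k\<in>K. p k \<in> J k)})"

text \<open>Extensionality outside the carrier only serves to make the map unique as a HOL function.\<close>

definition dilation :: "real \<Rightarrow> real \<Rightarrow> ('d fock \<Rightarrow>\<^sub>L 'd fock) \<Rightarrow> ('d fock \<Rightarrow>\<^sub>L 'd fock)"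
  where "dilation x y = (THE h. h \<in> alg_hom disc_algebra disc_algebra \<and>
    h \<in> extensional (carrier disc_algebra) \<and>
    (\<forall>a\<in>carrier disc_algebra. norm (h a) \<le> norm a) \<and>
    (\<forall>i. h (creation i) = complex_of_real (x / y) *\<^sub>C creation i))"


section \<open>Free holomorphic functions\<close>

text \<open>A formal free series is identified with its coefficient function on words. The space of
  free holomorphic functions depends on the Hilbert space through a type argument.\<close>

definition row_ball :: "real \<Rightarrow> ('d::finite \<Rightarrow> ('h::complex_hilbert \<Rightarrow>\<^sub>L 'h)) set"
  where "row_ball r = {T. (\<forall>i. T i \<in> bounded_ops) \<and>
    norm (\<Sum>i\<in>UNIV. T i o\<^sub>L hilbert_adjoint (T i)) < r\<^sup>2}"

definition homog_eval ::
    "('d::finite list \<Rightarrow> complex) \<Rightarrow> ('d \<Rightarrow> ('h::complex_hilbert \<Rightarrow>\<^sub>L 'h)) \<Rightarrow> nat \<Rightarrow> ('h \<Rightarrow>\<^sub>L 'h)"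
  where "homog_eval F T k = (\<Sum>w | length w = k. F w *\<^sub>C word_op T w)"

definition free_hol :: "'h::complex_hilbert itself \<Rightarrow> real \<Rightarrow> ('d::finite list \<Rightarrow> complex) set"
  where "free_hol _ r =
    {F. \<forall>T \<in> (row_ball r :: ('d \<Rightarrow> ('h \<Rightarrow>\<^sub>L 'h)) set). summable (\<lambda>k. norm (homog_eval F T k))}"

definition free_norm ::
    "'h::complex_hilbert itself \<Rightarrow> real \<Rightarrow> ('d::finite list \<Rightarrow> complex) \<Rightarrow> real"
  where "free_norm _ x F =
    (SUP T \<in> (row_ball x :: ('d \<Rightarrow> ('h \<Rightarrow>\<^sub>L 'h)) set). norm (\<Sum>k. homog_eval F T k))"

definition series_mult :: "('d list \<Rightarrow> complex) \<Rightarrow> ('d list \<Rightarrow> complex) \<Rightarrow> 'd list \<Rightarrow> complex"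
  where "series_mult F G w = (\<Sum>(u, v) | u @ v = w. F u * G v)"

definition free_hol_algebra ::
    "'h::complex_hilbert itself \<Rightarrow> real \<Rightarrow> ('d::finite list \<Rightarrow> complex) lc_algebra"
  where "free_hol_algebra H r =
    \<lparr>carrier = free_hol H r, mult = series_mult, one = (\<lambda>w. of_bool (w = [])), zero = (\<lambda>w. 0),
     add = (\<lambda>F G w. F w + G w), smult = (\<lambda>c F w. c * F w),
     lctop = topology_generated_by
       {{G \<in> free_hol H r. free_norm H x (\<lambda>w. G w - F w) < e} | F x e.
          F \<in> free_hol H r \<and> 0 < x \<and> x < r \<and> 0 < e}\<rparr>"

text \<open>Since the operators \<^term>\<open>word_op creation w\<close> are linearly independent, this is the image of a
  set \<open>I\<close> of polynomials in the creation operators when these are identified with the free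
  variables.\<close>

definition free_polys_of :: "('d fock \<Rightarrow>\<^sub>L 'd fock) set \<Rightarrow> ('d list \<Rightarrow> complex) set"
  where "free_polys_of I =
    {F. finite {w. F w \<noteq> 0} \<and> (\<Sum>w | F w \<noteq> 0. F w *\<^sub>C word_op creation w) \<in> I}"

end

theory Submission
  imports Defs "HOL-Complex_Analysis.Conformal_Mappings"
begin

text \<open>Both sides of the isomorphism are determined by the coefficients on words, and both topologies are
given by the same weighted norms of the homogeneous parts. Write \<open>\<parallel>F\<parallel>\<^sub>k\<close> (below \<open>hnorm F k\<close>) for the
\<open>\<ell>\<^sup>2\<close> norm of the coefficients of \<open>F\<close> on words of length \<open>k\<close>.

On the side of the free holomorphic functions, a row \<open>T\<close> of norm at most \<open>x\<close> satisfies
\<open>\<parallel>F\<^sub>k(T)\<parallel> \<le> x^k \<parallel>F\<parallel>\<^sub>k\<close>, because the row of all words of length \<open>k\<close> in \<open>T\<close> has norm at most \<open>x^k\<close>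
(\<open>norm_homog_eval_le\<close>). Conversely \<open>H\<close> contains an orthonormal family indexed by the words, so a
multiple \<open>t S\<close> of a copy \<open>S\<close> of the creation operators acts on it, and applying \<open>F(t S)\<close> to the vacuum
vector gives \<open>t^k \<parallel>F\<parallel>\<^sub>k \<le> \<parallel>F(t S)\<parallel>\<close> (\<open>row_ball_lower_bound\<close>). Hence \<open>F\<close> is free holomorphic of
radius \<open>r\<close> iff \<open>x^k \<parallel>F\<parallel>\<^sub>k\<close> is bounded in \<open>k\<close> for every \<open>x < r\<close>, and the topology is given by
the norms \<open>\<Sum>\<^sub>k x^k \<parallel>F\<parallel>\<^sub>k\<close>; the loss of an arbitrarily small amount of radius is harmless.

On the side of the disc algebra, an element \<open>a\<close> is convolution by its symbol, the coefficient
function of \<open>a\<close> applied to the vacuum. It is therefore determined by its symbol, and products of operators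
correspond to products of series. Again \<open>\<parallel>symb a\<parallel>\<^sub>k \<le> \<parallel>a\<parallel>\<close>, so \<open>F \<mapsto> F(x s)\<close> maps free
holomorphic functions to the disc algebra, and the connecting map \<open>\<phi>\<^bsub>xy\<^esub>\<close> multiplies the homogeneous part
of degree \<open>k\<close> by \<open>(x/y)^k\<close>. That this map is contractive follows from the maximum principle
for \<open>z \<mapsto> p(z s)\<close> together with \<open>\<parallel>p(z s)\<parallel> = \<parallel>p(s)\<parallel>\<close> for \<open>\<bar>z\<bar> = 1\<close> (\<open>norm_dil_poly_le\<close>).

Because dilations tend to the identity pointwise in norm, an element of the disc algebra lies in a closed graded
ideal \<open>J\<close> iff all its homogeneous parts do (\<open>mem_iff_components\<close>). So a compatible family
of cosets in the quotients by \<open>J\<close> gives, degree by degree and up to the powers \<open>x^k\<close>, one coset of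
the degree \<open>k\<close> part of \<open>J\<close>. Choosing in each of these cosets a representative of almost minimal norm
yields a free holomorphic function that induces the family and obeys the norm bounds of every representative of every
member of it (\<open>graded_lift\<close>). This one selection shows that the map \<open>F \<mapsto> (F(x s) + J)\<^sub>x\<close> to the inverse
limit is surjective and that it is open. It is a continuous homomorphism, and its kernel consists of the series
all of whose homogeneous parts lie in \<open>J\<close>; they form the closure
of \<open>I\<close> among the free holomorphic functions (\<open>closure_free_polys_of\<close>). Sending
a family to its fibre under this map is then the isomorphism onto the quotient. With \<open>J = {0}\<close> and without passing to
cosets the map is injective, and its inverse is the second isomorphism.\<close>

section \<open>Adjoints and row operators\<close>

instance complex_hilbert \<subseteq> banach ..

lemma cinner_scaleC_right: "cinner (x::'a::complex_hilbert) (c *\<^sub>C y) = cnj c * cinner x y"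
  by (metis cinner_commute cinner_scaleC_left complex_cnj_mult complex_cnj_cnj)

lemma cinner_zero_left [simp]: "cinner 0 (x::'a::complex_hilbert) = 0"
  using cinner_add_left[of 0 0 x] by simp

lemma cinner_minus_left: "cinner (- x::'a::complex_hilbert) y = - cinner x y"
  using cinner_add_left[of x "- x" y] by (simp add: eq_neg_iff_add_eq_0 add.commute)

lemma cinner_diff_left: "cinner (x - y::'a::complex_hilbert) z = cinner x z - cinner y z"
  using cinner_add_left[of x "- y" z] by (simp add: cinner_minus_left)

lemma cinner_sum_left: "cinner (\<Sum>i\<in>A. f i) (y::'a::complex_hilbert) = (\<Sum>i\<in>A. cinner (f i) y)"
  by (induction A rule: infinite_finite_induct) (simp_all add: cinner_add_left)

lemma Im_cinner: "Im (cinner x y) = inner ((- \<i>) *\<^sub>C x) (y::'a::complex_hilbert)"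
  by (simp add: inner_eq_Re_cinner cinner_scaleC_left cinner_minus_left)

lemma cmod_cinner_le: "cmod (cinner x y) \<le> norm x * norm (y::'a::complex_hilbert)"
proof (cases "cinner x y = 0")
  case False
  let ?c = "cnj (sgn (cinner x y))"
  have "cnj (sgn z) * z = complex_of_real (cmod z)" for z
    by (cases "z = 0")
      (simp_all add: sgn_eq complex_norm_square[symmetric] power2_eq_square mult.commute[of "cnj z"]
        field_simps)
  then have "cmod (cinner x y) = Re (cinner (?c *\<^sub>C x) y)"
    by (simp add: cinner_scaleC_left)
  also have "\<dots> \<le> norm (?c *\<^sub>C x) * norm y"
    unfolding inner_eq_Re_cinner[symmetric] by (rule norm_cauchy_schwarz)
  finally show ?thesis
    using False by (simp add: norm_scaleC norm_sgn)
qed simp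

text \<open>The representing vector is the minimiser of \<open>\<parallel>x\<parallel>\<^sup>2 - 2 f x\<close>: by the parallelogram law a minimising sequence is
Cauchy, and the first variation at the limit vanishes.\<close>

lemma riesz_representation:
  fixes f :: "'a::{real_inner,complete_space} \<Rightarrow> real"
  assumes "bounded_linear f"
  shows "\<exists>z. \<forall>x. f x = inner x z"
proof -
  interpret f: bounded_linear f by fact
  obtain K where K: "\<And>x. norm (f x) \<le> norm x * K"
    using f.bounded by blast
  define \<phi> where "\<phi> x = (norm x)\<^sup>2 - 2 * f x" for x
  have lower: "- K\<^sup>2 \<le> \<phi> x" for x
  proof -
    have "0 \<le> (norm x - K)\<^sup>2" by simp
    also have "\<dots> = (norm x)\<^sup>2 - 2 * (norm x * K) + K\<^sup>2" by (simp add: power2_diff)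
    also have "\<dots> \<le> \<phi> x + K\<^sup>2"
      using K[of x] by (simp add: \<phi>_def abs_le_iff)
    finally show ?thesis by simp
  qed
  define m where "m = (INF x. \<phi> x)"
  have bdd: "bdd_below (range \<phi>)"
    using lower by (auto intro!: bdd_belowI)
  have m: "m \<le> \<phi> x" for x
    unfolding m_def by (rule cINF_lower[OF bdd]) simp
  have "\<exists>x. \<phi> x < m + 1 / Suc n" for n
  proof -
    have "m < m + 1 / Suc n" by simp
    then show ?thesis
      unfolding m_def by (subst (asm) cINF_less_iff[OF _ bdd]) auto
  qed
  then obtain X where X: "\<And>n. \<phi> (X n) < m + 1 / Suc n"
    by metis
  have parallelogram:
    "(norm (x - y))\<^sup>2 = 2 * \<phi> x + 2 * \<phi> y - 4 * \<phi> ((1/2) *\<^sub>R (x + y))" for x y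
    by (simp add: \<phi>_def power2_norm_eq_inner inner_diff inner_add inner_commute f.add f.scaleR
        field_simps)
  have "Cauchy X"
  proof (rule metric_CauchyI)
    fix e :: real assume "0 < e"
    then obtain N where N: "inverse (real (Suc N)) < e\<^sup>2 / 4"
      using reals_Archimedean[of "e\<^sup>2 / 4"] by auto
    have "dist (X i) (X j) < e" if "i \<ge> N" "j \<ge> N" for i j
    proof -
      have "1 / real (Suc i) \<le> 1 / Suc N" "1 / real (Suc j) \<le> 1 / Suc N"
        using that by (simp_all add: frac_le)
      then have "(norm (X i - X j))\<^sup>2 < e\<^sup>2"
        using X[of i] X[of j] m[of "(1/2) *\<^sub>R (X i + X j)"] N
        unfolding parallelogram[of "X i" "X j"] inverse_eq_divide by linarith
      then show ?thesis
        using \<open>0 < e\<close> by (simp add: dist_norm power2_less_imp_less)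
    qed
    then show "\<exists>M. \<forall>i\<ge>M. \<forall>j\<ge>M. dist (X i) (X j) < e" by blast
  qed
  then obtain z where z: "X \<longlonglongrightarrow> z"
    using Cauchy_convergent convergent_def by blast
  have "\<phi> z \<le> m"
  proof (rule LIMSEQ_le)
    show "(\<lambda>n. \<phi> (X n)) \<longlonglongrightarrow> \<phi> z"
      unfolding \<phi>_def by (intro tendsto_intros f.tendsto z)
    show "(\<lambda>n. m + 1 / Suc n) \<longlonglongrightarrow> m"
      using tendsto_add[OF tendsto_const LIMSEQ_inverse_real_of_nat, of m]
      by (simp add: inverse_eq_divide)
    show "\<exists>N. \<forall>n\<ge>N. \<phi> (X n) \<le> m + 1 / Suc n"
      using X less_imp_le by blast
  qed
  have "f x = inner x z" for x
  proof (rule ccontr)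
    assume ne: "f x \<noteq> inner x z"
    define b where "b = inner x z - f x"
    have b: "b \<noteq> 0" using ne by (simp add: b_def)
    have pos: "0 \<le> t\<^sup>2 * (norm x)\<^sup>2 + 2 * t * b" for t
    proof -
      have "\<phi> z \<le> \<phi> (z + t *\<^sub>R x)"
        using \<open>\<phi> z \<le> m\<close> m order_trans by blast
      also have "\<phi> (z + t *\<^sub>R x) = \<phi> z + t\<^sup>2 * (norm x)\<^sup>2 + 2 * t * b"
        by (simp add: \<phi>_def b_def power2_norm_eq_inner inner_add inner_commute f.add f.scaleR
            algebra_simps power2_eq_square[of t])
      finally show ?thesis by simp
    qed
    have nx: "norm x \<noteq> 0"
      using ne by auto
    \<comment> \<open>The minimising value of \<open>t\<close>.\<close>
    have "0 \<le> - (b\<^sup>2 / (norm x)\<^sup>2)"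
      using pos[of "- b / (norm x)\<^sup>2"] nx by (simp add: power2_eq_square field_simps)
    moreover have "b\<^sup>2 / (norm x)\<^sup>2 > 0"
      using b nx by simp
    ultimately show False by simp
  qed
  then show ?thesis by blast
qed

text \<open>The two spaces may differ: the embedding of the Fock space into \<open>H\<close> is obtained below as the adjoint of a
coefficient map from \<open>H\<close> to the Fock space.\<close>

lemma adjoint_exists:
  fixes B :: "'a::complex_hilbert \<Rightarrow>\<^sub>L 'b::complex_hilbert"
  assumes lin: "\<And>c x. B (c *\<^sub>C x) = c *\<^sub>C B x"
  obtains S :: "'b \<Rightarrow>\<^sub>L 'a"
  where "\<And>x y. cinner (B x) y = cinner x (S y)"
    and "\<And>c y. S (c *\<^sub>C y) = c *\<^sub>C S y" and "norm S \<le> norm B"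
proof -
  have "\<exists>z. \<forall>x. inner (B x) y = inner x z" for y
    by (rule riesz_representation)
      (rule bounded_linear_compose[OF bounded_linear_inner_left blinfun.bounded_linear_right])
  then obtain S where S: "\<And>x y. inner (B x) y = inner x (S y)"
    by metis
  have cS: "cinner (B x) y = cinner x (S y)" for x y
    using S[of x y] S[of "(- \<i>) *\<^sub>C x" y]
    by (intro complex_eqI) (simp_all only: Im_cinner lin flip: inner_eq_Re_cinner)
  have eqI: "u = v" if "\<And>x. inner x u = inner x v" for u v :: 'a
    using that vector_eq_ldot by blast
  have eqI': "u = v" if "\<And>x. cinner x u = cinner x v" for u v :: 'a
    using that by (intro eqI) (simp add: inner_eq_Re_cinner)
  have nS: "norm (S y) \<le> norm B * norm y" for y
  proof (cases "S y = 0")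
    case False
    have "norm (S y) * norm (S y) = inner (B (S y)) y"
      unfolding S by (simp add: norm_eq_sqrt_inner)
    also have "\<dots> \<le> norm (B (S y)) * norm y"
      by (rule norm_cauchy_schwarz)
    also have "\<dots> \<le> (norm B * norm (S y)) * norm y"
      by (intro mult_right_mono norm_blinfun) simp
    finally show ?thesis
      using False by (simp add: mult.assoc mult.left_commute[of "norm B"])
  qed simp
  have "bounded_linear S"
  proof (rule bounded_linear_intro)
    show "S (x + y) = S x + S y" for x y
      by (rule eqI) (simp add: inner_add_right flip: S)
    show "S (r *\<^sub>R x) = r *\<^sub>R S x" for r x
      by (rule eqI) (simp flip: S)
    show "norm (S x) \<le> norm x * norm B" for x
      using nS[of x] by (simp add: mult.commute)
  qed
  then have app: "blinfun_apply (Blinfun S) = S"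
    by (rule bounded_linear_Blinfun_apply)
  show thesis
  proof (rule that[of "Blinfun S"])
    show "cinner (B x) y = cinner x (Blinfun S y)" for x y
      by (simp add: app cS)
    show "Blinfun S (c *\<^sub>C y) = c *\<^sub>C Blinfun S y" for c y
      by (rule eqI') (simp add: app cinner_scaleC_right flip: cS)
    show "norm (Blinfun S) \<le> norm B"
      by (rule norm_blinfun_bound) (simp_all add: app nS)
  qed
qed

lemma cinner_hilbert_adjoint:
  assumes "T \<in> bounded_ops"
  shows "cinner (blinfun_apply T x) y = cinner x (blinfun_apply (hilbert_adjoint T) y)"
proof -
  have lin: "blinfun_apply T (c *\<^sub>C x) = c *\<^sub>C blinfun_apply T x" for c x
    using assms by (simp add: bounded_ops_def)
  obtain S where S: "\<And>x y. cinner (blinfun_apply T x) y = cinner x (blinfun_apply S y)"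
    by (rule adjoint_exists[OF lin], rule that)
  have "hilbert_adjoint T = S"
    unfolding hilbert_adjoint_def
  proof (rule the_equality)
    fix S' assume S': "\<forall>x y. cinner (blinfun_apply T x) y = cinner x (blinfun_apply S' y)"
    show "S' = S"
    proof (rule blinfun_eqI)
      fix y
      have "inner x (blinfun_apply S' y) = inner x (blinfun_apply S y)" for x
        using S S' by (simp add: inner_eq_Re_cinner)
      then show "blinfun_apply S' y = blinfun_apply S y"
        using vector_eq_ldot by blast
    qed
  qed (simp add: S)
  then show ?thesis
    by (simp add: S)
qed

text \<open>Since \<open>\<Sum>\<^sub>i T\<^sub>i T\<^sub>i\<^sup>*\<close> is \<open>R R\<^sup>*\<close> for the row operator \<open>R : (h\<^sub>i) \<mapsto> \<Sum>\<^sub>i T\<^sub>i h\<^sub>i\<close>, its norm is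
\<open>\<parallel>R\<parallel>\<^sup>2\<close>. Members of a row ball can thus be recognised by an inequality
without adjoints.\<close>

lemma row_norm_le_iff:
  fixes T :: "'d::finite \<Rightarrow> ('h::complex_hilbert \<Rightarrow>\<^sub>L 'h)"
  assumes T: "\<And>i. T i \<in> bounded_ops" and "M \<ge> 0"
  shows "norm (\<Sum>i\<in>UNIV. T i o\<^sub>L hilbert_adjoint (T i)) \<le> M \<longleftrightarrow>
    (\<forall>h. (norm (\<Sum>i\<in>UNIV. T i (h i)))\<^sup>2 \<le> M * (\<Sum>i\<in>UNIV. (norm (h i))\<^sup>2))"
proof -
  define N where "N = (\<Sum>i\<in>UNIV. T i o\<^sub>L hilbert_adjoint (T i))"
  define A where "A i v = hilbert_adjoint (T i) v" for i v
  have adj: "inner (T i x) y = inner x (A i y)" for i x y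
    using cinner_hilbert_adjoint[OF T, of i x y] by (simp add: inner_eq_Re_cinner A_def)
  have N: "N v = (\<Sum>i\<in>UNIV. T i (A i v))" for v
    by (simp add: N_def A_def blinfun.sum_left)
  have sum_A: "(\<Sum>i\<in>UNIV. (norm (A i v))\<^sup>2) = inner (N v) v" for v
    by (simp add: N inner_sum_left adj power2_norm_eq_inner)
  show ?thesis
    unfolding N_def[symmetric]
  proof (intro iffI allI)
    fix h
    assume M: "norm N \<le> M"
    define v where "v = (\<Sum>i\<in>UNIV. T i (h i))"
    have "(norm v)\<^sup>2 = (\<Sum>i\<in>UNIV. inner (h i) (A i v))"
      by (simp add: power2_norm_eq_inner v_def[symmetric] flip: adj inner_sum_left)
    also have "\<dots> \<le> (\<Sum>i\<in>UNIV. \<bar>norm (h i)\<bar> * \<bar>norm (A i v)\<bar>)"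
      by (intro sum_mono) (simp add: norm_cauchy_schwarz)
    also have "\<dots> \<le> L2_set (\<lambda>i. norm (h i)) UNIV * L2_set (\<lambda>i. norm (A i v)) UNIV"
      by (rule L2_set_mult_ineq)
    finally have "((norm v)\<^sup>2)\<^sup>2 \<le> (L2_set (\<lambda>i. norm (h i)) UNIV * L2_set (\<lambda>i. norm (A i v)) UNIV)\<^sup>2"
      by (intro power_mono) simp_all
    also have "\<dots> = (\<Sum>i\<in>UNIV. (norm (h i))\<^sup>2) * inner (N v) v"
      by (simp add: power_mult_distrib L2_set_def sum_nonneg flip: sum_A)
    also have "\<dots> \<le> (\<Sum>i\<in>UNIV. (norm (h i))\<^sup>2) * (M * (norm v)\<^sup>2)"
    proof (rule mult_left_mono)
      have "inner (N v) v \<le> norm (N v) * norm v"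
        by (rule norm_cauchy_schwarz)
      also have "\<dots> \<le> (norm N * norm v) * norm v"
        by (intro mult_right_mono norm_blinfun) simp
      also have "\<dots> \<le> (M * norm v) * norm v"
        by (intro mult_right_mono M) simp_all
      finally show "inner (N v) v \<le> M * (norm v)\<^sup>2"
        by (simp add: power2_eq_square mult.assoc)
    qed (simp add: sum_nonneg)
    finally have "(norm v)\<^sup>2 * (norm v)\<^sup>2 \<le> (M * (\<Sum>i\<in>UNIV. (norm (h i))\<^sup>2)) * (norm v)\<^sup>2"
      by (simp add: power2_eq_square mult_ac)
    then have "v = 0 \<or> (norm v)\<^sup>2 \<le> M * (\<Sum>i\<in>UNIV. (norm (h i))\<^sup>2)"
      by (metis mult_right_le_imp_le zero_less_norm_iff zero_less_power)
    then show "(norm (\<Sum>i\<in>UNIV. T i (h i)))\<^sup>2 \<le> M * (\<Sum>i\<in>UNIV. (norm (h i))\<^sup>2)"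
      using \<open>M \<ge> 0\<close> by (auto simp: v_def[symmetric] sum_nonneg)
  next
    assume row: "\<forall>h. (norm (\<Sum>i\<in>UNIV. T i (h i)))\<^sup>2 \<le> M * (\<Sum>i\<in>UNIV. (norm (h i))\<^sup>2)"
    show "norm N \<le> M"
    proof (rule norm_blinfun_bound[OF \<open>M \<ge> 0\<close>])
      fix v
      have "(norm (N v))\<^sup>2 \<le> M * inner (N v) v"
        using row[rule_format, of "\<lambda>i. A i v"] by (simp add: N[symmetric] sum_A)
      also have "\<dots> \<le> M * (norm (N v) * norm v)"
        using \<open>M \<ge> 0\<close> by (intro mult_left_mono norm_cauchy_schwarz)
      finally have "norm (N v) * norm (N v) \<le> (M * norm v) * norm (N v)"
        by (simp add: power2_eq_square mult_ac)
      then have "N v = 0 \<or> norm (N v) \<le> M * norm v"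
        by (metis mult_right_le_imp_le zero_less_norm_iff)
      then show "norm (N v) \<le> M * norm v"
        using \<open>M \<ge> 0\<close> by auto
    qed
  qed
qed

section \<open>Homogeneous parts of a series and their norms\<close>

lemma finite_words [simp]: "finite {w::'d::finite list. length w = k}"
  using finite_lists_length_eq[of "UNIV::'d set" k] by simp

lemma sum_words_Suc:
  "(\<Sum>w | length w = Suc k. f w) = (\<Sum>i\<in>UNIV. \<Sum>v | length v = k. f (i # v :: 'd::finite list))"
proof -
  have "{w::'d list. length w = Suc k} = (\<lambda>(i, v). i # v) ` (UNIV \<times> {v. length v = k})"
    by (auto simp: length_Suc_conv image_iff)
  then have "(\<Sum>w | length w = Suc k. f w) = (\<Sum>(i, v)\<in>UNIV \<times> {v. length v = k}. f (i # v))"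
    by (simp only:) (subst sum.reindex, auto simp: inj_on_def case_prod_unfold)
  then show ?thesis
    by (simp add: sum.cartesian_product)
qed

text \<open>The \<open>\<ell>\<^sup>2\<close> norm of the homogeneous part of degree \<open>k\<close>. It is the operator norm of this part in the
creation operators.\<close>

definition hnorm :: "('d::finite list \<Rightarrow> complex) \<Rightarrow> nat \<Rightarrow> real"
  where "hnorm F k = L2_set (\<lambda>w. cmod (F w)) {w. length w = k}"

lemma hnorm_nonneg [simp]: "0 \<le> hnorm F k"
  by (simp add: hnorm_def)

lemma hnorm_square: "(hnorm F k)\<^sup>2 = (\<Sum>w | length w = k. (cmod (F w))\<^sup>2)"
  by (simp add: hnorm_def L2_set_def sum_nonneg)

lemma hnorm_triangle: "hnorm (\<lambda>w. F w + G w) k \<le> hnorm F k + hnorm G k"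
proof -
  have "hnorm (\<lambda>w. F w + G w) k \<le> L2_set (\<lambda>w. cmod (F w) + cmod (G w)) {w. length w = k}"
    unfolding hnorm_def by (rule L2_set_mono) (simp_all add: norm_triangle_ineq)
  also have "\<dots> \<le> hnorm F k + hnorm G k"
    unfolding hnorm_def by (rule L2_set_triangle_ineq)
  finally show ?thesis .
qed

lemma hnorm_scale: "hnorm (\<lambda>w. c * F w) k = cmod c * hnorm F k"
  by (simp add: hnorm_def norm_mult L2_set_right_distrib)

lemma hnorm_cong: "(\<And>w. length w = k \<Longrightarrow> F w = G w) \<Longrightarrow> hnorm F k = hnorm G k"
  unfolding hnorm_def by (rule L2_set_cong) simp_all

lemma hnorm_zero [simp]: "hnorm (\<lambda>w. 0) k = 0"
  by (simp add: hnorm_def L2_set_def)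

lemma hnorm_dilate: "hnorm (\<lambda>w. complex_of_real (x ^ length w) * F w) k = \<bar>x\<bar> ^ k * hnorm F k"
proof -
  have "hnorm (\<lambda>w. complex_of_real (x ^ length w) * F w) k
      = hnorm (\<lambda>w. complex_of_real (x ^ k) * F w) k"
    by (rule hnorm_cong) simp
  then show ?thesis
    by (simp add: hnorm_scale norm_power power_abs)
qed

lemma word_op_Nil [simp]: "word_op T [] = id_blinfun"
  and word_op_Cons [simp]: "word_op T (i # w) = T i o\<^sub>L word_op T w"
  by (simp_all add: word_op_def)

lemma word_op_scaleC:
  assumes "\<And>i. T i \<in> bounded_ops"
  shows "word_op T w (c *\<^sub>C x) = c *\<^sub>C word_op T w x"
  using assms by (induction w) (simp_all add: bounded_ops_def)

text \<open>The row of all words of length \<open>k\<close> factors into \<open>k\<close> rows, one for each letter, each of which multiplies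
the bound by \<open>M\<close>.\<close>

lemma row_power_bound:
  fixes T :: "'d::finite \<Rightarrow> ('h::complex_hilbert \<Rightarrow>\<^sub>L 'h)"
  assumes row: "\<And>h. (norm (\<Sum>i\<in>UNIV. T i (h i)))\<^sup>2 \<le> M * (\<Sum>i\<in>UNIV. (norm (h i))\<^sup>2)" and "0 \<le> M"
  shows "(norm (\<Sum>w | length w = k. word_op T w (h w)))\<^sup>2 \<le> M ^ k * (\<Sum>w | length w = k. (norm (h w))\<^sup>2)"
proof (induction k arbitrary: h)
  case 0
  show ?case by simp
next
  case (Suc k)
  have "(norm (\<Sum>w | length w = Suc k. word_op T w (h w)))\<^sup>2
      = (norm (\<Sum>i\<in>UNIV. T i (\<Sum>v | length v = k. word_op T v (h (i # v)))))\<^sup>2"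
    by (simp add: sum_words_Suc blinfun.sum_right)
  also have "\<dots> \<le> M * (\<Sum>i\<in>UNIV. (norm (\<Sum>v | length v = k. word_op T v (h (i # v))))\<^sup>2)"
    by (rule row)
  also have "\<dots> \<le> M * (\<Sum>i\<in>UNIV. M ^ k * (\<Sum>v | length v = k. (norm (h (i # v)))\<^sup>2))"
    by (intro mult_left_mono sum_mono Suc.IH \<open>0 \<le> M\<close>)
  also have "\<dots> = M ^ Suc k * (\<Sum>w | length w = Suc k. (norm (h w))\<^sup>2)"
    by (simp add: sum_words_Suc sum_distrib_left mult.assoc)
  finally show ?case .
qed

lemma blinfun_scaleC_left [simp]: "blinfun_apply (c *\<^sub>C T) x = c *\<^sub>C blinfun_apply T x"
  by transfer simp

lemma norm_homog_eval_le:
  fixes T :: "'d::finite \<Rightarrow> ('h::complex_hilbert \<Rightarrow>\<^sub>L 'h)"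
  assumes T: "\<And>i. T i \<in> bounded_ops" and "0 \<le> x"
    and row: "\<And>h. (norm (\<Sum>i\<in>UNIV. T i (h i)))\<^sup>2 \<le> x\<^sup>2 * (\<Sum>i\<in>UNIV. (norm (h i))\<^sup>2)"
  shows "norm (homog_eval F T k) \<le> x ^ k * hnorm F k"
proof (rule norm_blinfun_bound)
  fix h
  have "homog_eval F T k h = (\<Sum>w | length w = k. word_op T w (F w *\<^sub>C h))"
    by (simp add: homog_eval_def blinfun.sum_left word_op_scaleC[OF T])
  then have "(norm (homog_eval F T k h))\<^sup>2 \<le> (x\<^sup>2) ^ k * (\<Sum>w | length w = k. (norm (F w *\<^sub>C h))\<^sup>2)"
    using row_power_bound[OF row zero_le_power2, where k = k and h = "\<lambda>w. F w *\<^sub>C h"] by simp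
  also have "\<dots> = (x ^ k * hnorm F k * norm h)\<^sup>2"
    by (simp add: norm_scaleC power_mult_distrib hnorm_square sum_distrib_right mult.assoc
        flip: power_mult power_even_eq) (simp add: mult.commute)
  finally show "norm (homog_eval F T k h) \<le> x ^ k * hnorm F k * norm h"
    by (rule power2_le_imp_le) (use \<open>0 \<le> x\<close> in simp)
qed (use \<open>0 \<le> x\<close> in simp)

lemma creation_apply [simp]: "blinfun_apply (creation j) = create_vec j"
  by (rule creation.rep_eq)

lemma creation_bounded_ops: "creation j \<in> bounded_ops"
proof -
  have "create_vec j (c *\<^sub>C x) = c *\<^sub>C create_vec j x" for c x
    by transfer (auto simp: fun_eq_iff split: list.splits)
  then show ?thesis by (simp add: bounded_ops_def)
qed

text \<open>The creation operators are isometries with orthogonal ranges.\<close>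

lemma creation_row:
  fixes h :: "'d::finite \<Rightarrow> 'd fock"
  shows "(norm (\<Sum>i\<in>UNIV. creation i (h i)))\<^sup>2 = (\<Sum>i\<in>UNIV. (norm (h i))\<^sup>2)"
proof -
  have "inner (create_vec i x) (create_vec j y) = 0" if "i \<noteq> j" for i j and x y :: "'d fock"
  proof -
    have "fock_cinner (create_vec i x) (create_vec j y) = 0"
      unfolding fock_cinner.rep_eq
      by (rule infsum_0) (use that in \<open>auto simp: create_vec.rep_eq split: list.splits\<close>)
    then show ?thesis by (simp add: inner_fock_def)
  qed
  then have "(norm (\<Sum>i\<in>UNIV. create_vec i (h i)))\<^sup>2 = (\<Sum>i\<in>UNIV. (norm (create_vec i (h i)))\<^sup>2)"
    by (intro norm_sum_Pythagorean) (simp_all add: pairwise_def orthogonal_def)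
  then show ?thesis
    by (simp add: norm_create_vec)
qed

lemma norm_homog_eval_creation_le: "norm (homog_eval F creation k) \<le> hnorm F k"
proof -
  have "norm (homog_eval F creation k) \<le> 1 ^ k * hnorm F k"
    by (rule norm_homog_eval_le) (simp_all only: creation_bounded_ops creation_row, simp_all)
  then show ?thesis by simp
qed

lemma word_op_creation_basis: "word_op creation u (fock_basis v) = fock_basis (u @ v)"
  by (induction u) (simp_all add: create_vec_basis)

lemma fock_coeff_simps [simp]:
  "fock_coeff (x + y) w = fock_coeff x w + fock_coeff y w"
  "fock_coeff (x - y) w = fock_coeff x w - fock_coeff y w"
  "fock_coeff 0 w = 0"
  "fock_coeff (- x) w = - fock_coeff x w"
  "fock_coeff (c *\<^sub>C x) w = c * fock_coeff x w"
  "fock_coeff (r *\<^sub>R x) w = complex_of_real r * fock_coeff x w"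
  "fock_coeff (fock_basis v) w = of_bool (w = v)"
  by (transfer; simp)+

lemma fock_coeff_sum [simp]: "fock_coeff (\<Sum>i\<in>A. f i) w = (\<Sum>i\<in>A. fock_coeff (f i) w)"
  by (induction A rule: infinite_finite_induct) simp_all

lemma bounded_linear_fock_coeff: "bounded_linear (\<lambda>x. fock_coeff x w)"
  by (rule bounded_linear_intro[where K = 1])
    (simp_all add: norm_fock_coeff_le scaleR_conv_of_real)

lemma hnorm_fock_coeff_le: "hnorm (fock_coeff x) k \<le> norm x"
  by (rule power2_le_imp_le)
    (simp_all add: hnorm_square sum_le_norm_fock_square)

text \<open>The second claim is the Gram-Schmidt step for the construction of an orthonormal sequence.\<close>

lemma bessel_finite:
  fixes e :: "'i \<Rightarrow> 'h::complex_hilbert"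
  assumes "finite I" and e: "\<And>i j. i \<in> I \<Longrightarrow> j \<in> I \<Longrightarrow> cinner (e i) (e j) = of_bool (i = j)"
  shows "(\<Sum>i\<in>I. (cmod (cinner h (e i)))\<^sup>2) \<le> (norm h)\<^sup>2"
    and "j \<in> I \<Longrightarrow> cinner (h - (\<Sum>i\<in>I. cinner h (e i) *\<^sub>C e i)) (e j) = 0"
proof -
  define u where "u = h - (\<Sum>i\<in>I. cinner h (e i) *\<^sub>C e i)"
  have u: "cinner u (e j) = 0" if "j \<in> I" for j
  proof -
    have "cinner u (e j) = cinner h (e j) - (\<Sum>i\<in>I. cinner h (e i) * cinner (e i) (e j))"
      by (simp add: u_def cinner_diff_left cinner_sum_left cinner_scaleC_left)
    also have "(\<Sum>i\<in>I. cinner h (e i) * cinner (e i) (e j)) = (\<Sum>i\<in>I. if i = j then cinner h (e i) else 0)"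
      by (rule sum.cong) (simp_all add: e that)
    finally show ?thesis
      using that \<open>finite I\<close> by simp
  qed
  then show "j \<in> I \<Longrightarrow> cinner (h - (\<Sum>i\<in>I. cinner h (e i) *\<^sub>C e i)) (e j) = 0"
    by (simp add: u_def)
  have "cinner (\<Sum>i\<in>I. cinner h (e i) *\<^sub>C e i) u = 0"
    by (simp add: cinner_sum_left cinner_scaleC_left)
      (rule sum.neutral, use u in \<open>metis cinner_commute complex_cnj_zero mult_zero_right\<close>)
  then have "cinner u u = cinner h u"
    by (simp add: u_def cinner_diff_left)
  also have "\<dots> = cnj (cinner u h)"
    by (rule cinner_commute)
  also have "cinner u h = cinner h h - (\<Sum>i\<in>I. cinner h (e i) * cnj (cinner h (e i)))"
    by (simp add: u_def cinner_diff_left cinner_sum_left cinner_scaleC_left cinner_commute[of "e _" h])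
  finally have "cinner u u = cnj (complex_of_real ((norm h)\<^sup>2 - (\<Sum>i\<in>I. (cmod (cinner h (e i)))\<^sup>2)))"
    by (simp only: cinner_self of_real_diff of_real_sum complex_norm_square)
  then have "(norm u)\<^sup>2 = (norm h)\<^sup>2 - (\<Sum>i\<in>I. (cmod (cinner h (e i)))\<^sup>2)"
    unfolding cinner_self complex_cnj_complex_of_real of_real_eq_iff .
  then show "(\<Sum>i\<in>I. (cmod (cinner h (e i)))\<^sup>2) \<le> (norm h)\<^sup>2"
    by (metis diff_ge_0_iff_ge zero_le_power2)
qed

section \<open>A copy of the creation operators on an infinite-dimensional space\<close>

locale infinite_dimensional =
  fixes H :: "'h::complex_hilbert itself"
  assumes infinite_dim: "\<not> (\<exists>B :: 'h set. finite B \<and> complex_vector.span B = UNIV)"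
begin

lemma ex_orthonormal_sequence:
  obtains e :: "nat \<Rightarrow> 'h" where "\<And>i j. cinner (e i) (e j) = of_bool (i = j)"
proof -
  define P where "P n e v \<longleftrightarrow> norm v = 1 \<and> (\<forall>i<n. cinner v (e i) = 0)"
    for n :: nat and e and v :: 'h
  have ortho: "cinner (e i) (e j) = of_bool (i = j)"
    if "\<And>m. m < n \<Longrightarrow> P m e (e m)" "i < n" "j < n" for n e i j
  proof (cases i j rule: linorder_cases)
    case less
    then have "cinner (e j) (e i) = 0" using that(1)[of j] that by (simp add: P_def)
    then show ?thesis using less cinner_commute[of "e i" "e j"] by simp
  next
    case equal
    then show ?thesis using that(1)[of j] that by (simp add: P_def cinner_self)
  next
    case greater
    then show ?thesis using that(1)[of i] that by (simp add: P_def)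
  qed
  have "\<exists>e. \<forall>n. P n e (e n)"
  proof (rule dependent_wellorder_choice)
    fix n :: nat and e :: "nat \<Rightarrow> 'h"
    assume *: "\<And>m. m < n \<Longrightarrow> P m e (e m)"
    obtain v where v: "v \<notin> complex_vector.span (e ` {..<n})"
      using infinite_dim by (metis UNIV_eq_I finite_imageI finite_lessThan)
    define u where "u = v - (\<Sum>i<n. cinner v (e i) *\<^sub>C e i)"
    have "(\<Sum>i<n. cinner v (e i) *\<^sub>C e i) \<in> complex_vector.span (e ` {..<n})"
      by (intro complex_vector.span_sum complex_vector.span_scale complex_vector.span_base) simp
    then have "u \<noteq> 0" using v by (auto simp: u_def)
    have "cinner u (e j) = 0" if "j < n" for j
      unfolding u_def by (rule bessel_finite(2)) (use ortho[OF *] that in auto)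
    then have "P n e (complex_of_real (inverse (norm u)) *\<^sub>C u)"
      using \<open>u \<noteq> 0\<close> by (simp add: P_def norm_scaleC cinner_scaleC_left norm_inverse)
    then show "\<exists>v. P n e v" by blast
  qed (auto simp: P_def)
  then obtain e where e: "\<And>n. P n e (e n)" by blast
  have "cinner (e i) (e j) = of_bool (i = j)" for i j
    by (rule ortho[of "Suc (max i j)"]) (simp_all add: e)
  then show thesis by (rule that)
qed

text \<open>An orthonormal family \<open>e\<^sub>w\<close> in \<open>H\<close> indexed by words gives the contraction \<open>B : h \<mapsto> (\<langle>h, e\<^sub>w\<rangle>)\<^sub>w\<close> onto the Fock
space, whose adjoint is the isometry \<open>S\<close> sending the word basis to \<open>e\<^sub>w\<close>. The operators \<open>S s\<^sub>i B\<close> copy the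
creation operators \<open>s\<^sub>i\<close>. The vector \<open>e\<close> is the vacuum, and \<open>B\<close> reads off the
coefficients of a series evaluated at this row and applied to \<open>e\<close>. A single row that
serves all degrees is essential, because membership in the space of free holomorphic functions is a
condition on each row separately.\<close>

lemma ex_shift_model:
  obtains T :: "'d::finite \<Rightarrow> ('h \<Rightarrow>\<^sub>L 'h)" and B :: "'h \<Rightarrow>\<^sub>L 'd fock" and e where
    "\<And>i. T i \<in> bounded_ops" "\<And>h. (norm (\<Sum>i\<in>UNIV. T i (h i)))\<^sup>2 \<le> (\<Sum>i\<in>UNIV. (norm (h i))\<^sup>2)"
    "\<And>x. norm (B x) \<le> norm x" "\<And>c x. B (c *\<^sub>C x) = c *\<^sub>C B x" "norm e = 1"
    "\<And>w. B (word_op T w e) = fock_basis w"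
proof -
  obtain e' :: "nat \<Rightarrow> 'h" where e': "\<And>i j. cinner (e' i) (e' j) = of_bool (i = j)"
    using ex_orthonormal_sequence by metis
  define e where "e w = e' (to_nat w)" for w :: "'d list"
  have e: "cinner (e v) (e w) = of_bool (v = w)" for v w
    by (simp add: e_def e')
  have bessel: "(\<Sum>w\<in>A. (cmod (cinner h (e w)))\<^sup>2) \<le> (norm h)\<^sup>2" if "finite A" for A h
    by (rule bessel_finite(1)) (use that e in auto)
  have sum: "(\<lambda>w. (cmod (cinner h (e w)))\<^sup>2) summable_on UNIV" for h
    by (rule nonneg_bdd_above_summable_on)
      (auto intro!: bdd_aboveI2[of _ _ "(norm h)\<^sup>2"] bessel)
  define b where "b h = Abs_fock (\<lambda>w. cinner h (e w))" for h
  have b: "fock_coeff (b h) w = cinner h (e w)" for h w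
    unfolding b_def using sum by (subst Abs_fock_inverse) simp_all
  have eqI: "x = y" if "\<And>w. fock_coeff x w = fock_coeff y w" for x y :: "'d fock"
    using that by (simp add: fun_eq_iff flip: fock_coeff_inject)
  have norm_b: "norm (b h) \<le> norm h" for h
  proof (rule power2_le_imp_le)
    show "(norm (b h))\<^sup>2 \<le> (norm h)\<^sup>2"
      unfolding norm_fock_square b by (rule infsum_le_finite_sums[OF sum]) (simp add: bessel)
  qed simp
  have "bounded_linear b"
  proof (rule bounded_linear_intro[where K = 1])
    show "b (x + y) = b x + b y" for x y
      by (rule eqI) (simp add: b cinner_add_left)
    show "b (r *\<^sub>R x) = r *\<^sub>R b x" for r x
      by (rule eqI) (simp add: b cinner_scaleC_left flip: scaleC_of_real)
  qed (simp add: norm_b)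
  define B where "B = Blinfun b"
  have B: "blinfun_apply B = b"
    unfolding B_def by (rule bounded_linear_Blinfun_apply) fact
  have lin: "B (c *\<^sub>C x) = c *\<^sub>C B x" for c x
    by (rule eqI) (simp add: B b cinner_scaleC_left)
  obtain S :: "'d fock \<Rightarrow>\<^sub>L 'h" where S: "\<And>x y. cinner (B x) y = cinner x (S y)"
    and S_lin: "\<And>c y. S (c *\<^sub>C y) = c *\<^sub>C S y" and "norm S \<le> norm B"
    by (rule adjoint_exists[OF lin], rule that)
  have "norm B \<le> 1"
    by (rule norm_blinfun_bound) (simp_all add: B norm_b)
  then have norm_S: "norm (S x) \<le> norm x" for x
    using norm_blinfun[of S x] \<open>norm S \<le> norm B\<close> mult_right_mono[of "norm S" 1 "norm x"] by simp
  have Be: "B (e w) = fock_basis w" for w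
    by (rule eqI) (simp add: B b e eq_commute)
  have basis: "cinner x (fock_basis w) = fock_coeff x w" for x and w :: "'d list"
  proof -
    have "cinner x (fock_basis w) = (\<Sum>\<^sub>\<infinity>v\<in>{w}. fock_coeff x v * cnj (of_bool (v = w)))"
      unfolding cinner_fock_def fock_cinner.rep_eq
      by (rule infsum_cong_neutral) auto
    then show ?thesis by simp
  qed
  have Se: "S (fock_basis w) = e w" for w
  proof -
    have "inner x (S (fock_basis w)) = inner x (e w)" for x
      by (simp add: inner_eq_Re_cinner basis B b flip: S)
    then show ?thesis using vector_eq_ldot by blast
  qed
  define T where "T i = S o\<^sub>L creation i o\<^sub>L B" for i
  show thesis
  proof (rule that[of T B "e []"])
    show "T i \<in> bounded_ops" for i
      using creation_bounded_ops[of i] by (simp add: T_def bounded_ops_def lin S_lin)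
    show "(norm (\<Sum>i\<in>UNIV. T i (h i)))\<^sup>2 \<le> (\<Sum>i\<in>UNIV. (norm (h i))\<^sup>2)" for h
    proof -
      have "(norm (\<Sum>i\<in>UNIV. T i (h i)))\<^sup>2 = (norm (S (\<Sum>i\<in>UNIV. creation i (B (h i)))))\<^sup>2"
        by (simp add: T_def blinfun.sum_right)
      also have "\<dots> \<le> (norm (\<Sum>i\<in>UNIV. creation i (B (h i))))\<^sup>2"
        by (intro power_mono norm_S) simp
      also have "\<dots> = (\<Sum>i\<in>UNIV. (norm (B (h i)))\<^sup>2)"
        by (rule creation_row)
      also have "\<dots> \<le> (\<Sum>i\<in>UNIV. (norm (h i))\<^sup>2)"
        by (intro sum_mono power_mono) (simp_all add: B norm_b)
      finally show ?thesis .
    qed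
    have "word_op T w (e []) = e w" for w
      by (induction w) (simp_all add: T_def Be Se create_vec_basis)
    then show "B (word_op T w (e [])) = fock_basis w" for w
      by (simp add: Be)
    show "norm (e []) = 1"
      using e[of "[]" "[]"] norm_ge_zero[of "e []"]
      by (auto simp: cinner_self power2_eq_1_iff simp flip: of_real_power)
  qed (use lin in \<open>simp_all add: B norm_b\<close>)
qed

end

section \<open>Free holomorphic functions through weighted norms\<close>

definition wnorm :: "real \<Rightarrow> ('d::finite list \<Rightarrow> complex) \<Rightarrow> real"
  where "wnorm x F = (\<Sum>k. x ^ k * hnorm F k)"

text \<open>The condition on the coefficients that characterises free holomorphic functions on the ball of radius \<open>r\<close>,
independently of \<open>H\<close>. Boundedness for all \<open>x < r\<close> implies summability for all \<open>x < r\<close> and is easier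
to verify.\<close>

definition has_radius :: "real \<Rightarrow> ('d::finite list \<Rightarrow> complex) \<Rightarrow> bool"
  where "has_radius r F \<longleftrightarrow> (\<forall>x. 0 < x \<longrightarrow> x < r \<longrightarrow> (\<exists>C. \<forall>k. x ^ k * hnorm F k \<le> C))"

text \<open>Passing from radius \<open>y\<close> to a smaller radius \<open>x\<close> turns a supremum over the degrees into a convergent sum. All
comparisons between the various families of norms rest on this.\<close>

lemma geometric_bound:
  assumes "0 < x" "x < y" and C: "\<And>k. y ^ k * hnorm F k \<le> C"
  shows "summable (\<lambda>k. x ^ k * hnorm F k)" and "wnorm x F \<le> C / (1 - x / y)"
proof -
  have le: "x ^ k * hnorm F k \<le> C * (x / y) ^ k" for k
  proof -
    have "x ^ k * hnorm F k = (y ^ k * hnorm F k) * (x / y) ^ k"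
      using assms by (simp add: power_divide)
    also have "\<dots> \<le> C * (x / y) ^ k"
      using assms by (intro mult_right_mono C) simp
    finally show ?thesis .
  qed
  have "(\<lambda>k. (x / y) ^ k) sums (1 / (1 - x / y))"
    using assms by (intro geometric_sums) simp
  then have g: "(\<lambda>k. C * (x / y) ^ k) sums (C / (1 - x / y))"
    using sums_mult[of _ _ C] by fastforce
  show s: "summable (\<lambda>k. x ^ k * hnorm F k)"
    by (rule summable_comparison_test'[OF sums_summable[OF g]]) (use le assms in simp)
  show "wnorm x F \<le> C / (1 - x / y)"
    unfolding wnorm_def sums_unique[OF g] by (rule suminf_le[OF le s sums_summable[OF g]])
qed

lemma has_radius_summable:
  assumes "has_radius r F" "0 < x" "x < r"
  shows "summable (\<lambda>k. x ^ k * hnorm F k)"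
proof -
  obtain y where y: "x < y" "y < r"
    using dense[OF assms(3)] by blast
  then obtain C where "\<And>k. y ^ k * hnorm F k \<le> C"
    using assms unfolding has_radius_def by (meson less_trans)
  then show ?thesis
    using geometric_bound(1) assms y by blast
qed

lemma has_radiusI:
  assumes "\<And>x. 0 < x \<Longrightarrow> x < r \<Longrightarrow> summable (\<lambda>k. x ^ k * hnorm F k)"
  shows "has_radius r F"
  unfolding has_radius_def
proof (intro allI impI)
  fix x assume "0 < x" "x < r"
  then have s: "summable (\<lambda>k. x ^ k * hnorm F k)" by (rule assms)
  have "x ^ k * hnorm F k \<le> wnorm x F" for k
    using sum_le_suminf[OF s, of "{k}"] \<open>0 < x\<close> by (simp add: wnorm_def)
  then show "\<exists>C. \<forall>k. x ^ k * hnorm F k \<le> C" by blast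
qed

lemma term_le_wnorm:
  assumes "has_radius r F" "0 < x" "x < r"
  shows "x ^ k * hnorm F k \<le> wnorm x F"
  using sum_le_suminf[OF has_radius_summable[OF assms], of "{k}"] assms by (simp add: wnorm_def)

lemma has_radius_add:
  assumes "has_radius r F" "has_radius r G"
  shows "has_radius r (\<lambda>w. F w + G w)"
    and "0 < x \<Longrightarrow> x < r \<Longrightarrow> wnorm x (\<lambda>w. F w + G w) \<le> wnorm x F + wnorm x G"
proof -
  have le: "x ^ k * hnorm (\<lambda>w. F w + G w) k \<le> x ^ k * hnorm F k + x ^ k * hnorm G k" if "0 < x" for x k
    using mult_left_mono[OF hnorm_triangle, of "x ^ k"] that by (simp add: distrib_left)
  have s: "summable (\<lambda>k. x ^ k * hnorm F k + x ^ k * hnorm G k)" if "0 < x" "x < r" for x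
    using assms that by (intro summable_add has_radius_summable)
  have s': "summable (\<lambda>k. x ^ k * hnorm (\<lambda>w. F w + G w) k)" if "0 < x" "x < r" for x
    by (rule summable_comparison_test'[OF s[OF that]]) (use le that in simp)
  then show "has_radius r (\<lambda>w. F w + G w)" by (rule has_radiusI)
  assume x: "0 < x" "x < r"
  show "wnorm x (\<lambda>w. F w + G w) \<le> wnorm x F + wnorm x G"
    unfolding wnorm_def
    by (subst suminf_add) (use assms x in \<open>auto intro!: has_radius_summable suminf_le le s s'\<close>)
qed

lemma has_radius_scale:
  assumes "has_radius r F"
  shows "has_radius r (\<lambda>w. c * F w)"
    and "0 < x \<Longrightarrow> x < r \<Longrightarrow> wnorm x (\<lambda>w. c * F w) = cmod c * wnorm x F"
proof -
  have eq: "x ^ k * hnorm (\<lambda>w. c * F w) k = cmod c * (x ^ k * hnorm F k)" for x k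
    by (simp add: hnorm_scale)
  show "has_radius r (\<lambda>w. c * F w)"
    by (rule has_radiusI) (simp add: eq summable_mult has_radius_summable[OF assms])
  show "wnorm x (\<lambda>w. c * F w) = cmod c * wnorm x F" if "0 < x" "x < r"
    unfolding wnorm_def eq by (rule suminf_mult[OF has_radius_summable[OF assms that]])
qed

lemma wnorm_mono:
  assumes "has_radius r F" "0 < x" "x \<le> y" "y < r"
  shows "wnorm x F \<le> wnorm y F"
  unfolding wnorm_def
  by (rule suminf_le)
    (use assms in \<open>auto intro!: mult_right_mono power_mono has_radius_summable\<close>)

lemma blinfun_scaleC_compose [simp]:
  "(c *\<^sub>C S) o\<^sub>L T = c *\<^sub>C (S o\<^sub>L T)"
  by (rule blinfun_eqI) simp

lemma homog_eval_dilate: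
  assumes T: "\<And>i. T i \<in> bounded_ops"
  shows "homog_eval F (\<lambda>i. complex_of_real t *\<^sub>C T i) k = complex_of_real (t ^ k) *\<^sub>C homog_eval F T k"
proof -
  have "word_op (\<lambda>i. complex_of_real t *\<^sub>C T i) w = complex_of_real (t ^ length w) *\<^sub>C word_op T w" for w
    by (induction w) (use T in \<open>auto intro!: blinfun_eqI simp: bounded_ops_def scaleC_scaleC mult.commute\<close>)
  then show ?thesis
    unfolding homog_eval_def complex_vector.scale_sum_right
    by (intro sum.cong) (simp_all add: scaleC_scaleC mult.commute)
qed

lemma zero_mem_row_ball:
  "0 < x \<Longrightarrow> (\<lambda>i. 0) \<in> (row_ball x :: ('d::finite \<Rightarrow> ('h::complex_hilbert \<Rightarrow>\<^sub>L 'h)) set)"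
proof -
  assume "0 < x"
  have "(\<Sum>i\<in>(UNIV::'d set). 0 o\<^sub>L hilbert_adjoint 0 :: 'h \<Rightarrow>\<^sub>L 'h) = 0"
    by (intro sum.neutral ballI blinfun_eqI) simp
  then show ?thesis
    using \<open>0 < x\<close> by (simp add: row_ball_def bounded_ops_def)
qed

text \<open>The strict inequality in the definition of the row ball leaves room for a bound \<open>x < r\<close>, which is what
makes the series converge absolutely.\<close>

lemma row_ball_iff:
  fixes T :: "'d::finite \<Rightarrow> ('h::complex_hilbert \<Rightarrow>\<^sub>L 'h)"
  assumes "0 < r"
  shows "T \<in> row_ball r \<longleftrightarrow> (\<forall>i. T i \<in> bounded_ops) \<and>
    (\<exists>x>0. x < r \<and> (\<forall>h. (norm (\<Sum>i\<in>UNIV. T i (h i)))\<^sup>2 \<le> x\<^sup>2 * (\<Sum>i\<in>UNIV. (norm (h i))\<^sup>2)))"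
    (is "_ \<longleftrightarrow> ?B \<and> ?E")
proof
  assume T: "T \<in> row_ball r"
  define M where "M = norm (\<Sum>i\<in>UNIV. T i o\<^sub>L hilbert_adjoint (T i))"
  have B: ?B and M: "M < r\<^sup>2"
    using T by (auto simp: row_ball_def M_def)
  \<comment> \<open>The second argument only keeps \<open>x\<close> positive when \<open>T = 0\<close>.\<close>
  define x where "x = max (sqrt M) (r / 2)"
  have "sqrt M < r"
    using M \<open>0 < r\<close> by (simp add: real_less_lsqrt M_def)
  then have x: "0 < x" "x < r"
    using \<open>0 < r\<close> by (auto simp: x_def)
  have "M = (sqrt M)\<^sup>2" by (simp add: M_def)
  also have "\<dots> \<le> x\<^sup>2" by (rule power_mono) (simp_all add: x_def M_def)
  finally have "\<forall>h. (norm (\<Sum>i\<in>UNIV. T i (h i)))\<^sup>2 \<le> x\<^sup>2 * (\<Sum>i\<in>UNIV. (norm (h i))\<^sup>2)"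
    using row_norm_le_iff[of T "x\<^sup>2"] B by (simp add: M_def)
  then show "?B \<and> ?E"
    using B x by blast
next
  assume *: "?B \<and> ?E"
  then obtain x where x: "0 < x" "x < r"
    and "\<forall>h. (norm (\<Sum>i\<in>UNIV. T i (h i)))\<^sup>2 \<le> x\<^sup>2 * (\<Sum>i\<in>UNIV. (norm (h i))\<^sup>2)"
    by blast
  then have "norm (\<Sum>i\<in>UNIV. T i o\<^sub>L hilbert_adjoint (T i)) \<le> x\<^sup>2"
    using row_norm_le_iff[of T "x\<^sup>2"] * by simp
  also have "\<dots> < r\<^sup>2"
    using x by (simp add: power_strict_mono)
  finally show "T \<in> row_ball r"
    using * by (simp add: row_ball_def)
qed

lemma row_ball_homog_eval:
  fixes T :: "'d::finite \<Rightarrow> ('h::complex_hilbert \<Rightarrow>\<^sub>L 'h)"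
  assumes "T \<in> row_ball r" "0 < r"
  obtains x where "0 < x" "x < r" "\<And>F k. norm (homog_eval F T k) \<le> x ^ k * hnorm F k"
proof -
  obtain x where T: "\<And>i. T i \<in> bounded_ops" and x: "0 < x" "x < r"
    and "\<And>h. (norm (\<Sum>i\<in>UNIV. T i (h i)))\<^sup>2 \<le> x\<^sup>2 * (\<Sum>i\<in>UNIV. (norm (h i))\<^sup>2)"
    using assms by (auto simp: row_ball_iff)
  then show thesis
    using norm_homog_eval_le[of T x] by (intro that[of x]) auto
qed

lemma homog_eval_add: "homog_eval (\<lambda>w. F w + G w) T k = homog_eval F T k + homog_eval G T k"
  by (simp add: homog_eval_def scaleC_add_left sum.distrib)

lemma free_hol_summable:
  fixes F :: "'d::finite list \<Rightarrow> complex" and H :: "'h::complex_hilbert itself"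
    and T :: "'d \<Rightarrow> ('h \<Rightarrow>\<^sub>L 'h)"
  assumes "has_radius r F" "T \<in> row_ball x" "0 < x" "x \<le> r"
  shows "summable (\<lambda>k. norm (homog_eval F T k))"
    and "x < r \<Longrightarrow> norm (\<Sum>k. homog_eval F T k) \<le> wnorm x F"
proof -
  obtain y where y: "0 < y" "y < x" "\<And>F k. norm (homog_eval F T k) \<le> y ^ k * hnorm F k"
    using row_ball_homog_eval[OF assms(2,3)] by blast
  have s: "summable (\<lambda>k. y ^ k * hnorm F k)"
    using assms y by (intro has_radius_summable[of r]) auto
  show sn: "summable (\<lambda>k. norm (homog_eval F T k))"
    by (rule summable_comparison_test'[OF s]) (use y in simp)
  assume "x < r"
  have "norm (\<Sum>k. homog_eval F T k) \<le> (\<Sum>k. norm (homog_eval F T k))"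
    by (rule summable_norm[OF sn])
  also have "\<dots> \<le> wnorm y F"
    unfolding wnorm_def by (intro suminf_le y sn s)
  also have "\<dots> \<le> wnorm x F"
    by (rule wnorm_mono[OF assms(1)]) (use y \<open>x < r\<close> in auto)
  finally show "norm (\<Sum>k. homog_eval F T k) \<le> wnorm x F" .
qed

context infinite_dimensional
begin

text \<open>Applied to the vacuum, \<open>F(t S)\<close> yields the vector with coefficients \<open>t^\<bar>w\<bar> F w\<close>, and its part of degree \<open>k\<close>
has norm \<open>t^k \<parallel>F\<parallel>\<^sub>k\<close>.\<close>

lemma row_ball_lower_bound:
  assumes "0 < t"
  obtains T :: "'d::finite \<Rightarrow> ('h \<Rightarrow>\<^sub>L 'h)" where "\<And>x. t < x \<Longrightarrow> T \<in> row_ball x"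
    "\<And>F k. t ^ k * hnorm F k \<le> norm (homog_eval F T k)"
    "\<And>F k. summable (\<lambda>k. norm (homog_eval F T k)) \<Longrightarrow> t ^ k * hnorm F k \<le> norm (\<Sum>k. homog_eval F T k)"
proof -
  obtain S :: "'d \<Rightarrow> ('h \<Rightarrow>\<^sub>L 'h)" and B :: "'h \<Rightarrow>\<^sub>L 'd fock" and e where
    S: "\<And>i. S i \<in> bounded_ops"
    and row: "\<And>h. (norm (\<Sum>i\<in>UNIV. S i (h i)))\<^sup>2 \<le> (\<Sum>i\<in>UNIV. (norm (h i))\<^sup>2)"
    and norm_B: "\<And>x. norm (B x) \<le> norm x" and lin: "\<And>c x. B (c *\<^sub>C x) = c *\<^sub>C B x"
    and e: "norm e = 1" and Be: "\<And>w. B (word_op S w e) = fock_basis w"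
    by (rule ex_shift_model, rule that)
  define T where "T = (\<lambda>i. complex_of_real t *\<^sub>C S i)"
  define L where "L w A = fock_coeff (B (blinfun_apply A e)) w" for w and A :: "'h \<Rightarrow>\<^sub>L 'h"
  have bl: "bounded_linear (L w)" for w
    unfolding L_def
    by (intro bounded_linear_compose[OF bounded_linear_fock_coeff]
        bounded_linear_compose[OF blinfun.bounded_linear_right] blinfun.bounded_linear_left)
  have L: "L w (homog_eval F T k) = (if length w = k then complex_of_real (t ^ k) * F w else 0)" for w F k
  proof -
    have "B (homog_eval F S k e) = (\<Sum>v | length v = k. F v *\<^sub>C fock_basis v)"
      by (simp add: homog_eval_def blinfun.sum_left blinfun.sum_right lin Be)
    then have "fock_coeff (B (homog_eval F S k e)) w = (\<Sum>v | length v = k. F v * of_bool (w = v))"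
      by simp
    also have "\<dots> = (\<Sum>v | length v = k. if v = w then F v else 0)"
      by (intro sum.cong) auto
    also have "\<dots> = (if length w = k then F w else 0)"
      by (subst sum.delta) simp_all
    finally show ?thesis
      by (simp add: L_def T_def homog_eval_dilate[OF S] lin del: of_real_power)
  qed
  have bound: "t ^ k * hnorm F k \<le> norm A"
    if "\<And>w. length w = k \<Longrightarrow> L w A = complex_of_real (t ^ length w) * F w" for A F k
  proof -
    have "t ^ k * hnorm F k = hnorm (\<lambda>w. complex_of_real (t ^ length w) * F w) k"
      using \<open>0 < t\<close> hnorm_dilate[of t F k] by simp
    also have "\<dots> = hnorm (fock_coeff (B (blinfun_apply A e))) k"
      by (rule hnorm_cong) (simp add: that[unfolded L_def])
    also have "\<dots> \<le> norm (B (blinfun_apply A e))"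
      by (rule hnorm_fock_coeff_le)
    also have "\<dots> \<le> norm (blinfun_apply A e)"
      by (rule norm_B)
    also have "\<dots> \<le> norm A"
      using norm_blinfun[of A e] e by simp
    finally show ?thesis .
  qed
  show thesis
  proof (rule that[of T])
    show "T \<in> row_ball x" if "t < x" for x
    proof -
      have "(norm (\<Sum>i\<in>UNIV. T i (h i)))\<^sup>2 \<le> t\<^sup>2 * (\<Sum>i\<in>UNIV. (norm (h i))\<^sup>2)" for h
      proof -
        have "(\<Sum>i\<in>UNIV. T i (h i)) = complex_of_real t *\<^sub>C (\<Sum>i\<in>UNIV. S i (h i))"
          by (simp add: T_def complex_vector.scale_sum_right)
        then show ?thesis
          using row by (simp add: norm_scaleC power_mult_distrib mult_left_mono)
      qed
      moreover have "T i \<in> bounded_ops" for i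
        using S[of i] by (simp add: T_def bounded_ops_def scaleC_scaleC mult.commute)
      ultimately show ?thesis
        using that \<open>0 < t\<close> by (subst row_ball_iff) auto
    qed
    show "t ^ k * hnorm F k \<le> norm (homog_eval F T k)" for F k
      by (rule bound) (simp add: L)
    show "t ^ k * hnorm F k \<le> norm (\<Sum>k. homog_eval F T k)"
      if "summable (\<lambda>k. norm (homog_eval F T k))" for F k
    proof (rule bound)
      fix w
      have "L w (\<Sum>k. homog_eval F T k) = (\<Sum>k. L w (homog_eval F T k))"
        by (rule bounded_linear.suminf[OF bl summable_norm_cancel[OF that]])
      also have "\<dots> = (\<Sum>k\<in>{length w}. L w (homog_eval F T k))"
        by (rule suminf_finite) (simp_all add: L)
      finally show "L w (\<Sum>k. homog_eval F T k) = complex_of_real (t ^ length w) * F w"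
        by (simp add: L)
    qed
  qed
qed

lemma free_hol_iff:
  fixes F :: "'d::finite list \<Rightarrow> complex"
  assumes "0 < r"
  shows "F \<in> free_hol H r \<longleftrightarrow> has_radius r F"
proof
  assume F: "F \<in> free_hol H r"
  show "has_radius r F"
  proof (rule has_radiusI)
    fix x assume x: "0 < x" "x < r"
    obtain T :: "'d \<Rightarrow> ('h \<Rightarrow>\<^sub>L 'h)" where T: "\<And>y. x < y \<Longrightarrow> T \<in> row_ball y"
      "\<And>F k. x ^ k * hnorm F k \<le> norm (homog_eval F T k)"
      using row_ball_lower_bound[OF x(1)] by metis
    have "summable (\<lambda>k. norm (homog_eval F T k))"
      using F T(1)[OF x(2)] by (simp add: free_hol_def)
    then show "summable (\<lambda>k. x ^ k * hnorm F k)"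
      by (rule summable_comparison_test') (use T x in simp)
  qed
next
  assume "has_radius r F"
  then show "F \<in> free_hol H r"
    using free_hol_summable(1)[of r F] assms by (auto simp: free_hol_def)
qed

text \<open>The second and the fourth bound go in opposite directions and show that the norms \<open>free_norm H x\<close> and \<open>wnorm x\<close>, for
\<open>0 < x < r\<close>, define the same topology.\<close>

lemma free_norm_estimates:
  fixes F :: "'d::finite list \<Rightarrow> complex" and T :: "'d \<Rightarrow> ('h \<Rightarrow>\<^sub>L 'h)"
  assumes F: "F \<in> free_hol H r" and x: "0 < x" "x < r"
  shows "T \<in> row_ball x \<Longrightarrow> norm (\<Sum>k. homog_eval F T k) \<le> free_norm H x F"
    and "free_norm H x F \<le> wnorm x F"
    and "0 < t \<Longrightarrow> t < x \<Longrightarrow> t ^ k * hnorm F k \<le> free_norm H x F"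
    and "0 < t \<Longrightarrow> t < x \<Longrightarrow> wnorm t F \<le> free_norm H x F / (1 - t / ((t + x) / 2))"
proof -
  have sub: "has_radius r F"
    using F x free_hol_iff[of r F] by simp
  have le: "norm (\<Sum>k. homog_eval F T k) \<le> wnorm x F" if "T \<in> row_ball x" for T :: "'d \<Rightarrow> ('h \<Rightarrow>\<^sub>L 'h)"
    using free_hol_summable(2)[OF sub that] x by simp
  have bdd: "bdd_above ((\<lambda>T. norm (\<Sum>k. homog_eval F T k)) ` (row_ball x :: ('d \<Rightarrow> ('h \<Rightarrow>\<^sub>L 'h)) set))"
    using le by (intro bdd_aboveI2)
  have upper: "norm (\<Sum>k. homog_eval F T k) \<le> free_norm H x F" if "T \<in> row_ball x"
    for T :: "'d \<Rightarrow> ('h \<Rightarrow>\<^sub>L 'h)"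
    unfolding free_norm_def by (rule cSUP_upper[OF that bdd])
  then show "T \<in> row_ball x \<Longrightarrow> norm (\<Sum>k. homog_eval F T k) \<le> free_norm H x F" .
  show "free_norm H x F \<le> wnorm x F"
    unfolding free_norm_def using zero_mem_row_ball[OF x(1)] le by (intro cSUP_least) auto
  have lower: "t ^ k * hnorm F k \<le> free_norm H x F" if t: "0 < t" "t < x" for t k
  proof -
    obtain T :: "'d \<Rightarrow> ('h \<Rightarrow>\<^sub>L 'h)" where T: "\<And>y. t < y \<Longrightarrow> T \<in> row_ball y"
      "\<And>F k. summable (\<lambda>k. norm (homog_eval F T k)) \<Longrightarrow> t ^ k * hnorm F k \<le> norm (\<Sum>k. homog_eval F T k)"
      using row_ball_lower_bound[OF t(1)] by metis
    have "summable (\<lambda>k. norm (homog_eval F T k))"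
      using free_hol_summable(1)[OF sub T(1)[OF t(2)]] x by simp
    then show ?thesis
      using T(2) upper[OF T(1)[OF t(2)]] order_trans by blast
  qed
  assume t: "0 < t" "t < x"
  then show "t ^ k * hnorm F k \<le> free_norm H x F"
    by (rule lower)
  show "wnorm t F \<le> free_norm H x F / (1 - t / ((t + x) / 2))"
    by (rule geometric_bound(2)) (use t lower in auto)
qed

lemma free_norm_triangle:
  fixes F G :: "'d::finite list \<Rightarrow> complex"
  assumes F: "F \<in> free_hol H r" and G: "G \<in> free_hol H r" and x: "0 < x" "x < r"
  shows "free_norm H x (\<lambda>w. F w + G w) \<le> free_norm H x F + free_norm H x G"
  unfolding free_norm_def[of H x "\<lambda>w. F w + G w"]
proof (rule cSUP_least)
  fix T :: "'d \<Rightarrow> ('h \<Rightarrow>\<^sub>L 'h)" assume T: "T \<in> row_ball x"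
  have sub: "has_radius r F" "has_radius r G"
    using F G x free_hol_iff[of r F] free_hol_iff[of r G] by simp_all
  have "summable (\<lambda>k. homog_eval F T k)" "summable (\<lambda>k. homog_eval G T k)"
    using free_hol_summable(1)[OF _ T] sub x by (auto intro: summable_norm_cancel)
  then have "(\<Sum>k. homog_eval (\<lambda>w. F w + G w) T k) = (\<Sum>k. homog_eval F T k) + (\<Sum>k. homog_eval G T k)"
    unfolding homog_eval_add by (rule suminf_add[symmetric])
  also have "norm \<dots> \<le> norm (\<Sum>k. homog_eval F T k) + norm (\<Sum>k. homog_eval G T k)"
    by (rule norm_triangle_ineq)
  also have "\<dots> \<le> free_norm H x F + free_norm H x G"
    by (intro add_mono free_norm_estimates(1)[OF F x T] free_norm_estimates(1)[OF G x T])
  finally show "norm (\<Sum>k. homog_eval (\<lambda>w. F w + G w) T k) \<le> free_norm H x F + free_norm H x G" .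
qed (use zero_mem_row_ball[OF x(1)] in auto)

end

section \<open>Elements of the disc algebra as convolution operators\<close>

lemma finite_splits [simp]: "finite {(u, v). u @ v = w}"
proof -
  have "{(u, v). u @ v = w} \<subseteq> (\<lambda>i. (take i w, drop i w)) ` {..length w}"
  proof clarify
    fix u v :: "'a list"
    show "(u, v) \<in> (\<lambda>i. (take i (u @ v), drop i (u @ v))) ` {..length (u @ v)}"
      by (rule image_eqI[of _ _ "length u"]) simp_all
  qed
  then show ?thesis
    by (rule finite_subset) simp
qed

lemma finite_splits' [simp]: "finite {p. fst p @ snd p = w}"
  using finite_splits[of w] by (simp add: case_prod_unfold)

lemma series_mult_assoc:
  "series_mult (series_mult F G) K = series_mult F (series_mult G K)"
proof
  fix w
  have "series_mult (series_mult F G) K w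
      = (\<Sum>(p, v) | p @ v = w. \<Sum>(u, t) | u @ t = p. F u * G t * K v)"
    by (simp add: series_mult_def sum_distrib_right case_prod_unfold)
  also have "\<dots> = (\<Sum>((p, v), (u, t)) \<in> Sigma {(p, v). p @ v = w} (\<lambda>(p, v). {(u, t). u @ t = p}).
      F u * G t * K v)"
    by (subst sum.Sigma[symmetric]) (auto simp: case_prod_unfold)
  also have "\<dots> = (\<Sum>((u, q), (t, v)) \<in> Sigma {(u, q). u @ q = w} (\<lambda>(u, q). {(t, v). t @ v = q}).
      F u * (G t * K v))"
    by (rule sum.reindex_bij_witness[of _ "\<lambda>((u, q), (t, v)). ((u @ t, v), (u, t))"
          "\<lambda>((p, v), (u, t)). ((u, t @ v), (t, v))"]) (auto simp: mult.assoc)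
  also have "\<dots> = (\<Sum>(u, q) | u @ q = w. \<Sum>(t, v) | t @ v = q. F u * (G t * K v))"
    by (subst sum.Sigma[symmetric]) (auto simp: case_prod_unfold)
  also have "\<dots> = series_mult F (series_mult G K) w"
    by (simp add: series_mult_def sum_distrib_left case_prod_unfold)
  finally show "series_mult (series_mult F G) K w = series_mult F (series_mult G K) w" .
qed

lemma series_mult_word:
  "series_mult (\<lambda>w. of_bool (w = p)) G w = (if take (length p) w = p then G (drop (length p) w) else 0)"
proof -
  have "series_mult (\<lambda>w. of_bool (w = p)) G w
      = (\<Sum>z | fst z @ snd z = w. if z = (p, drop (length p) w) then G (drop (length p) w) else 0)"
    unfolding series_mult_def case_prod_unfold by (rule sum.cong) auto
  also have "\<dots> = (if take (length p) w = p then G (drop (length p) w) else 0)"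
    using finite_splits[of w]
    by (subst sum.delta) (auto simp: case_prod_unfold, metis append_eq_conv_conj, metis append_take_drop_id)
  finally show ?thesis .
qed

lemma series_mult_one_left: "series_mult (\<lambda>w. of_bool (w = [])) G = G"
  by (simp add: fun_eq_iff series_mult_word)

lemma series_mult_add_left: "series_mult (\<lambda>w. F w + G w) K w = series_mult F K w + series_mult G K w"
  and series_mult_add_right: "series_mult K (\<lambda>w. F w + G w) w = series_mult K F w + series_mult K G w"
  by (simp_all add: series_mult_def case_prod_unfold algebra_simps sum.distrib)

lemma series_mult_scale_left: "series_mult (\<lambda>w. c * F w) K w = c * series_mult F K w"
  by (simp add: series_mult_def case_prod_unfold sum_distrib_left mult.assoc)

text \<open>Multiplication by a character of the free semigroup is multiplicative on series. The characters
\<open>t^\<bar>w\<bar>\<close> and \<open>cis (\<theta> \<bar>w\<bar>)\<close> give the dilations and the rotations.\<close>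

lemma series_mult_dilate:
  assumes "\<And>u v. \<kappa> (u @ v) = \<kappa> u * \<kappa> v"
  shows "series_mult (\<lambda>w. \<kappa> w * F w) (\<lambda>w. \<kappa> w * G w) w = \<kappa> w * series_mult F G w"
  unfolding series_mult_def sum_distrib_left case_prod_unfold
  by (rule sum.cong) (auto simp: assms mult_ac)

lemma series_mult_finite_support:
  assumes "finite {w. F w \<noteq> 0}" "finite {w. G w \<noteq> 0}"
  shows "finite {w. series_mult F G w \<noteq> 0}"
proof (rule finite_subset)
  show "{w. series_mult F G w \<noteq> 0} \<subseteq> (\<lambda>(u, v). u @ v) ` ({w. F w \<noteq> 0} \<times> {w. G w \<noteq> 0})"
  proof
    fix w assume "w \<in> {w. series_mult F G w \<noteq> 0}"
    then have "series_mult F G w \<noteq> 0" by simp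
    then obtain z where "z \<in> {(u, v). u @ v = w}" "(case z of (u, v) \<Rightarrow> F u * G v) \<noteq> 0"
      unfolding series_mult_def by (rule sum.not_neutral_contains_not_neutral)
    then show "w \<in> (\<lambda>(u, v). u @ v) ` ({w. F w \<noteq> 0} \<times> {w. G w \<noteq> 0})"
      by (auto simp: image_iff)
  qed
qed (use assms in simp)

text \<open>The vector that \<open>a\<close> assigns to the vacuum, read as a formal series: for a polynomial \<open>a = \<Sum>\<^sub>w c\<^sub>w s\<^sub>w\<close> it is \<open>c\<close>.\<close>

definition symb :: "('d fock \<Rightarrow>\<^sub>L 'd fock) \<Rightarrow> 'd list \<Rightarrow> complex"
  where "symb a = fock_coeff (blinfun_apply a (fock_basis []))"

text \<open>Operators of this kind are determined by their symbol and closed under products and norm limits, so they contain the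
disc algebra. They are the complex-linear operators that commute with right creation.\<close>

definition conv_op :: "('d fock \<Rightarrow>\<^sub>L 'd fock) \<Rightarrow> bool"
  where "conv_op a \<longleftrightarrow> (\<forall>\<xi>. fock_coeff (blinfun_apply a \<xi>) = series_mult (symb a) (fock_coeff \<xi>))"

lemma symb_add: "symb (a + b) = (\<lambda>w. symb a w + symb b w)"
  and symb_diff: "symb (a - b) = (\<lambda>w. symb a w - symb b w)"
  and symb_scaleC: "symb (c *\<^sub>C a) = (\<lambda>w. c * symb a w)"
  and symb_scaleR: "symb (t *\<^sub>R a) = (\<lambda>w. complex_of_real t * symb a w)"
  and symb_zero: "symb 0 = (\<lambda>w. 0)"
  and symb_id: "symb id_blinfun = (\<lambda>w. of_bool (w = []))"
  and symb_creation: "symb (creation j) = (\<lambda>w. of_bool (w = [j]))"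
  by (simp_all add: symb_def fun_eq_iff blinfun.bilinear_simps create_vec_basis)

lemma symb_sum: "symb (\<Sum>i\<in>I. f i) w = (\<Sum>i\<in>I. symb (f i) w)"
  by (induction I rule: infinite_finite_induct) (simp_all add: symb_add symb_zero)

lemma bounded_linear_symb: "bounded_linear (\<lambda>a. symb a w)"
  unfolding symb_def
  by (rule bounded_linear_compose[OF bounded_linear_fock_coeff blinfun.bounded_linear_left])

lemma norm_fock_basis [simp]: "norm (fock_basis w) = 1"
proof -
  have "(norm (fock_basis w))\<^sup>2 = (\<Sum>\<^sub>\<infinity>v\<in>{w}. (cmod (fock_coeff (fock_basis w) v))\<^sup>2)"
    unfolding norm_fock_square by (rule infsum_cong_neutral) auto
  then show ?thesis
    using norm_ge_zero[of "fock_basis w"] by (auto simp: power2_eq_1_iff simp del: norm_ge_zero)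
qed

lemma hnorm_symb_le: "hnorm (symb a) k \<le> norm a"
proof -
  have "hnorm (symb a) k \<le> norm (blinfun_apply a (fock_basis []))"
    unfolding symb_def by (rule hnorm_fock_coeff_le)
  also have "\<dots> \<le> norm a"
    using norm_blinfun[of a "fock_basis []"] by simp
  finally show ?thesis .
qed

lemma fock_coeff_eqI: "fock_coeff x = fock_coeff y \<Longrightarrow> x = y"
  by (simp add: fock_coeff_inject)

lemma conv_opD: "conv_op a \<Longrightarrow> fock_coeff (blinfun_apply a \<xi>) = series_mult (symb a) (fock_coeff \<xi>)"
  by (simp add: conv_op_def)

lemma conv_op_compose:
  assumes "conv_op a" "conv_op b"
  shows "symb (a o\<^sub>L b) = series_mult (symb a) (symb b)" "conv_op (a o\<^sub>L b)"
proof -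
  show *: "symb (a o\<^sub>L b) = series_mult (symb a) (symb b)"
    using conv_opD[OF assms(1), of "blinfun_apply b (fock_basis [])"]
    by (simp add: symb_def[of b] symb_def[of "a o\<^sub>L b"])
  show "conv_op (a o\<^sub>L b)"
    unfolding conv_op_def * by (simp add: conv_opD assms series_mult_assoc)
qed

lemma conv_op_eqI: "conv_op a \<Longrightarrow> conv_op b \<Longrightarrow> symb a = symb b \<Longrightarrow> a = b"
  by (rule blinfun_eqI, rule fock_coeff_eqI) (simp add: conv_op_def)

lemma fock_polys_conv_op: "a \<in> fock_polys \<Longrightarrow> conv_op a"
proof (induction rule: fock_polys.induct)
  case one
  show ?case by (simp add: conv_op_def symb_id series_mult_one_left)
next
  case (gen j)
  show ?case
    by (auto simp: conv_op_def symb_creation series_mult_word create_vec.rep_eq fun_eq_iff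
        split: list.splits)
next
  case (add a b)
  then show ?case
    by (simp add: conv_op_def symb_add series_mult_add_left fun_eq_iff blinfun.add_left)
next
  case (scale a c)
  then show ?case
    by (simp add: conv_op_def symb_scaleC series_mult_scale_left fun_eq_iff)
next
  case (mult a b)
  then show ?case by (simp add: conv_op_compose)
qed

text \<open>The convolution formula evaluated at one vector and one word is a finite sum, hence a closed condition on
the operator.\<close>

lemma closed_conv_op: "closed {a. conv_op a}"
proof -
  have eq: "{a. conv_op a} = {a::'a fock \<Rightarrow>\<^sub>L 'a fock. \<forall>\<xi> w. fock_coeff (blinfun_apply a \<xi>) w
      = (\<Sum>z | fst z @ snd z = w. symb a (fst z) * fock_coeff \<xi> (snd z))}"
    by (simp add: conv_op_def series_mult_def fun_eq_iff case_prod_unfold)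
  have "closed {a::'a fock \<Rightarrow>\<^sub>L 'a fock. fock_coeff (blinfun_apply a \<xi>) w
      = (\<Sum>z | fst z @ snd z = w. symb a (fst z) * fock_coeff \<xi> (snd z))}" for \<xi> w
    by (intro closed_Collect_eq continuous_intros
        bounded_linear.continuous_on[OF bounded_linear_fock_coeff]
        bounded_linear.continuous_on[OF bounded_linear_symb])
  then show ?thesis
    unfolding eq by (intro closed_Collect_all)
qed

lemma disc_conv_op: "a \<in> closure fock_polys \<Longrightarrow> conv_op a"
  using closure_minimal[OF _ closed_conv_op, of fock_polys] fock_polys_conv_op by blast

lemma fock_polys_zero: "0 \<in> fock_polys"
  using fock_polys.scale[OF fock_polys.one, of 0] by simp

lemma fock_polys_scaleR: "a \<in> fock_polys \<Longrightarrow> t *\<^sub>R a \<in> fock_polys"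
  using fock_polys.scale[of a "complex_of_real t"] by (simp add: scaleC_of_real)

lemma fock_polys_sum: "(\<And>i. i \<in> I \<Longrightarrow> f i \<in> fock_polys) \<Longrightarrow> (\<Sum>i\<in>I. f i) \<in> fock_polys"
  by (induction I rule: infinite_finite_induct) (auto intro: fock_polys_zero fock_polys.add)

lemma word_op_mem_fock_polys: "word_op creation w \<in> fock_polys"
  by (induction w) (auto intro: fock_polys.intros)

lemma homog_eval_mem_fock_polys: "homog_eval F creation k \<in> fock_polys"
  unfolding homog_eval_def
  by (intro fock_polys_sum fock_polys.scale word_op_mem_fock_polys)

lemma symb_word_op: "symb (word_op creation v) = (\<lambda>w. of_bool (w = v))"
  by (simp add: symb_def word_op_creation_basis fun_eq_iff)

lemma symb_homog_eval:
  "symb (homog_eval F creation k) = (\<lambda>w. if length w = k then F w else 0)"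
proof
  fix w
  have "symb (homog_eval F creation k) w = (\<Sum>v | length v = k. if v = w then F v else 0)"
    unfolding homog_eval_def symb_sum
    by (rule sum.cong) (auto simp: symb_scaleC symb_word_op)
  then show "symb (homog_eval F creation k) w = (if length w = k then F w else 0)"
    by (simp add: sum.delta)
qed

lemma norm_scaleC_blinfun_le: "norm (c *\<^sub>C (a :: 'a::real_normed_vector \<Rightarrow>\<^sub>L 'b::complex_hilbert)) \<le> norm a * cmod c"
proof (rule norm_blinfun_bound)
  fix x
  show "norm (blinfun_apply (c *\<^sub>C a) x) \<le> norm a * cmod c * norm x"
    using mult_left_mono[OF norm_blinfun[of a x] norm_ge_zero[of c]]
    by (simp add: norm_scaleC mult_ac)
qed simp

lemma bounded_linear_scaleC_blinfun:
  "bounded_linear (\<lambda>a :: 'a::real_normed_vector \<Rightarrow>\<^sub>L 'b::complex_hilbert. c *\<^sub>C a)"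
  by (rule bounded_linear_intro[OF scaleC_add_right _ norm_scaleC_blinfun_le])
    (simp add: scaleC_scaleC mult.commute flip: scaleC_of_real)

lemma closure_binop:
  assumes "continuous_on UNIV (\<lambda>z. f (fst z) (snd z))"
    and "\<And>a b. a \<in> S \<Longrightarrow> b \<in> S' \<Longrightarrow> f a b \<in> U"
    and "a \<in> closure S" "b \<in> closure S'"
  shows "f a b \<in> closure U"
proof -
  have "(\<lambda>z. f (fst z) (snd z)) ` closure (S \<times> S') \<subseteq> closure U"
    by (rule image_closure_subset)
      (use assms(2) in \<open>auto intro!: continuous_on_subset[OF assms(1)] subsetD[OF closure_subset]\<close>)
  then show ?thesis
    using assms(3,4) by (force simp: closure_Times image_subset_iff)
qed

lemma disc_add: "a \<in> closure fock_polys \<Longrightarrow> b \<in> closure fock_polys \<Longrightarrow> a + b \<in> closure fock_polys"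
  by (rule closure_binop[of "(+)"]) (auto intro!: continuous_intros fock_polys.add)

lemma continuous_compose_blinfun: "continuous_on UNIV (\<lambda>z. fst z o\<^sub>L snd z)"
  by (intro bounded_bilinear.continuous_on[OF bounded_bilinear_blinfun_compose] continuous_intros)

lemma disc_mult: "a \<in> closure fock_polys \<Longrightarrow> b \<in> closure fock_polys \<Longrightarrow> a o\<^sub>L b \<in> closure fock_polys"
  by (rule closure_binop[of "(o\<^sub>L)"]) (auto intro!: continuous_compose_blinfun fock_polys.mult)

lemma closure_scale:
  assumes "\<And>a. a \<in> S \<Longrightarrow> c *\<^sub>C a \<in> S" "a \<in> closure (S :: ('a::real_normed_vector \<Rightarrow>\<^sub>L 'b::complex_hilbert) set)"
  shows "c *\<^sub>C a \<in> closure S"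
proof -
  have "(\<lambda>a. c *\<^sub>C a) ` closure S \<subseteq> closure S"
    by (rule image_closure_subset)
      (use assms(1) in \<open>auto intro!: bounded_linear.continuous_on[OF bounded_linear_scaleC_blinfun]
        subsetD[OF closure_subset]\<close>)
  then show ?thesis using assms(2) by blast
qed

lemma disc_scale: "a \<in> closure fock_polys \<Longrightarrow> c *\<^sub>C a \<in> closure fock_polys"
  by (rule closure_scale) (auto intro: fock_polys.scale)

lemma disc_poly: "a \<in> fock_polys \<Longrightarrow> a \<in> closure fock_polys"
  using closure_subset by blast

lemma disc_diff: "a \<in> closure fock_polys \<Longrightarrow> b \<in> closure fock_polys \<Longrightarrow> a - b \<in> closure fock_polys"
  using disc_add[of a "(-1) *\<^sub>C b"] disc_scale[of b "-1"] by simp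

lemma disc_eqI:
  "a \<in> closure fock_polys \<Longrightarrow> b \<in> closure fock_polys \<Longrightarrow> symb a = symb b \<Longrightarrow> a = b"
  using conv_op_eqI disc_conv_op by blast

lemma symb_mult:
  "a \<in> closure fock_polys \<Longrightarrow> b \<in> closure fock_polys \<Longrightarrow> symb (a o\<^sub>L b) = series_mult (symb a) (symb b)"
  by (simp add: conv_op_compose disc_conv_op)

text \<open>The evaluation \<open>F(x s)\<close> at the dilated creation operators.\<close>

definition series_op :: "real \<Rightarrow> ('d::finite list \<Rightarrow> complex) \<Rightarrow> ('d fock \<Rightarrow>\<^sub>L 'd fock)"
  where "series_op x F = (\<Sum>k. x ^ k *\<^sub>R homog_eval F creation k)"

lemma series_op_convergence:
  fixes F :: "'d::finite list \<Rightarrow> complex"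
  assumes "0 < x" and s: "summable (\<lambda>k. x ^ k * hnorm F k)"
  shows "(\<lambda>k. x ^ k *\<^sub>R homog_eval F creation k) sums series_op x F"
    and "norm (series_op x F) \<le> wnorm x F"
    and "series_op x F \<in> closure fock_polys"
    and "symb (series_op x F) = (\<lambda>w. complex_of_real (x ^ length w) * F w)"
proof -
  have le: "norm (x ^ k *\<^sub>R homog_eval F creation k) \<le> x ^ k * hnorm F k" for k
    using norm_homog_eval_creation_le[of F k] \<open>0 < x\<close> by (simp add: mult_left_mono)
  have sn: "summable (\<lambda>k. norm (x ^ k *\<^sub>R homog_eval F creation k))"
    by (rule summable_comparison_test'[OF s]) (use le in simp)
  show sums: "(\<lambda>k. x ^ k *\<^sub>R homog_eval F creation k) sums series_op x F"
    unfolding series_op_def by (rule summable_sums[OF summable_norm_cancel[OF sn]])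
  have "norm (series_op x F) \<le> (\<Sum>k. norm (x ^ k *\<^sub>R homog_eval F creation k))"
    unfolding series_op_def by (rule summable_norm[OF sn])
  also have "\<dots> \<le> wnorm x F"
    unfolding wnorm_def by (rule suminf_le[OF le sn s])
  finally show "norm (series_op x F) \<le> wnorm x F" .
  have poly: "(\<Sum>k<n. x ^ k *\<^sub>R homog_eval F creation k) \<in> fock_polys" for n
    by (intro fock_polys_sum fock_polys_scaleR homog_eval_mem_fock_polys)
  show "series_op x F \<in> closure fock_polys"
    by (rule Lim_in_closed_set[OF closed_closure _ _ sums[unfolded sums_def]])
      (auto intro!: always_eventually disc_poly poly)
  show "symb (series_op x F) = (\<lambda>w. complex_of_real (x ^ length w) * F w)"
  proof
    fix w
    have "(\<lambda>k. symb (x ^ k *\<^sub>R homog_eval F creation k) w) sums symb (series_op x F) w"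
      by (rule bounded_linear.sums[OF bounded_linear_symb sums])
    moreover have "(\<lambda>k. symb (x ^ k *\<^sub>R homog_eval F creation k) w) sums
        (\<Sum>k\<in>{length w}. symb (x ^ k *\<^sub>R homog_eval F creation k) w)"
      by (rule sums_finite) (auto simp: symb_scaleR symb_homog_eval)
    ultimately show "symb (series_op x F) w = complex_of_real (x ^ length w) * F w"
      using sums_unique2 by (fastforce simp: symb_scaleR symb_homog_eval)
  qed
qed

section \<open>The connecting maps as dilations\<close>

text \<open>The connecting map is built from the symbol rather than by extension from polynomials. Its algebraic
properties are then read off from the symbols.\<close>

definition dil :: "real \<Rightarrow> ('d::finite fock \<Rightarrow>\<^sub>L 'd fock) \<Rightarrow> ('d fock \<Rightarrow>\<^sub>L 'd fock)"
  where "dil t a = series_op t (symb a)"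

lemma dil_convergence:
  assumes "0 < t" "t < 1"
  shows "(\<lambda>k. t ^ k *\<^sub>R homog_eval (symb a) creation k) sums dil t a"
    and "dil t a \<in> closure fock_polys"
    and "symb (dil t a) = (\<lambda>w. complex_of_real (t ^ length w) * symb a w)"
    and "norm (dil t a) \<le> norm a / (1 - t)"
proof -
  have s: "summable (\<lambda>k. t ^ k * hnorm (symb a) k)" and le: "wnorm t (symb a) \<le> norm a / (1 - t)"
    using geometric_bound[of t 1 "symb a" "norm a"] assms hnorm_symb_le by auto
  show "(\<lambda>k. t ^ k *\<^sub>R homog_eval (symb a) creation k) sums dil t a"
    and "dil t a \<in> closure fock_polys"
    and "symb (dil t a) = (\<lambda>w. complex_of_real (t ^ length w) * symb a w)"
    unfolding dil_def by (rule series_op_convergence[OF assms(1) s])+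
  show "norm (dil t a) \<le> norm a / (1 - t)"
    unfolding dil_def using series_op_convergence(2)[OF assms(1) s] le by simp
qed

text \<open>The gauge unitary that acts on the tensors of degree \<open>k\<close> as \<open>cis (\<theta> k)\<close>.\<close>

lift_definition rot :: "real \<Rightarrow> 'd fock \<Rightarrow> 'd fock" is "\<lambda>\<theta> f w. cis (\<theta> * real (length w)) * f w"
  by (simp add: norm_mult)

lemma norm_rot [simp]: "norm (rot \<theta> x) = norm x"
proof -
  have "(norm (rot \<theta> x))\<^sup>2 = (norm x)\<^sup>2"
    unfolding norm_fock_square by (simp add: rot.rep_eq norm_mult)
  then show ?thesis by (simp add: power2_eq_iff_nonneg)
qed

text \<open>Rotating the symbol amounts to conjugating the operator with gauge unitaries.\<close>

lemma norm_conv_op_rotate: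
  assumes a: "conv_op a" and b: "conv_op b"
    and symb: "\<And>w. symb b w = cis (\<theta> * real (length w)) * symb a w"
  shows "norm b \<le> norm a"
proof (rule norm_blinfun_bound)
  fix \<xi>
  have "b \<xi> = rot \<theta> (a (rot (- \<theta>) \<xi>))"
  proof (rule fock_coeff_eqI, rule ext)
    fix w
    have "fock_coeff (b \<xi>) w = series_mult (\<lambda>w. cis (\<theta> * real (length w)) * symb a w)
        (\<lambda>w. cis (\<theta> * real (length w)) * fock_coeff (rot (- \<theta>) \<xi>) w) w"
      using b by (simp add: conv_op_def symb[abs_def] rot.rep_eq cis_mult mult.assoc[symmetric])
    also have "\<dots> = fock_coeff (rot \<theta> (a (rot (- \<theta>) \<xi>))) w"
      using a by (subst series_mult_dilate) (simp_all add: conv_op_def rot.rep_eq cis_mult distrib_left)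
    finally show "fock_coeff (b \<xi>) w = fock_coeff (rot \<theta> (a (rot (- \<theta>) \<xi>))) w" .
  qed
  then show "norm (b \<xi>) \<le> norm a * norm \<xi>"
    using norm_blinfun[of a "rot (- \<theta>) \<xi>"] by simp
qed simp

lemma fock_polys_finite_symb: "a \<in> fock_polys \<Longrightarrow> finite {w. symb a w \<noteq> 0}"
proof (induction rule: fock_polys.induct)
  case (add a b)
  show ?case
    by (rule finite_subset[OF _ finite_UnI[OF add.IH]]) (auto simp: symb_add)
next
  case (scale a c)
  show ?case
    by (rule finite_subset[OF _ scale.IH]) (auto simp: symb_scaleC)
next
  case (mult a b)
  then show ?case
    by (simp add: conv_op_compose fock_polys_conv_op series_mult_finite_support)
qed (simp_all add: symb_id symb_creation)

lemma fock_polys_bounded_degree: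
  assumes "a \<in> fock_polys"
  obtains n where "\<And>w. symb a w \<noteq> 0 \<Longrightarrow> length w < n"
proof -
  have "\<exists>n. \<forall>w\<in>{w. symb a w \<noteq> 0}. length w < n"
    using finite_nat_set_iff_bounded[of "length ` {w. symb a w \<noteq> 0}"] fock_polys_finite_symb[OF assms]
    by auto
  then show thesis using that by blast
qed

text \<open>For fixed vectors, \<open>z \<mapsto> \<langle>p(z s) \<xi>, \<eta>\<rangle>\<close> is a polynomial in \<open>z\<close>. On the unit circle it is bounded by
\<open>\<parallel>p\<parallel> \<parallel>\<xi>\<parallel> \<parallel>\<eta>\<parallel>\<close> by gauge invariance, hence at \<open>t\<close> by the maximum principle. The choice \<open>\<eta> = p(t s) \<xi>\<close> gives the
norm bound.\<close>

lemma norm_dil_poly_le: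
  fixes p :: "'d::finite fock \<Rightarrow>\<^sub>L 'd fock"
  assumes p: "p \<in> fock_polys" and t: "0 < t" "t < 1"
  shows "norm (dil t p) \<le> norm p"
proof -
  obtain n where n: "\<And>w. symb p w \<noteq> 0 \<Longrightarrow> length w < n"
    by (rule fock_polys_bounded_degree[OF p], rule that)
  define b where "b z = (\<Sum>k<n. z ^ k *\<^sub>C homog_eval (symb p) creation k)" for z
  have b: "b z \<in> fock_polys" for z
    unfolding b_def by (intro fock_polys_sum fock_polys.scale homog_eval_mem_fock_polys)
  have symb_b: "symb (b z) w = z ^ length w * symb p w" for z w
  proof -
    have "symb (b z) w = (\<Sum>k<n. if k = length w then z ^ length w * symb p w else 0)"
      unfolding b_def symb_sum by (rule sum.cong) (auto simp: symb_scaleC symb_homog_eval)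
    then show ?thesis
      using n[of w] by (cases "symb p w = 0") simp_all
  qed
  have circle: "norm (b z) \<le> norm p" if "norm z = 1" for z
  proof -
    obtain \<theta> where "z = cis \<theta>"
      using \<open>norm z = 1\<close> complex_norm_eq_1_exp[of z] unfolding cis_conv_exp by metis
    then show ?thesis
      by (intro norm_conv_op_rotate[of p _ \<theta>] fock_polys_conv_op p b)
        (simp add: symb_b Complex.DeMoivre mult.commute)
  qed
  have dil_b: "dil t p = b (complex_of_real t)"
    using t by (intro disc_eqI dil_convergence(2) disc_poly b) (simp_all add: dil_convergence(3) symb_b fun_eq_iff)
  show ?thesis
  proof (rule norm_blinfun_bound)
    fix \<xi>
    define \<eta> where "\<eta> = dil t p \<xi>"
    define f where "f z = cinner (b z \<xi>) \<eta>" for z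
    have f: "f z = (\<Sum>k<n. z ^ k * cinner (homog_eval (symb p) creation k \<xi>) \<eta>)" for z
      by (simp add: f_def b_def blinfun.sum_left cinner_sum_left cinner_scaleC_left)
    have "norm (f (complex_of_real t)) \<le> norm p * norm \<xi> * norm \<eta>"
    proof (rule maximum_modulus_frontier[where f = f and S = "ball 0 1"])
      show "f holomorphic_on interior (ball 0 1)"
        unfolding f by (intro holomorphic_intros)
      show "continuous_on (closure (ball 0 1)) f"
        unfolding f by (intro continuous_intros)
      show "norm (f z) \<le> norm p * norm \<xi> * norm \<eta>" if "z \<in> frontier (ball 0 1)" for z
      proof -
        have "norm (b z) \<le> norm p" using that circle by simp
        then have "norm (b z \<xi>) \<le> norm p * norm \<xi>"
          using norm_blinfun[of "b z" \<xi>] by (meson mult_right_mono norm_ge_zero order_trans)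
        then show ?thesis
          unfolding f_def using cmod_cinner_le[of "b z \<xi>" \<eta>]
          by (meson mult_right_mono norm_ge_zero order_trans)
      qed
    qed (use t in auto)
    then have "norm \<eta> * norm \<eta> \<le> (norm p * norm \<xi>) * norm \<eta>"
      by (simp add: f_def dil_b[symmetric] \<eta>_def[symmetric] cinner_self norm_mult power2_eq_square)
    then have "\<eta> = 0 \<or> norm \<eta> \<le> norm p * norm \<xi>"
      by (metis mult_right_le_imp_le zero_less_norm_iff)
    then show "norm (dil t p \<xi>) \<le> norm p * norm \<xi>"
      by (auto simp: \<eta>_def[symmetric])
  qed simp
qed

lemma homog_eval_scale: "homog_eval (\<lambda>w. c * F w) T k = c *\<^sub>C homog_eval F T k"
  by (simp add: homog_eval_def complex_vector.scale_sum_right scaleC_scaleC)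

lemma homog_eval_diff: "homog_eval (\<lambda>w. F w - G w) T k = homog_eval F T k - homog_eval G T k"
  using homog_eval_add[of F "\<lambda>w. (-1) * G w" T k] by (simp only: homog_eval_scale) simp

lemma homog_eval_cong:
  "(\<And>w. length w = k \<Longrightarrow> F w = G w) \<Longrightarrow> homog_eval F T k = homog_eval G T k"
  unfolding homog_eval_def by (rule sum.cong) auto

lemma homog_eval_weight:
  "homog_eval (\<lambda>w. complex_of_real (t ^ length w) * F w) T k = t ^ k *\<^sub>R homog_eval F T k"
proof -
  have "homog_eval (\<lambda>w. complex_of_real (t ^ length w) * F w) T k
      = homog_eval (\<lambda>w. complex_of_real (t ^ k) * F w) T k"
    by (rule homog_eval_cong) simp
  then show ?thesis by (simp only: homog_eval_scale scaleC_of_real)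
qed

lemma dil_eqI:
  assumes "0 < t" "t < 1" "b \<in> closure fock_polys"
    and "\<And>w. symb b w = complex_of_real (t ^ length w) * symb a w"
  shows "dil t a = b"
  by (rule disc_eqI[OF dil_convergence(2) assms(3)]) (use assms in \<open>simp_all add: dil_convergence(3) fun_eq_iff\<close>)

lemma dil_linear:
  assumes t: "0 < t" "t < 1"
  shows "dil t (a + b) = dil t a + dil t b" "dil t (a - b) = dil t a - dil t b"
    "dil t (c *\<^sub>C a) = c *\<^sub>C dil t a"
  by (rule dil_eqI[OF t]; simp add: t dil_convergence disc_add disc_diff disc_scale symb_add symb_diff symb_scaleC
      algebra_simps)+

lemma dil_mult:
  assumes t: "0 < t" "t < 1" and "a \<in> closure fock_polys" "b \<in> closure fock_polys"
  shows "dil t (a o\<^sub>L b) = dil t a o\<^sub>L dil t b"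
proof (rule dil_eqI[OF t])
  show "dil t a o\<^sub>L dil t b \<in> closure fock_polys"
    by (intro disc_mult dil_convergence t)
  fix w
  have "symb (dil t a o\<^sub>L dil t b) w = series_mult (\<lambda>w. complex_of_real (t ^ length w) * symb a w)
      (\<lambda>w. complex_of_real (t ^ length w) * symb b w) w"
    by (simp only: symb_mult dil_convergence(2,3)[OF t])
  also have "\<dots> = complex_of_real (t ^ length w) * symb (a o\<^sub>L b) w"
    by (subst series_mult_dilate) (simp_all add: power_add symb_mult assms)
  finally show "symb (dil t a o\<^sub>L dil t b) w = complex_of_real (t ^ length w) * symb (a o\<^sub>L b) w" .
qed

lemma dil_generators:
  assumes t: "0 < t" "t < 1"
  shows "dil t id_blinfun = id_blinfun" "dil t (creation i) = complex_of_real t *\<^sub>C creation i"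
  by (rule dil_eqI[OF t];
      simp add: disc_poly fock_polys.intros disc_scale symb_id symb_scaleC symb_creation)+

lemma disc_sequence:
  assumes "a \<in> closure fock_polys"
  obtains p where "\<And>n. p n \<in> fock_polys" "p \<longlonglongrightarrow> a"
  using assms unfolding closure_sequential by auto

text \<open>The crude bound \<open>\<parallel>a\<parallel> / (1 - t)\<close> on dilations suffices to carry the sharp bound from polynomials over to their
limits.\<close>

lemma norm_dil_le:
  assumes a: "a \<in> closure fock_polys" and t: "0 < t" "t < 1"
  shows "norm (dil t a) \<le> norm a"
proof -
  obtain p where p: "\<And>n. p n \<in> fock_polys" and lim: "p \<longlonglongrightarrow> a"
    using disc_sequence[OF a] by blast
  have "norm (dil t a) \<le> norm (p n) + norm (a - p n) / (1 - t)" for n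
  proof -
    have "dil t a = dil t (p n) + dil t (a - p n)"
      using dil_linear(1)[OF t, of "p n" "a - p n"] by simp
    then show ?thesis
      using norm_triangle_mono[OF norm_dil_poly_le[OF p t] dil_convergence(4)[OF t, of "a - p n"]] by simp
  qed
  moreover have "(\<lambda>n. norm (p n) + norm (a - p n) / (1 - t)) \<longlonglongrightarrow> norm a + norm (a - a) / (1 - t)"
    using t by (intro tendsto_intros lim) auto
  ultimately show ?thesis
    using LIMSEQ_le_const by fastforce
qed

lemma poly_expansion:
  assumes p: "p \<in> fock_polys"
  obtains n where "p = (\<Sum>k<n. homog_eval (symb p) creation k)"
    "\<And>t. 0 < t \<Longrightarrow> t < 1 \<Longrightarrow> dil t p = (\<Sum>k<n. t ^ k *\<^sub>R homog_eval (symb p) creation k)"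
proof -
  obtain n where n: "\<And>w. symb p w \<noteq> 0 \<Longrightarrow> length w < n"
    by (rule fock_polys_bounded_degree[OF p], rule that)
  have mem: "(\<Sum>k<n. t ^ k *\<^sub>R homog_eval (symb p) creation k) \<in> closure fock_polys" for t
    by (intro disc_poly fock_polys_sum fock_polys_scaleR homog_eval_mem_fock_polys)
  have symb: "symb (\<Sum>k<n. t ^ k *\<^sub>R homog_eval (symb p) creation k) w
      = complex_of_real (t ^ length w) * symb p w" for t w
  proof -
    have "symb (\<Sum>k<n. t ^ k *\<^sub>R homog_eval (symb p) creation k) w
        = (\<Sum>k<n. if k = length w then complex_of_real (t ^ length w) * symb p w else 0)"
      unfolding symb_sum by (rule sum.cong) (auto simp: symb_scaleR symb_homog_eval)
    then show ?thesis
      using n[of w] by (cases "symb p w = 0") simp_all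
  qed
  show thesis
  proof (rule that)
    show "p = (\<Sum>k<n. homog_eval (symb p) creation k)"
      using mem[of 1] symb[of 1] by (intro disc_eqI) (simp_all add: fun_eq_iff disc_poly p)
    show "dil t p = (\<Sum>k<n. t ^ k *\<^sub>R homog_eval (symb p) creation k)" if "0 < t" "t < 1" for t
      by (rule dil_eqI[OF that mem symb])
  qed
qed

text \<open>Convergence is clear for polynomials, and dilations are uniformly bounded.\<close>

lemma dil_approximates:
  assumes a: "a \<in> closure fock_polys" and "0 < e"
  obtains t where "0 < t" "t < 1" "norm (dil t a - a) < e"
proof -
  have "\<forall>e>0. \<exists>p\<in>fock_polys. dist p a < e"
    using a by (simp add: closure_approachable)
  then obtain p where p: "p \<in> fock_polys" and "dist p a < e / 3"
    using \<open>0 < e\<close> by (meson divide_pos_pos zero_less_numeral)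
  then have ap: "norm (a - p) < e / 3"
    by (simp add: dist_norm norm_minus_commute)
  obtain n where n: "p = (\<Sum>k<n. homog_eval (symb p) creation k)"
    "\<And>t. 0 < t \<Longrightarrow> t < 1 \<Longrightarrow> dil t p = (\<Sum>k<n. t ^ k *\<^sub>R homog_eval (symb p) creation k)"
    by (rule poly_expansion[OF p], rule that)
  have "((\<lambda>t. \<Sum>k<n. t ^ k *\<^sub>R homog_eval (symb p) creation k)
      \<longlongrightarrow> (\<Sum>k<n. 1 ^ k *\<^sub>R homog_eval (symb p) creation k)) (at_left (1::real))"
    by (intro tendsto_intros)
  then have "((\<lambda>t. \<Sum>k<n. t ^ k *\<^sub>R homog_eval (symb p) creation k) \<longlongrightarrow> p) (at_left (1::real))"
    using n(1) by simp
  then have "\<forall>\<^sub>F t in at_left 1. dist (\<Sum>k<n. t ^ k *\<^sub>R homog_eval (symb p) creation k) p < e / 3"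
    using \<open>0 < e\<close> by (intro tendstoD) auto
  moreover have "\<forall>\<^sub>F t in at_left (1::real). t \<in> {0<..<1}"
    by (rule eventually_at_left_real) simp
  ultimately have "\<forall>\<^sub>F t in at_left 1. t \<in> {0<..<1} \<and> norm (dil t p - p) < e / 3"
    by eventually_elim (auto simp: n(2) dist_norm)
  then have "\<exists>t. t \<in> {0<..<1} \<and> norm (dil t p - p) < e / 3"
    by (rule eventually_happens'[OF trivial_limit_at_left_real])
  then obtain t where t: "0 < t" "t < 1" and tp: "norm (dil t p - p) < e / 3"
    by auto
  have "dil t a - a = dil t (a - p) + ((dil t p - p) - (a - p))"
    by (simp add: dil_linear[OF t])
  then have "norm (dil t a - a) \<le> norm (dil t (a - p)) + norm ((dil t p - p) - (a - p))"
    by (simp only: norm_triangle_ineq)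
  also have "\<dots> \<le> norm (dil t (a - p)) + (norm (dil t p - p) + norm (a - p))"
    by (intro add_left_mono norm_triangle_ineq4)
  also have "norm (dil t (a - p)) \<le> norm (a - p)"
    by (intro norm_dil_le t disc_diff a disc_poly p)
  finally have "norm (dil t a - a) < e"
    using ap tp by simp
  then show thesis
    using that t by blast
qed

lemma disc_algebra_simps [simp]:
  "carrier disc_algebra = closure fock_polys" "a \<otimes>\<^bsub>disc_algebra\<^esub> b = a o\<^sub>L b"
  "\<one>\<^bsub>disc_algebra\<^esub> = id_blinfun" "\<zero>\<^bsub>disc_algebra\<^esub> = 0" "a \<oplus>\<^bsub>disc_algebra\<^esub> b = a + b"
  "c \<odot>\<^bsub>disc_algebra\<^esub> a = c *\<^sub>C a" "lctop disc_algebra = top_of_set (closure fock_polys)"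
  by (simp_all add: disc_algebra_def operator_algebra_def)

text \<open>Contractivity is part of the defining property of \<open>dilation\<close>. It forces uniqueness, since a contractive
homomorphism is determined by its values on the dense subalgebra of polynomials.\<close>

lemma dilation_eq:
  fixes a :: "'d::finite fock \<Rightarrow>\<^sub>L 'd fock"
  assumes xy: "0 < x" "x < y" and a: "a \<in> closure fock_polys"
  shows "dilation x y a = dil (x / y) a"
proof -
  define t where "t = x / y"
  have t: "0 < t" "t < 1" using xy by (simp_all add: t_def)
  have "dilation x y = restrict (dil t) (closure fock_polys :: ('d fock \<Rightarrow>\<^sub>L 'd fock) set)"
    unfolding dilation_def t_def[symmetric]
  proof (rule the_equality)
    show "restrict (dil t) (closure fock_polys) \<in> alg_hom disc_algebra disc_algebra \<and>
        restrict (dil t) (closure fock_polys) \<in> extensional (carrier disc_algebra) \<and>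
        (\<forall>a\<in>carrier disc_algebra. norm (restrict (dil t) (closure fock_polys) a) \<le> norm a) \<and>
        (\<forall>i. restrict (dil t) (closure fock_polys) (creation i) = complex_of_real t *\<^sub>C creation i)"
      using t by (auto simp: alg_hom_def ring_hom_def dil_convergence(2) dil_linear dil_mult dil_generators
          norm_dil_le disc_add disc_mult disc_scale disc_poly fock_polys.intros)
  next
    fix h :: "('d fock \<Rightarrow>\<^sub>L 'd fock) \<Rightarrow> ('d fock \<Rightarrow>\<^sub>L 'd fock)"
    assume "h \<in> alg_hom disc_algebra disc_algebra \<and> h \<in> extensional (carrier disc_algebra) \<and>
        (\<forall>a\<in>carrier disc_algebra. norm (h a) \<le> norm a) \<and>
        (\<forall>i. h (creation i) = complex_of_real t *\<^sub>C creation i)"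
    then have h: "h id_blinfun = id_blinfun" "h \<in> extensional (closure fock_polys)"
      "\<And>i. h (creation i) = complex_of_real t *\<^sub>C creation i"
      and h_add: "\<And>a b. a \<in> closure fock_polys \<Longrightarrow> b \<in> closure fock_polys \<Longrightarrow> h (a + b) = h a + h b"
      and h_mult: "\<And>a b. a \<in> closure fock_polys \<Longrightarrow> b \<in> closure fock_polys \<Longrightarrow> h (a o\<^sub>L b) = h a o\<^sub>L h b"
      and h_scale: "\<And>c a. a \<in> closure fock_polys \<Longrightarrow> h (c *\<^sub>C a) = c *\<^sub>C h a"
      and norm_h: "\<And>a. a \<in> closure fock_polys \<Longrightarrow> norm (h a) \<le> norm a"
      by (simp_all add: alg_hom_def ring_hom_def)
    have poly: "h p = dil t p" if "p \<in> fock_polys" for p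
      using that by induction
        (simp_all add: h h_add h_mult h_scale disc_poly dil_linear[OF t] dil_mult[OF t] dil_generators[OF t])
    have "h a = dil t a" if a: "a \<in> closure fock_polys" for a
    proof -
      obtain p where p: "\<And>n. p n \<in> fock_polys" and lim: "p \<longlonglongrightarrow> a"
        using disc_sequence[OF a] by blast
      have "norm (h a - dil t a) \<le> norm (a - p n) + norm (a - p n)" for n
      proof -
        have ap: "a - p n \<in> closure fock_polys"
          by (intro disc_diff a disc_poly p)
        have "h a = h (a - p n) + h (p n)"
          using h_add[OF ap disc_poly[OF p[of n]]] by simp
        then have "h a - dil t a = h (a - p n) - dil t (a - p n)"
          by (simp add: dil_linear[OF t] poly p)
        then show ?thesis
          using norm_triangle_ineq4[of "h (a - p n)" "dil t (a - p n)"] norm_h[OF ap] norm_dil_le[OF ap t]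
          by simp
      qed
      moreover have "(\<lambda>n. norm (a - p n) + norm (a - p n)) \<longlonglongrightarrow> norm (a - a) + norm (a - a)"
        by (intro tendsto_intros lim)
      ultimately have "norm (h a - dil t a) \<le> 0"
        using LIMSEQ_le_const by fastforce
      then show ?thesis by simp
    qed
    then show "h = restrict (dil t) (closure fock_polys)"
      using h(2) by (auto simp: extensional_def restrict_def)
  qed
  then show ?thesis
    using a by (simp add: t_def)
qed

section \<open>Closed graded ideals of the disc algebra\<close>

text \<open>The locale describes the closures of graded ideals. Gradedness appears as invariance under the
projections onto homogeneous parts, which passes to closures.\<close>

locale closed_graded_ideal =
  fixes J :: "('d::finite fock \<Rightarrow>\<^sub>L 'd fock) set"
  assumes subset: "J \<subseteq> closure fock_polys"
    and closed: "closed J"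
    and zero: "0 \<in> J"
    and add: "a \<in> J \<Longrightarrow> b \<in> J \<Longrightarrow> a + b \<in> J"
    and scale: "a \<in> J \<Longrightarrow> c *\<^sub>C a \<in> J"
    and mult_right: "a \<in> J \<Longrightarrow> b \<in> closure fock_polys \<Longrightarrow> a o\<^sub>L b \<in> J"
    and mult_left: "a \<in> J \<Longrightarrow> b \<in> closure fock_polys \<Longrightarrow> b o\<^sub>L a \<in> J"
    and component: "a \<in> J \<Longrightarrow> homog_eval (symb a) creation k \<in> J"
begin

lemma scaleR: "a \<in> J \<Longrightarrow> t *\<^sub>R a \<in> J"
  using scale[of a "complex_of_real t"] by (simp add: scaleC_of_real)

lemma diff: "a \<in> J \<Longrightarrow> b \<in> J \<Longrightarrow> a - b \<in> J"
  using add[of a "(-1) *\<^sub>R b"] scaleR[of b "-1"] by simp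

lemma sum: "(\<And>i. i \<in> I \<Longrightarrow> f i \<in> J) \<Longrightarrow> (\<Sum>i\<in>I. f i) \<in> J"
  by (induction I rule: infinite_finite_induct) (auto intro: zero add)

text \<open>The homogeneous parts of \<open>a\<close> need not sum to \<open>a\<close> in norm, but those of its dilations do, and the dilations
converge to \<open>a\<close>.\<close>

lemma mem_iff_components:
  assumes a: "a \<in> closure fock_polys"
  shows "a \<in> J \<longleftrightarrow> (\<forall>k. homog_eval (symb a) creation k \<in> J)"
proof
  assume comp: "\<forall>k. homog_eval (symb a) creation k \<in> J"
  have dil_mem: "dil t a \<in> J" if t: "0 < t" "t < 1" for t
  proof (rule Lim_in_closed_set[OF closed _ _ dil_convergence(1)[OF t, unfolded sums_def]])
    show "\<forall>\<^sub>F n in sequentially. (\<Sum>k<n. t ^ k *\<^sub>R homog_eval (symb a) creation k) \<in> J"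
      using comp by (intro always_eventually allI sum scaleR) blast
  qed simp
  have "\<exists>b\<in>J. dist b a < e" if e: "0 < e" for e
  proof -
    obtain t where "0 < t" "t < 1" "norm (dil t a - a) < e"
      by (rule dil_approximates[OF a e], rule that)
    then show ?thesis
      using dil_mem by (auto simp: dist_norm)
  qed
  then show "a \<in> J"
    using closed_approachable[OF closed] by blast
qed (simp add: component)

lemma dil_mem:
  assumes t: "0 < t" "t < 1" and a: "a \<in> J"
  shows "dil t a \<in> J"
  unfolding mem_iff_components[OF dil_convergence(2)[OF t]] dil_convergence(3)[OF t] homog_eval_weight
  using component[OF a] scaleR by blast

text \<open>Compatibility means that the homogeneous parts of degree \<open>k\<close> of all \<open>b x\<close>, rescaled by \<open>x^-k\<close>, lie in one coset of
\<open>J\<close>. The set \<open>V k\<close> collects the norms of the members of this coset that come from representatives \<open>a\<close> of any \<open>b x\<close>,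
and \<open>F\<close> picks in each degree one with norm below \<open>Inf (V k) + \<eta> / r^k\<close>. The last summand makes room for an infimum that is not attained, and contributes at most \<open>\<eta>\<close> at every
radius \<open>x < r\<close>.\<close>

lemma graded_lift:
  assumes "0 < r" and b: "\<And>x. 0 < x \<Longrightarrow> x < r \<Longrightarrow> b x \<in> closure fock_polys"
    and compat: "\<And>x y. 0 < x \<Longrightarrow> x < y \<Longrightarrow> y < r \<Longrightarrow> dil (x / y) (b y) - b x \<in> J" and "0 < \<eta>"
  obtains F where "has_radius r F" "\<And>x. 0 < x \<Longrightarrow> x < r \<Longrightarrow> series_op x F - b x \<in> J"
    "\<And>x a k. 0 < x \<Longrightarrow> x < r \<Longrightarrow> a - b x \<in> J \<Longrightarrow> x ^ k * hnorm F k \<le> norm a + \<eta>"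
proof -
  define hp where "hp = (\<lambda>a k. homog_eval (symb a) creation k :: 'd fock \<Rightarrow>\<^sub>L 'd fock)"
  have hp_diff: "hp (a - b) k = hp a k - hp b k" for a b k
    by (simp add: hp_def symb_diff homog_eval_diff)
  have hp_mem: "hp a k \<in> J" if "a \<in> J" for a k
    using component[OF that] by (simp add: hp_def)
  have hp_compat: "(x / y) ^ k *\<^sub>R hp (b y) k - hp (b x) k \<in> J"
    if "0 < x" "x < r" "0 < y" "y < r" for x y k
  proof -
    have less: "(x / y) ^ k *\<^sub>R hp (b y) k - hp (b x) k \<in> J" if "0 < x" "x < y" "y < r" for x y
    proof -
      have "hp (dil (x / y) (b y)) k = (x / y) ^ k *\<^sub>R hp (b y) k"
        using that dil_convergence(3)[of "x / y" "b y"] by (simp add: hp_def homog_eval_weight del: of_real_power)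
      then show ?thesis
        using hp_mem[OF compat[OF that], of k] by (simp add: hp_diff)
    qed
    show ?thesis
    proof (cases x y rule: linorder_cases)
      case greater
      then have "(- ((x / y) ^ k)) *\<^sub>R ((y / x) ^ k *\<^sub>R hp (b x) k - hp (b y) k) \<in> J"
        using less[of y x] that by (intro scaleR) auto
      moreover have "(- ((x / y) ^ k)) *\<^sub>R ((y / x) ^ k *\<^sub>R hp (b x) k - hp (b y) k)
          = (x / y) ^ k *\<^sub>R hp (b y) k - hp (b x) k"
        using that by (simp add: scaleR_diff_right flip: power_mult_distrib)
      ultimately show ?thesis by simp
    qed (use less that zero in auto)
  qed
  define V where "V k = {hnorm (symb a) k / x ^ k | x a. 0 < x \<and> x < r \<and> a - b x \<in> J}" for k
  have V_ne: "V k \<noteq> {}" for k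
    using dense[OF \<open>0 < r\<close>] zero by (auto simp: V_def) (metis diff_self)
  have V_bdd: "bdd_below (V k)" for k
    by (rule bdd_belowI[of _ 0]) (auto simp: V_def)
  have "\<exists>x a. 0 < x \<and> x < r \<and> a - b x \<in> J \<and> hnorm (symb a) k / x ^ k < Inf (V k) + \<eta> / r ^ k" for k
  proof -
    have "Inf (V k) < Inf (V k) + \<eta> / r ^ k"
      using \<open>0 < r\<close> \<open>0 < \<eta>\<close> by simp
    then obtain v where "v \<in> V k" "v < Inf (V k) + \<eta> / r ^ k"
      using cInf_less_iff[OF V_ne V_bdd] by blast
    then show ?thesis by (auto simp: V_def)
  qed
  then obtain X A where X: "\<And>k. 0 < X k" "\<And>k. X k < r" and A: "\<And>k. A k - b (X k) \<in> J"
    and near: "\<And>k. hnorm (symb (A k)) k / X k ^ k < Inf (V k) + \<eta> / r ^ k"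
    by metis
  define F where "F w = complex_of_real (inverse (X (length w) ^ length w)) * symb (A (length w)) w" for w
  have hnorm_F: "hnorm F k = hnorm (symb (A k)) k / X k ^ k" for k
  proof -
    have "hnorm F k = hnorm (\<lambda>w. complex_of_real (inverse (X k ^ k)) * symb (A k) w) k"
      by (rule hnorm_cong) (simp add: F_def)
    then show ?thesis
      using X(1)[of k] by (simp only: hnorm_scale norm_of_real) (simp add: divide_inverse mult.commute)
  qed
  have bound: "x ^ k * hnorm F k \<le> norm a + \<eta>" if x: "0 < x" "x < r" and a: "a - b x \<in> J" for x a k
  proof -
    have "Inf (V k) \<le> hnorm (symb a) k / x ^ k"
      using that by (intro cInf_lower V_bdd) (auto simp: V_def)
    also have "\<dots> \<le> norm a / x ^ k"
      using x hnorm_symb_le by (intro divide_right_mono) auto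
    finally have "hnorm F k \<le> norm a / x ^ k + \<eta> / r ^ k"
      using near[of k] by (simp add: hnorm_F)
    then have "x ^ k * hnorm F k \<le> x ^ k * (norm a / x ^ k + \<eta> / r ^ k)"
      using x by (intro mult_left_mono) auto
    also have "\<dots> = norm a + \<eta> * (x / r) ^ k"
      using x by (simp add: field_simps power_divide)
    also have "\<dots> \<le> norm a + \<eta> * 1"
      using x \<open>0 < \<eta>\<close> by (intro add_left_mono mult_left_mono power_le_one) auto
    finally show ?thesis by simp
  qed
  have radius: "has_radius r F"
    unfolding has_radius_def using bound zero by (metis diff_self)
  have "series_op x F - b x \<in> J" if x: "0 < x" "x < r" for x
  proof -
    note op = series_op_convergence[OF x(1) has_radius_summable[OF radius x]]
    have "hp (series_op x F - b x) k \<in> J" for k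
    proof -
      have "homog_eval F creation k = homog_eval (\<lambda>w. complex_of_real (inverse (X k ^ k)) * symb (A k) w) creation k"
        by (rule homog_eval_cong) (simp add: F_def)
      also have "\<dots> = inverse (X k ^ k) *\<^sub>R hp (A k) k"
        by (simp only: homog_eval_scale scaleC_of_real hp_def)
      finally have "hp (series_op x F) k = (x / X k) ^ k *\<^sub>R hp (A k) k"
        by (simp add: hp_def op(4) homog_eval_weight power_divide divide_inverse power_mult_distrib
            power_inverse del: of_real_power)
      then have "hp (series_op x F - b x) k = (x / X k) ^ k *\<^sub>R hp (A k - b (X k)) k
          + ((x / X k) ^ k *\<^sub>R hp (b (X k)) k - hp (b x) k)"
        by (simp add: hp_diff scaleR_diff_right)
      then show ?thesis
        using add[OF scaleR[OF hp_mem[OF A]] hp_compat[OF x X]] by simp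
    qed
    then show ?thesis
      using mem_iff_components[of "series_op x F - b x"] disc_diff[OF op(3) b[OF x]]
      by (simp add: hp_def)
  qed
  then show thesis
    using that radius bound by blast
qed

end

section \<open>Quotients of locally convex algebras\<close>

lemma lca_quotient_simps [simp]:
  "carrier (lca_quotient A J) = carrier (A Quot J)" "mult (lca_quotient A J) = mult (A Quot J)"
  "one (lca_quotient A J) = one (A Quot J)" "zero (lca_quotient A J) = zero (A Quot J)"
  "add (lca_quotient A J) = add (A Quot J)"
  "smult (lca_quotient A J) = (\<lambda>c X. \<Union>a\<in>X. J +>\<^bsub>A\<^esub> (c \<odot>\<^bsub>A\<^esub> a))"
  "lctop (lca_quotient A J) = quotient_topology (lctop A) (\<lambda>a. J +>\<^bsub>A\<^esub> a)"
  by (simp_all add: lca_quotient_def)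

lemma topspace_quotient_topology [simp]: "topspace (quotient_topology X f) = f ` topspace X"
proof
  show "topspace (quotient_topology X f) \<subseteq> f ` topspace X"
    unfolding topspace_def openin_quotient_topology by auto
  have "openin (quotient_topology X f) (f ` topspace X)"
  proof -
    have "{x \<in> topspace X. f x \<in> f ` topspace X} = topspace X" by blast
    then show ?thesis by (simp add: openin_quotient_topology)
  qed
  then show "f ` topspace X \<subseteq> topspace (quotient_topology X f)"
    by (rule openin_subset)
qed

lemma carrier_quotient: "carrier (A Quot J) = (\<lambda>a. J +>\<^bsub>A\<^esub> a) ` carrier A"
  by (auto simp: FactRing_def A_RCOSETS_def RCOSETS_def a_r_coset_def)

lemma coset_map_alg_hom:
  fixes A :: "('a, 'm) lc_algebra_scheme"
  assumes "ideal J A" and smult: "\<And>c a. a \<in> carrier A \<Longrightarrow> c \<odot>\<^bsub>A\<^esub> a \<in> carrier A"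
    and coset: "\<And>c a b. \<lbrakk>a \<in> carrier A; b \<in> carrier A; J +>\<^bsub>A\<^esub> a = J +>\<^bsub>A\<^esub> b\<rbrakk>
      \<Longrightarrow> J +>\<^bsub>A\<^esub> (c \<odot>\<^bsub>A\<^esub> a) = J +>\<^bsub>A\<^esub> (c \<odot>\<^bsub>A\<^esub> b)"
  shows "(\<lambda>a. J +>\<^bsub>A\<^esub> a) \<in> alg_hom A (lca_quotient A J)"
proof -
  interpret ideal J A by fact
  have hom: "(\<lambda>a. J +>\<^bsub>A\<^esub> a) \<in> ring_hom A (lca_quotient A J)"
    using rcos_ring_hom by (simp add: ring_hom_def)
  have "J +>\<^bsub>A\<^esub> (c \<odot>\<^bsub>A\<^esub> a) = (\<Union>b\<in>J +>\<^bsub>A\<^esub> a. J +>\<^bsub>A\<^esub> (c \<odot>\<^bsub>A\<^esub> b))" if a: "a \<in> carrier A" for c a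
  proof -
    have "J +>\<^bsub>A\<^esub> (c \<odot>\<^bsub>A\<^esub> b) = J +>\<^bsub>A\<^esub> (c \<odot>\<^bsub>A\<^esub> a)" if b: "b \<in> J +>\<^bsub>A\<^esub> a" for b
    proof (rule coset)
      show "b \<in> carrier A"
        using b a a_r_coset_subset_G[OF a_subset a] by blast
      show "J +>\<^bsub>A\<^esub> b = J +>\<^bsub>A\<^esub> a"
        using a_repr_independence'[OF b a] by simp
    qed (fact a)
    moreover have "a \<in> J +>\<^bsub>A\<^esub> a"
      by (rule a_rcos_self[OF a])
    ultimately show ?thesis by blast
  qed
  then show ?thesis
    using hom by (simp add: alg_hom_def)
qed

lemma alg_homD:
  assumes "h \<in> alg_hom A B"
  shows "a \<in> carrier A \<Longrightarrow> h a \<in> carrier B"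
    "a \<in> carrier A \<Longrightarrow> b \<in> carrier A \<Longrightarrow> h (a \<otimes>\<^bsub>A\<^esub> b) = h a \<otimes>\<^bsub>B\<^esub> h b"
    "a \<in> carrier A \<Longrightarrow> b \<in> carrier A \<Longrightarrow> h (a \<oplus>\<^bsub>A\<^esub> b) = h a \<oplus>\<^bsub>B\<^esub> h b"
    "h \<one>\<^bsub>A\<^esub> = \<one>\<^bsub>B\<^esub>"
    "a \<in> carrier A \<Longrightarrow> h (c \<odot>\<^bsub>A\<^esub> a) = c \<odot>\<^bsub>B\<^esub> h a"
  using assms by (auto simp: alg_hom_def ring_hom_def)

text \<open>A continuous open epimorphism identifies its range with the quotient by its kernel. The algebraic structure of the
range is transported from \<open>A\<close>, so inverse limits qualify without a separate verification of the ring axioms.\<close>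

locale open_alg_epi =
  fixes A :: "('a, 'm) lc_algebra_scheme" and B :: "('b, 'n) lc_algebra_scheme" and f :: "'a \<Rightarrow> 'b"
  assumes ring: "ring A" and smult_closed: "\<And>c a. a \<in> carrier A \<Longrightarrow> c \<odot>\<^bsub>A\<^esub> a \<in> carrier A"
    and hom: "f \<in> alg_hom A B" and surj: "f ` carrier A = carrier B"
    and topspace: "topspace (lctop A) = carrier A" "topspace (lctop B) = carrier B"
    and cont: "continuous_map (lctop A) (lctop B) f" and open_map: "open_map (lctop A) (lctop B) f"
begin

lemmas f_simps = alg_homD[OF hom]

lemma inverse_lca_iso:
  assumes inj: "inj_on f (carrier A)"
  shows "inv_into (carrier A) f \<in> lca_iso B A"
proof -
  interpret ring A by (rule ring)
  let ?g = "inv_into (carrier A) f"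
  have g: "?g (f a) = a" if "a \<in> carrier A" for a
    by (rule inv_into_f_f[OF inj that])
  have cB: "\<exists>a\<in>carrier A. b = f a" if "b \<in> carrier B" for b
    using that surj by auto
  have "?g \<in> ring_hom B A"
  proof (rule ring_hom_memI)
    show "?g x \<in> carrier A" if "x \<in> carrier B" for x
      using cB[OF that] g by auto
    show "?g (x \<otimes>\<^bsub>B\<^esub> y) = ?g x \<otimes>\<^bsub>A\<^esub> ?g y" "?g (x \<oplus>\<^bsub>B\<^esub> y) = ?g x \<oplus>\<^bsub>A\<^esub> ?g y"
      if "x \<in> carrier B" "y \<in> carrier B" for x y
      using cB[OF that(1)] cB[OF that(2)] g f_simps(2,3)[symmetric] by auto
    show "?g \<one>\<^bsub>B\<^esub> = \<one>\<^bsub>A\<^esub>"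
      using g[OF one_closed] f_simps(4) by simp
  qed
  moreover have "?g (c \<odot>\<^bsub>B\<^esub> x) = c \<odot>\<^bsub>A\<^esub> ?g x" if "x \<in> carrier B" for c x
    using cB[OF that] g smult_closed f_simps(5)[symmetric] by auto
  moreover have "bij_betw ?g (carrier B) (carrier A)"
    by (rule bij_betw_inv_into) (simp add: bij_betw_def inj surj)
  moreover have "homeomorphic_map (lctop B) (lctop A) ?g"
  proof -
    have "homeomorphic_map (lctop A) (lctop B) f"
      by (rule bijective_open_imp_homeomorphic_map) (simp_all add: cont open_map topspace surj inj)
    then obtain g' where g': "homeomorphic_maps (lctop A) (lctop B) f g'"
      by (auto simp: homeomorphic_map_maps)
    then have "homeomorphic_map (lctop B) (lctop A) g'"
      using homeomorphic_maps_map by blast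
    moreover have "g' b = ?g b" if "b \<in> topspace (lctop B)" for b
      using g' cB[of b] that g by (auto simp: homeomorphic_maps_def topspace)
    ultimately show ?thesis
      using homeomorphic_map_eq by blast
  qed
  ultimately show ?thesis
    by (simp add: lca_iso_def alg_hom_def)
qed

text \<open>The fibres of \<open>f\<close> are the cosets of the kernel, so the inverse of the induced map sends a point to
the fibre over it.\<close>

lemma fibre_lca_iso:
  assumes K: "K = {a \<in> carrier A. f a = f \<zero>\<^bsub>A\<^esub>}"
  shows "(\<lambda>b. {a \<in> carrier A. f a = b}) \<in> lca_iso B (lca_quotient A K)"
proof -
  interpret ring A by (rule ring)
  define \<Phi> where "\<Phi> b = {a \<in> carrier A. f a = b}" for b
  define \<pi> where "\<pi> a = K +>\<^bsub>A\<^esub> a" for a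
  have minus: "f (\<ominus>\<^bsub>A\<^esub> a) = f \<zero>\<^bsub>A\<^esub>" if "a \<in> K" for a
  proof -
    have a: "a \<in> carrier A" "f a = f \<zero>\<^bsub>A\<^esub>" using that by (simp_all add: K)
    have "f (\<ominus>\<^bsub>A\<^esub> a) = f (\<ominus>\<^bsub>A\<^esub> a) \<oplus>\<^bsub>B\<^esub> f \<zero>\<^bsub>A\<^esub>"
      using f_simps(3)[of "\<ominus>\<^bsub>A\<^esub> a" "\<zero>\<^bsub>A\<^esub>"] a by simp
    also have "\<dots> = f (\<ominus>\<^bsub>A\<^esub> a \<oplus>\<^bsub>A\<^esub> a)"
      using f_simps(3)[of "\<ominus>\<^bsub>A\<^esub> a" a] a by simp
    finally show ?thesis using a by (simp add: l_neg)
  qed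
  have ideal: "ideal K A"
  proof (rule idealI[OF ring])
    show "subgroup K (add_monoid A)"
    proof
      show "x \<otimes>\<^bsub>add_monoid A\<^esub> y \<in> K" if "x \<in> K" "y \<in> K" for x y
        using that f_simps(3)[of x y] f_simps(3)[of "\<zero>\<^bsub>A\<^esub>" "\<zero>\<^bsub>A\<^esub>"] by (simp add: K)
      show "inv\<^bsub>add_monoid A\<^esub> x \<in> K" if "x \<in> K" for x
        using minus[OF that] that by (simp add: K a_inv_def[symmetric])
    qed (auto simp: K)
    show "x \<otimes>\<^bsub>A\<^esub> a \<in> K" "a \<otimes>\<^bsub>A\<^esub> x \<in> K" if "a \<in> K" "x \<in> carrier A" for a x
      using that f_simps(2)[of x a] f_simps(2)[of x "\<zero>\<^bsub>A\<^esub>"] f_simps(2)[of a x] f_simps(2)[of "\<zero>\<^bsub>A\<^esub>" x]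
      by (simp_all add: K)
  qed
  have \<pi>: "\<pi> a = \<Phi> (f a)" if a: "a \<in> carrier A" for a
  proof
    show "\<pi> a \<subseteq> \<Phi> (f a)"
    proof
      fix b assume "b \<in> \<pi> a"
      then obtain k where k: "k \<in> K" "b = k \<oplus>\<^bsub>A\<^esub> a"
        by (auto simp: \<pi>_def a_r_coset_def r_coset_def)
      then have "f b = f \<zero>\<^bsub>A\<^esub> \<oplus>\<^bsub>B\<^esub> f a"
        using f_simps(3)[of k a] a by (simp add: K)
      also have "\<dots> = f a"
        using f_simps(3)[of "\<zero>\<^bsub>A\<^esub>" a] a by simp
      finally show "b \<in> \<Phi> (f a)"
        using k a by (simp add: \<Phi>_def K)
    qed
    show "\<Phi> (f a) \<subseteq> \<pi> a"
    proof
      fix b assume "b \<in> \<Phi> (f a)"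
      then have b: "b \<in> carrier A" "f b = f a" by (simp_all add: \<Phi>_def)
      have "f (b \<oplus>\<^bsub>A\<^esub> \<ominus>\<^bsub>A\<^esub> a) = f a \<oplus>\<^bsub>B\<^esub> f (\<ominus>\<^bsub>A\<^esub> a)"
        using f_simps(3)[of b "\<ominus>\<^bsub>A\<^esub> a"] a b by simp
      also have "\<dots> = f \<zero>\<^bsub>A\<^esub>"
        using f_simps(3)[of a "\<ominus>\<^bsub>A\<^esub> a"] a by (simp add: r_neg)
      finally have "b \<oplus>\<^bsub>A\<^esub> \<ominus>\<^bsub>A\<^esub> a \<in> K"
        using a b by (simp add: K)
      moreover have "b = (b \<oplus>\<^bsub>A\<^esub> \<ominus>\<^bsub>A\<^esub> a) \<oplus>\<^bsub>A\<^esub> a"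
        using a b by (simp add: a_assoc l_neg)
      ultimately show "b \<in> \<pi> a"
        by (auto simp: \<pi>_def a_r_coset_def r_coset_def)
    qed
  qed
  have \<Phi>_eq: "\<Phi> (f a) = \<Phi> (f b) \<longleftrightarrow> f a = f b" if "a \<in> carrier A" for a b
    using that by (auto simp: \<Phi>_def)
  have "\<pi> \<in> alg_hom A (lca_quotient A K)"
    unfolding \<pi>_def
  proof (rule coset_map_alg_hom[OF ideal smult_closed])
    fix c a b assume a: "a \<in> carrier A" and b: "b \<in> carrier A" and "K +>\<^bsub>A\<^esub> a = K +>\<^bsub>A\<^esub> b"
    then have "f a = f b" using \<Phi>_eq \<pi> by (simp add: \<pi>_def[symmetric])
    then show "K +>\<^bsub>A\<^esub> (c \<odot>\<^bsub>A\<^esub> a) = K +>\<^bsub>A\<^esub> (c \<odot>\<^bsub>A\<^esub> b)"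
      using \<pi>[of "c \<odot>\<^bsub>A\<^esub> a"] \<pi>[of "c \<odot>\<^bsub>A\<^esub> b"] a b by (simp add: smult_closed f_simps \<pi>_def)
  qed
  note \<pi>_simps = alg_homD[OF this]
  have cB: "\<exists>a\<in>carrier A. b = f a" if "b \<in> carrier B" for b
    using that surj by auto
  have "\<Phi> \<in> ring_hom B (lca_quotient A K)"
  proof (rule ring_hom_memI)
    show "\<Phi> x \<in> carrier (lca_quotient A K)" if "x \<in> carrier B" for x
      using cB[OF that] \<pi>_simps(1) \<pi> by auto
    show "\<Phi> (x \<otimes>\<^bsub>B\<^esub> y) = \<Phi> x \<otimes>\<^bsub>lca_quotient A K\<^esub> \<Phi> y" if "x \<in> carrier B" "y \<in> carrier B" for x y
    proof -
      obtain a b where ab: "a \<in> carrier A" "b \<in> carrier A" "x = f a" "y = f b"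
        using cB[OF \<open>x \<in> carrier B\<close>] cB[OF \<open>y \<in> carrier B\<close>] by blast
      then show ?thesis
        using \<pi>_simps(2)[of a b] \<pi>[of "a \<otimes>\<^bsub>A\<^esub> b"] by (simp add: f_simps \<pi>)
    qed
    show "\<Phi> (x \<oplus>\<^bsub>B\<^esub> y) = \<Phi> x \<oplus>\<^bsub>lca_quotient A K\<^esub> \<Phi> y" if "x \<in> carrier B" "y \<in> carrier B" for x y
    proof -
      obtain a b where ab: "a \<in> carrier A" "b \<in> carrier A" "x = f a" "y = f b"
        using cB[OF \<open>x \<in> carrier B\<close>] cB[OF \<open>y \<in> carrier B\<close>] by blast
      then show ?thesis
        using \<pi>_simps(3)[of a b] \<pi>[of "a \<oplus>\<^bsub>A\<^esub> b"] by (simp add: f_simps \<pi>)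
    qed
    show "\<Phi> \<one>\<^bsub>B\<^esub> = \<one>\<^bsub>lca_quotient A K\<^esub>"
      using \<pi>_simps(4) \<pi>[OF one_closed] f_simps(4) by simp
  qed
  moreover have "\<Phi> (c \<odot>\<^bsub>B\<^esub> x) = c \<odot>\<^bsub>lca_quotient A K\<^esub> \<Phi> x" if "x \<in> carrier B" for c x
  proof -
    obtain a where a: "a \<in> carrier A" "x = f a" using cB[OF \<open>x \<in> carrier B\<close>] by auto
    have "\<Phi> (c \<odot>\<^bsub>B\<^esub> x) = \<pi> (c \<odot>\<^bsub>A\<^esub> a)"
      using a smult_closed by (simp add: \<pi> f_simps)
    then show ?thesis
      using \<pi>_simps(5)[of a c] a by (simp only: \<pi>)
  qed
  moreover have inj: "inj_on \<Phi> (carrier B)"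
  proof (rule inj_onI)
    fix x y assume x: "x \<in> carrier B" and y: "y \<in> carrier B" and eq: "\<Phi> x = \<Phi> y"
    obtain a where "a \<in> carrier A" "x = f a" using cB[OF x] by blast
    moreover obtain b where "b \<in> carrier A" "y = f b" using cB[OF y] by blast
    ultimately show "x = y" using eq \<Phi>_eq by blast
  qed
  moreover have img: "\<Phi> ` carrier B = \<pi> ` carrier A"
    unfolding surj[symmetric] image_image using \<pi> by (intro image_cong) simp_all
  moreover have "\<pi> ` carrier A = carrier (lca_quotient A K)"
    by (simp add: carrier_quotient \<pi>_def[abs_def])
  moreover have "homeomorphic_map (lctop B) (lctop (lca_quotient A K)) \<Phi>"
  proof (rule bijective_open_imp_homeomorphic_map)
    have sat: "{a \<in> carrier A. \<pi> a \<in> U} = {a \<in> carrier A. f a \<in> {b \<in> carrier B. \<Phi> b \<in> U}}" for U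
      using \<pi> f_simps(1) by auto
    show "continuous_map (lctop B) (lctop (lca_quotient A K)) \<Phi>"
      unfolding continuous_map_def
    proof (intro conjI allI impI)
      show "\<Phi> \<in> topspace (lctop B) \<rightarrow> topspace (lctop (lca_quotient A K))"
        using img by (auto simp: topspace \<pi>_def)
      fix U assume "openin (lctop (lca_quotient A K)) U"
      then have "openin (lctop A) {a \<in> carrier A. \<pi> a \<in> U}"
        by (simp add: openin_quotient_topology topspace \<pi>_def)
      then have "openin (lctop B) (f ` {a \<in> carrier A. \<pi> a \<in> U})"
        using open_map by (simp add: open_map_def)
      moreover have "f ` {a \<in> carrier A. \<pi> a \<in> U} = {x \<in> topspace (lctop B). \<Phi> x \<in> U}"
        unfolding sat using surj by (auto simp: topspace)
      ultimately show "openin (lctop B) {x \<in> topspace (lctop B). \<Phi> x \<in> U}" by simp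
    qed
    show "Abstract_Topology.open_map (lctop B) (lctop (lca_quotient A K)) \<Phi>"
      unfolding open_map_def
    proof (intro allI impI)
      fix V assume V: "openin (lctop B) V"
      then have VB: "V \<subseteq> carrier B"
        using openin_subset topspace by blast
      have "{a \<in> carrier A. \<pi> a \<in> \<Phi> ` V} = {a \<in> topspace (lctop A). f a \<in> V}"
        by (simp add: topspace inj_on_image_mem_iff[OF inj f_simps(1) VB] \<pi> cong: conj_cong)
      moreover have "openin (lctop A) {a \<in> topspace (lctop A). f a \<in> V}"
        by (rule openin_continuous_map_preimage[OF cont V])
      moreover have "\<Phi> ` V \<subseteq> \<pi> ` carrier A"
        using VB img by blast
      ultimately show "openin (lctop (lca_quotient A K)) (\<Phi> ` V)"
        by (simp add: openin_quotient_topology topspace \<pi>_def)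
    qed
  qed (use img inj in \<open>simp_all add: topspace \<pi>_def\<close>)
  ultimately have "\<Phi> \<in> lca_iso B (lca_quotient A K)"
    by (simp add: lca_iso_def alg_hom_def bij_betw_def)
  then show ?thesis
    by (simp add: \<Phi>_def[abs_def])
qed

end

section \<open>The locally convex algebra of free holomorphic functions\<close>

lemma has_radius_diff:
  assumes "has_radius r F" "has_radius r G"
  shows "has_radius r (\<lambda>w. F w - G w)"
  using has_radius_add(1)[OF assms(1) has_radius_scale(1)[OF assms(2), of "-1"]] by simp

lemma wnorm_zero [simp]: "wnorm x (\<lambda>w. 0) = 0"
  by (simp add: wnorm_def)

lemma has_radius_finite_support:
  fixes F :: "'d::finite list \<Rightarrow> complex"
  assumes "finite {w. F w \<noteq> 0}"
  shows "has_radius r F"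
proof (rule has_radiusI)
  fix x
  show "summable (\<lambda>k. x ^ k * hnorm F k)"
  proof (rule summable_finite)
    show "finite (length ` {w. F w \<noteq> 0})" using assms by simp
    fix k assume "k \<notin> length ` {w. F w \<noteq> 0}"
    then have "hnorm F k = hnorm (\<lambda>w::'d list. 0) k"
      by (intro hnorm_cong) auto
    then show "x ^ k * hnorm F k = 0" by simp
  qed
qed

context
  fixes r x :: real
  assumes x: "0 < x" "x < r"
begin

lemma series_op_of_radius:
  fixes F :: "'d::finite list \<Rightarrow> complex"
  assumes F: "has_radius r F"
  shows "norm (series_op x F) \<le> wnorm x F" "series_op x F \<in> closure fock_polys"
    "symb (series_op x F) = (\<lambda>w. complex_of_real (x ^ length w) * F w)"
  using series_op_convergence[OF x(1) has_radius_summable[OF F x]] by blast+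

lemma series_op_eqI:
  fixes F :: "'d::finite list \<Rightarrow> complex"
  assumes "has_radius r F" "a \<in> closure fock_polys" "\<And>w. symb a w = complex_of_real (x ^ length w) * F w"
  shows "series_op x F = a"
  by (rule disc_eqI[OF series_op_of_radius(2)[OF assms(1)] assms(2)])
    (simp add: series_op_of_radius(3)[OF assms(1)] assms(3) fun_eq_iff)

lemma series_op_linear:
  fixes F G :: "'d::finite list \<Rightarrow> complex"
  assumes F: "has_radius r F" and G: "has_radius r G"
  shows "series_op x (\<lambda>w. F w + G w) = series_op x F + series_op x G"
    "series_op x (\<lambda>w. F w - G w) = series_op x F - series_op x G"
    "series_op x (\<lambda>w. c * F w) = c *\<^sub>C series_op x F"
  using F G by (auto intro!: series_op_eqI disc_add disc_diff disc_scale has_radius_add has_radius_diff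
      has_radius_scale simp: series_op_of_radius symb_add symb_diff symb_scaleC distrib_left right_diff_distrib)

lemma series_op_one: "series_op x (\<lambda>w. of_bool (w = [])) = id_blinfun"
  by (rule series_op_eqI) (auto intro: has_radius_finite_support disc_poly fock_polys.one simp: symb_id)

lemma symb_series_op_mult:
  fixes F G :: "'d::finite list \<Rightarrow> complex"
  assumes F: "has_radius r F" and G: "has_radius r G"
  shows "symb (series_op x F o\<^sub>L series_op x G) w = complex_of_real (x ^ length w) * series_mult F G w"
proof -
  have "symb (series_op x F o\<^sub>L series_op x G) w
    = series_mult (\<lambda>w. complex_of_real (x ^ length w) * F w) (\<lambda>w. complex_of_real (x ^ length w) * G w) w"
    by (simp only: symb_mult series_op_of_radius[OF F] series_op_of_radius[OF G])
  then show ?thesis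
    by (subst (asm) series_mult_dilate) (simp_all add: power_add)
qed

end

lemma dil_series_op:
  fixes F :: "'d::finite list \<Rightarrow> complex"
  assumes F: "has_radius r F" and xy: "0 < x" "x < y" "y < r"
  shows "dil (x / y) (series_op y F) = series_op x F"
proof (rule dil_eqI)
  have x: "x < r" and y: "0 < y" using xy by simp_all
  show "symb (series_op x F) w = complex_of_real ((x / y) ^ length w) * symb (series_op y F) w" for w
    using y by (simp add: series_op_of_radius(3)[OF y xy(3) F] series_op_of_radius(3)[OF xy(1) x F] power_divide)
  show "series_op x F \<in> closure fock_polys"
    by (rule series_op_of_radius(2)[OF xy(1) x F])
qed (use xy in auto)

text \<open>The product is controlled through the operators: \<open>F(x s) G(x s)\<close> is bounded, and its norm dominates
the homogeneous parts of its symbol.\<close>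

lemma has_radius_mult:
  fixes F G :: "'d::finite list \<Rightarrow> complex"
  assumes F: "has_radius r F" and G: "has_radius r G"
  shows "has_radius r (series_mult F G)"
  unfolding has_radius_def
proof (intro allI impI)
  fix x assume x: "0 < x" "x < r"
  let ?a = "series_op x F o\<^sub>L series_op x G"
  have "x ^ k * hnorm (series_mult F G) k \<le> norm ?a" for k
  proof -
    have "x ^ k * hnorm (series_mult F G) k
        = hnorm (\<lambda>w. complex_of_real (x ^ length w) * series_mult F G w) k"
      using x by (subst hnorm_dilate) simp
    also have "\<dots> = hnorm (symb ?a) k"
      by (simp only: symb_series_op_mult[OF x F G, symmetric])
    also have "\<dots> \<le> norm ?a"
      by (rule hnorm_symb_le)
    finally show ?thesis .
  qed
  then show "\<exists>C. \<forall>k. x ^ k * hnorm (series_mult F G) k \<le> C" by blast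
qed

lemma series_op_mult:
  fixes F G :: "'d::finite list \<Rightarrow> complex"
  assumes F: "has_radius r F" and G: "has_radius r G" and x: "0 < x" "x < r"
  shows "series_op x (series_mult F G) = series_op x F o\<^sub>L series_op x G"
  by (intro series_op_eqI[OF x] has_radius_mult F G disc_mult series_op_of_radius(2)[OF x]
      symb_series_op_mult[OF x])

lemma series_mult_one_right: "series_mult F (\<lambda>w. of_bool (w = [])) = F"
proof
  fix w
  have "series_mult F (\<lambda>w. of_bool (w = [])) w
      = (\<Sum>z | fst z @ snd z = w. if z = (w, []) then F w else 0)"
    unfolding series_mult_def case_prod_unfold by (rule sum.cong) auto
  then show "series_mult F (\<lambda>w. of_bool (w = [])) w = F w"
    by (simp add: sum.delta)
qed

lemma free_hol_algebra_simps [simp]: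
  "carrier (free_hol_algebra H r) = free_hol H r" "mult (free_hol_algebra H r) = series_mult"
  "one (free_hol_algebra H r) = (\<lambda>w. of_bool (w = []))" "zero (free_hol_algebra H r) = (\<lambda>w. 0)"
  "add (free_hol_algebra H r) = (\<lambda>F G w. F w + G w)" "smult (free_hol_algebra H r) = (\<lambda>c F w. c * F w)"
  by (simp_all add: free_hol_algebra_def)

lemma lctop_free_hol_algebra: "lctop (free_hol_algebra H r) = topology_generated_by
       {{G \<in> free_hol H r. free_norm H x (\<lambda>w. G w - F w) < e} | F x e.
          F \<in> free_hol H r \<and> 0 < x \<and> x < r \<and> 0 < e}"
  by (simp add: free_hol_algebra_def)

context infinite_dimensional
begin

lemma ring_free_hol_algebra:
  assumes r: "0 < r"
  shows "ring (free_hol_algebra H r :: ('d::finite list \<Rightarrow> complex) lc_algebra)"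
proof (rule ringI)
  show "abelian_group (free_hol_algebra H r :: ('d list \<Rightarrow> complex) lc_algebra)"
  proof (rule abelian_groupI)
    fix F :: "'d list \<Rightarrow> complex" assume F: "F \<in> carrier (free_hol_algebra H r)"
    then show "\<exists>G\<in>carrier (free_hol_algebra H r). G \<oplus>\<^bsub>free_hol_algebra H r\<^esub> F = \<zero>\<^bsub>free_hol_algebra H r\<^esub>"
      using has_radius_scale(1)[of r F "-1"]
      by (intro bexI[of _ "\<lambda>w. - F w"]) (simp_all add: free_hol_iff[OF r])
  qed (auto simp: free_hol_iff[OF r] algebra_simps intro: has_radius_add has_radius_finite_support)
  show "monoid (free_hol_algebra H r :: ('d list \<Rightarrow> complex) lc_algebra)"
    by (rule monoidI) (auto simp: free_hol_iff[OF r] series_mult_assoc series_mult_one_left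
        series_mult_one_right intro: has_radius_mult has_radius_finite_support)
qed (simp_all add: fun_eq_iff series_mult_add_left series_mult_add_right)

text \<open>The defining subbasis consists of balls around arbitrary centres for the norms \<open>free_norm H x\<close>. This is the
description by balls of the weighted norms around the points of the open set.\<close>

lemma openin_free_hol:
  assumes r: "0 < r"
  shows "openin (lctop (free_hol_algebra H r)) U \<longleftrightarrow> U \<subseteq> free_hol H r \<and>
    (\<forall>F\<in>U. \<exists>x e. 0 < x \<and> x < r \<and> 0 < e \<and>
      (\<forall>G\<in>free_hol H r. wnorm x (\<lambda>w. G w - F w) < e \<longrightarrow> G \<in> (U :: ('d::finite list \<Rightarrow> complex) set)))"
    (is "_ \<longleftrightarrow> _ \<and> (\<forall>F\<in>U. ?nbhd U F)")
proof
  assume "openin (lctop (free_hol_algebra H r)) U"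
  then have gen: "generate_topology_on {{G \<in> free_hol H r. free_norm H x (\<lambda>w. G w - F w) < e} | F x e.
          F \<in> free_hol H r \<and> 0 < x \<and> x < r \<and> 0 < e} U" (is "generate_topology_on ?S U")
    by (simp add: lctop_free_hol_algebra openin_topology_generated_by)
  have sub: "V \<subseteq> free_hol H r" if "generate_topology_on ?S V" for V
    using that by induction auto
  have "\<forall>F\<in>U. ?nbhd U F"
    using gen
  proof induction
    case Empty
    show ?case by simp
  next
    case (Int U V)
    show ?case
    proof
      fix F assume F: "F \<in> U \<inter> V"

      obtain x e where x: "0 < x" "x < r" "0 < e"
        "\<And>G. G \<in> free_hol H r \<Longrightarrow> wnorm x (\<lambda>w. G w - F w) < e \<Longrightarrow> G \<in> U"
        using Int F by blast
      obtain y e' where y: "0 < y" "y < r" "0 < e'"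
        "\<And>G. G \<in> free_hol H r \<Longrightarrow> wnorm y (\<lambda>w. G w - F w) < e' \<Longrightarrow> G \<in> V"
        using Int F by blast
      have Fm: "has_radius r F" using F sub[OF Int.hyps(1)] free_hol_iff[OF r] by blast
      have "G \<in> U \<inter> V" if G: "G \<in> free_hol H r" and le: "wnorm (max x y) (\<lambda>w. G w - F w) < min e e'" for G
      proof -
        have "has_radius r (\<lambda>w. G w - F w)"
          using G Fm free_hol_iff[OF r] has_radius_diff by blast
        then have "wnorm x (\<lambda>w. G w - F w) \<le> wnorm (max x y) (\<lambda>w. G w - F w)"
          "wnorm y (\<lambda>w. G w - F w) \<le> wnorm (max x y) (\<lambda>w. G w - F w)"
          using x y by (auto intro!: wnorm_mono)
        then show ?thesis
          using x(4)[OF G] y(4)[OF G] le by auto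
      qed
      then show "?nbhd (U \<inter> V) F"
        using x y by (intro exI[of _ "max x y"] exI[of _ "min e e'"]) auto
    qed
  next
    case (UN K)
    then show ?case by (meson UnionE UnionI)
  next
    case (Basis s)
    then obtain F0 x e where s: "s = {G \<in> free_hol H r. free_norm H x (\<lambda>w. G w - F0 w) < e}"
      and F0: "F0 \<in> free_hol H r" and x: "0 < x" "x < r" by blast
    show ?case
    proof
      fix F assume F: "F \<in> s"
      then have Fm: "F \<in> free_hol H r" by (simp add: s)
      have diff: "(\<lambda>w. F w - G w) \<in> free_hol H r" if "F \<in> free_hol H r" "G \<in> free_hol H r"
        for F G :: "'d list \<Rightarrow> complex"
        using that has_radius_diff by (auto simp: free_hol_iff[OF r])
      have "G \<in> s" if G: "G \<in> free_hol H r"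
        and le: "wnorm x (\<lambda>w. G w - F w) < e - free_norm H x (\<lambda>w. F w - F0 w)" for G
      proof -
        have "free_norm H x (\<lambda>w. (G w - F w) + (F w - F0 w))
            \<le> free_norm H x (\<lambda>w. G w - F w) + free_norm H x (\<lambda>w. F w - F0 w)"
          by (intro free_norm_triangle[OF _ _ x] diff G Fm F0)
        also have "\<dots> \<le> wnorm x (\<lambda>w. G w - F w) + free_norm H x (\<lambda>w. F w - F0 w)"
          by (intro add_right_mono free_norm_estimates(2)[OF _ x] diff G Fm)
        also have "\<dots> < e" using le by simp
        finally show ?thesis using G by (simp add: s)
      qed
      then show "?nbhd s F"
        using F x by (intro exI[of _ x] exI[of _ "e - free_norm H x (\<lambda>w. F w - F0 w)"]) (auto simp: s)
    qed
  qed
  then show "U \<subseteq> free_hol H r \<and> (\<forall>F\<in>U. ?nbhd U F)" using sub[OF gen] by blast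
next
  assume U: "U \<subseteq> free_hol H r \<and> (\<forall>F\<in>U. ?nbhd U F)"
  show "openin (lctop (free_hol_algebra H r)) U"
    unfolding openin_subopen[of _ U]
  proof
    fix F assume "F \<in> U"
    then have F: "F \<in> free_hol H r" using U by blast
    obtain x e where x: "0 < x" "x < r" "0 < e"
      and sub: "\<And>G. G \<in> free_hol H r \<Longrightarrow> wnorm x (\<lambda>w. G w - F w) < e \<Longrightarrow> G \<in> U"
      using U \<open>F \<in> U\<close> by meson
    obtain y where y: "x < y" "y < r" using dense[OF x(2)] by blast
    define C where "C = 1 - x / ((x + y) / 2)"
    have C: "0 < C" using x y by (simp add: C_def field_simps)
    define B where "B = {G \<in> free_hol H r. free_norm H y (\<lambda>w. G w - F w) < e * C}"
    have "openin (lctop (free_hol_algebra H r)) B"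
      unfolding lctop_free_hol_algebra B_def
      by (rule topology_generated_by_Basis) (use F x y C in force)
    moreover have "F \<in> B"
    proof -
      have "free_norm H y (\<lambda>w::'d list. 0) \<le> 0"
        using free_norm_estimates(2)[of "\<lambda>w::'d list. 0" r y] x y
          has_radius_finite_support[of "\<lambda>w::'d list. 0" r]
        by (auto simp: free_hol_iff[OF r])
      then show ?thesis
        using F x C by (simp add: B_def order_le_less_trans[of _ 0])
    qed
    moreover have "B \<subseteq> U"
    proof
      fix G assume "G \<in> B"
      then have G: "G \<in> free_hol H r" "free_norm H y (\<lambda>w. G w - F w) < e * C"
        by (simp_all add: B_def)
      have "wnorm x (\<lambda>w. G w - F w) \<le> free_norm H y (\<lambda>w. G w - F w) / C"
        unfolding C_def using G F x y has_radius_diff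
        by (intro free_norm_estimates(4)[of _ r]) (auto simp: free_hol_iff[OF r])
      also have "\<dots> < e" using G C by (simp add: divide_less_eq)
      finally show "G \<in> U" using sub[OF G(1)] by simp
    qed
    ultimately show "\<exists>T. openin (lctop (free_hol_algebra H r)) T \<and> F \<in> T \<and> T \<subseteq> U" by blast
  qed
qed

lemma topspace_free_hol:
  assumes r: "0 < r"
  shows "topspace (lctop (free_hol_algebra H r)) = free_hol H r"
proof -
  have "openin (lctop (free_hol_algebra H r)) (free_hol H r)"
    unfolding openin_free_hol[OF r] using dense[OF r] zero_less_one by blast
  then show ?thesis
    using openin_free_hol[OF r] openin_subset openin_topspace by (metis subset_antisym)
qed

end

section \<open>The map from free holomorphic functions to the inverse limit\<close>

lemma inverse_limit_simps:
  "carrier (inverse_limit X A \<psi>) = {a \<in> Pi\<^sub>E X (\<lambda>x. carrier (A x)). \<forall>x\<in>X. \<forall>y\<in>X. x < y \<longrightarrow> \<psi> x y (a y) = a x}"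
  "mult (inverse_limit X A \<psi>) = (\<lambda>a b. \<lambda>x\<in>X. a x \<otimes>\<^bsub>A x\<^esub> b x)"
  "one (inverse_limit X A \<psi>) = (\<lambda>x\<in>X. \<one>\<^bsub>A x\<^esub>)"
  "add (inverse_limit X A \<psi>) = (\<lambda>a b. \<lambda>x\<in>X. a x \<oplus>\<^bsub>A x\<^esub> b x)"
  "smult (inverse_limit X A \<psi>) = (\<lambda>c a. \<lambda>x\<in>X. c \<odot>\<^bsub>A x\<^esub> a x)"
  "lctop (inverse_limit X A \<psi>) = subtopology (product_topology (\<lambda>x. lctop (A x)) X) (carrier (inverse_limit X A \<psi>))"
  by (simp_all add: inverse_limit_def Let_def)

text \<open>The two cases of the theorem are treated together. For a graded ideal, \<open>q\<close> is the coset map of \<open>J\<close>; for the plain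
inverse limit, \<open>J = {0}\<close> and \<open>q\<close> is the identity.\<close>

locale disc_quotient_limit = infinite_dimensional H + closed_graded_ideal J
  for H :: "'h::complex_hilbert itself" and J :: "('d::finite fock \<Rightarrow>\<^sub>L 'd fock) set" +
  fixes r :: real and B :: "'b lc_algebra" and q :: "('d fock \<Rightarrow>\<^sub>L 'd fock) \<Rightarrow> 'b"
    and \<psi> :: "real \<Rightarrow> real \<Rightarrow> 'b \<Rightarrow> 'b"
  assumes r: "0 < r" and q_hom: "q \<in> alg_hom disc_algebra B"
    and q_surj: "q ` closure fock_polys = carrier B"
    and q_top: "topspace (lctop B) = carrier B"
    and q_cont: "continuous_map (top_of_set (closure fock_polys)) (lctop B) q"
    and q_open: "open_map (top_of_set (closure fock_polys)) (lctop B) q"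
    and q_eq: "a \<in> closure fock_polys \<Longrightarrow> b \<in> closure fock_polys \<Longrightarrow> q a = q b \<longleftrightarrow> a - b \<in> J"
    and \<psi>: "0 < x \<Longrightarrow> x < y \<Longrightarrow> y < r \<Longrightarrow> a \<in> closure fock_polys \<Longrightarrow> \<psi> x y (q a) = q (dilation x y a)"
begin

abbreviation "L \<equiv> inverse_limit {0<..<r} (\<lambda>x. B) \<psi>"

definition \<Psi> :: "('d list \<Rightarrow> complex) \<Rightarrow> real \<Rightarrow> 'b"
  where "\<Psi> F = (\<lambda>x\<in>{0<..<r}. q (series_op x F))"

lemma q_simps:
  assumes "a \<in> closure fock_polys"
  shows "q a \<in> carrier B" "b \<in> closure fock_polys \<Longrightarrow> q (a o\<^sub>L b) = q a \<otimes>\<^bsub>B\<^esub> q b"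
    "b \<in> closure fock_polys \<Longrightarrow> q (a + b) = q a \<oplus>\<^bsub>B\<^esub> q b" "q id_blinfun = \<one>\<^bsub>B\<^esub>"
    "q (c *\<^sub>C a) = c \<odot>\<^bsub>B\<^esub> q a"
  using alg_homD[OF q_hom] assms by simp_all

lemma \<Psi>_mem: "has_radius r F \<Longrightarrow> \<Psi> F \<in> carrier L"
  by (auto simp: inverse_limit_simps \<Psi>_def q_simps series_op_of_radius \<psi> dilation_eq dil_series_op)

lemma \<Psi>_alg_hom: "\<Psi> \<in> alg_hom (free_hol_algebra H r) L"
  using \<Psi>_mem
  by (auto simp: alg_hom_def ring_hom_def free_hol_iff[OF r] inverse_limit_simps(2-5) \<Psi>_def
      q_simps series_op_mult series_op_of_radius series_op_linear series_op_one disc_poly fock_polys.one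
      intro!: restrict_ext q_simps(4)[OF disc_poly[OF fock_polys.one]])

text \<open>The comparison function \<open>F0\<close> serves openness: if the member at \<open>y\<close> of the family \<open>X\<close> has a representative near \<open>F0(y s)\<close>,
then \<open>X\<close> comes from a function near \<open>F0\<close>. Surjectivity is the case \<open>F0 = 0\<close>.\<close>

lemma \<Psi>_lift:
  assumes X: "X \<in> carrier L" and F0: "has_radius r F0" and \<eta>: "0 < \<eta>"
  obtains G where "has_radius r G" "\<Psi> G = X"
    "\<And>y a k. \<lbrakk>0 < y; y < r; a \<in> closure fock_polys; q a = X y\<rbrakk>
      \<Longrightarrow> y ^ k * hnorm (\<lambda>w. G w - F0 w) k \<le> norm (a - series_op y F0) + \<eta>"
proof -
  have X_mem: "X x \<in> q ` closure fock_polys" if "0 < x" "x < r" for x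
    using X that by (auto simp: inverse_limit_simps q_surj)
  define b where "b x = (SOME a. a \<in> closure fock_polys \<and> q a = X x)" for x
  have b: "b x \<in> closure fock_polys" "q (b x) = X x" if "0 < x" "x < r" for x
  proof -
    have "\<exists>a. a \<in> closure fock_polys \<and> q a = X x" using X_mem[OF that] by force
    from someI_ex[OF this] show "b x \<in> closure fock_polys" "q (b x) = X x" by (simp_all add: b_def)
  qed
  have b_compat: "dil (x / y) (b y) - b x \<in> J" if "0 < x" "x < y" "y < r" for x y
  proof -
    have "q (dil (x / y) (b y)) = \<psi> x y (X y)"
      using \<psi>[OF that b(1)] b(2) that by (simp add: dilation_eq b(1))
    also have "\<dots> = q (b x)"
      using X that b(2) by (simp add: inverse_limit_simps)
    finally show ?thesis
      using that b(1) by (simp add: q_eq dil_convergence(2))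
  qed
  define c where "c x = b x - series_op x F0" for x
  have c: "c x \<in> closure fock_polys" if "0 < x" "x < r" for x
    unfolding c_def using that by (intro disc_diff b series_op_of_radius(2)[OF _ _ F0])
  have compat: "dil (x / y) (c y) - c x \<in> J" if "0 < x" "x < y" "y < r" for x y
  proof -
    have "dil (x / y) (c y) - c x = dil (x / y) (b y) - b x"
      using that by (simp add: c_def dil_linear dil_series_op[OF F0])
    then show ?thesis using b_compat[OF that] by simp
  qed
  obtain E where E: "has_radius r E"
    and EJ: "\<And>x. 0 < x \<Longrightarrow> x < r \<Longrightarrow> series_op x E - c x \<in> J"
    and bound: "\<And>x a k. 0 < x \<Longrightarrow> x < r \<Longrightarrow> a - c x \<in> J \<Longrightarrow> x ^ k * hnorm E k \<le> norm a + \<eta>"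
    by (rule graded_lift[of r c \<eta>, OF r c compat \<eta>], assumption+, rule that)
  define G where "G = (\<lambda>w. F0 w + E w)"
  have G: "has_radius r G"
    unfolding G_def by (rule has_radius_add(1)[OF F0 E])
  show thesis
  proof (rule that[OF G])
    have "q (series_op x G) = X x" if x: "0 < x" "x < r" for x
    proof -
      have "series_op x G - b x = series_op x E - c x"
        by (simp add: G_def c_def series_op_linear[OF x F0 E])
      then show ?thesis
        using EJ[OF x] q_eq[OF series_op_of_radius(2)[OF x G] b(1)[OF x]] b(2)[OF x] by simp
    qed
    moreover have "X \<in> extensional {0<..<r}"
      using X by (simp add: inverse_limit_simps PiE_def)
    ultimately show "\<Psi> G = X"
      by (auto simp: \<Psi>_def fun_eq_iff extensional_def)
    fix y a k assume y: "0 < y" "y < r" and a: "a \<in> closure fock_polys" "q a = X y"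
    have "a - b y \<in> J"
      using q_eq[OF a(1) b(1)[OF y]] a(2) b(2)[OF y] by simp
    then have "(a - series_op y F0) - c y \<in> J"
      by (simp add: c_def)
    then show "y ^ k * hnorm (\<lambda>w. G w - F0 w) k \<le> norm (a - series_op y F0) + \<eta>"
      using bound[OF y, of "a - series_op y F0" k] by (simp add: G_def)
  qed
qed

lemma \<Psi>_surj: "\<Psi> ` free_hol H r = carrier L"
proof
  show "\<Psi> ` free_hol H r \<subseteq> carrier L"
    using \<Psi>_mem free_hol_iff[OF r] by blast
  show "carrier L \<subseteq> \<Psi> ` free_hol H r"
  proof
    fix X assume "X \<in> carrier L"
    moreover have "has_radius r (\<lambda>w::'d list. 0)"
      by (rule has_radius_finite_support) simp
    ultimately obtain G where "has_radius r G" "\<Psi> G = X"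
      by (rule \<Psi>_lift[OF _ _ zero_less_one])
    then show "X \<in> \<Psi> ` free_hol H r"
      using free_hol_iff[OF r] by blast
  qed
qed

lemma topspace_L: "topspace (lctop L) = carrier L"
  by (auto simp: inverse_limit_simps(6) q_top) (auto simp: inverse_limit_simps(1))

lemma continuous_series_op:
  assumes x: "0 < x" "x < r"
  shows "continuous_map (lctop (free_hol_algebra H r)) (top_of_set (closure fock_polys))
    (series_op x :: ('d list \<Rightarrow> complex) \<Rightarrow> _)"
  unfolding continuous_map_def topspace_free_hol[OF r]
proof (intro conjI allI impI)
  show "series_op x \<in> free_hol H r \<rightarrow> topspace (top_of_set (closure fock_polys))"
    using series_op_of_radius(2)[OF x] free_hol_iff[OF r] by auto
  fix U :: "('d fock \<Rightarrow>\<^sub>L 'd fock) set"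
  assume "openin (top_of_set (closure fock_polys)) U"
  then have U: "\<And>a. a \<in> U \<Longrightarrow> \<exists>e>0. \<forall>b\<in>closure fock_polys. dist b a < e \<longrightarrow> b \<in> U"
    unfolding openin_euclidean_subtopology_iff by blast
  show "openin (lctop (free_hol_algebra H r)) {F \<in> free_hol H r. series_op x F \<in> U}"
    unfolding openin_free_hol[OF r]
  proof (intro conjI ballI)
    fix F assume "F \<in> {F \<in> free_hol H r. series_op x F \<in> U}"
    then have F: "has_radius r F" and "series_op x F \<in> U"
      by (simp_all add: free_hol_iff[OF r])
    then obtain e where e: "0 < e" "\<And>b. b \<in> closure fock_polys \<Longrightarrow> dist b (series_op x F) < e \<Longrightarrow> b \<in> U"
      using U by blast
    have "series_op x G \<in> U" if G: "has_radius r G" and le: "wnorm x (\<lambda>w. G w - F w) < e" for G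
    proof (rule e(2)[OF series_op_of_radius(2)[OF x G]])
      show "dist (series_op x G) (series_op x F) < e"
        using series_op_of_radius(1)[OF x has_radius_diff[OF G F]] le
        by (simp add: dist_norm series_op_linear[OF x G F])
    qed
    then show "\<exists>y e. 0 < y \<and> y < r \<and> 0 < e \<and> (\<forall>G\<in>free_hol H r. wnorm y (\<lambda>w. G w - F w) < e
        \<longrightarrow> G \<in> {F \<in> free_hol H r. series_op x F \<in> U})"
      using x e(1) free_hol_iff[OF r] by blast
  qed auto
qed

lemma \<Psi>_continuous: "continuous_map (lctop (free_hol_algebra H r)) (lctop L) \<Psi>"
  unfolding inverse_limit_simps(6) continuous_map_in_subtopology continuous_map_componentwise
    topspace_free_hol[OF r]
proof (intro conjI ballI)
  show "\<Psi> ` free_hol H r \<subseteq> extensional {0<..<r}"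
    by (auto simp: \<Psi>_def)
  show "\<Psi> \<in> free_hol H r \<rightarrow> carrier L"
    using \<Psi>_surj by auto
  fix x assume x: "x \<in> {0<..<r}"
  have "continuous_map (lctop (free_hol_algebra H r)) (lctop B) (q \<circ> series_op x)"
    using x by (intro continuous_map_compose[OF continuous_series_op q_cont]) auto
  then show "continuous_map (lctop (free_hol_algebra H r)) (lctop B) (\<lambda>F. \<Psi> F x)"
    using x by (simp add: \<Psi>_def o_def)
qed

text \<open>A neighbourhood of \<open>F0\<close> contains a ball for some weight \<open>x\<close>. For \<open>y\<close> between \<open>x\<close> and \<open>r\<close>, the families whose
member at \<open>y\<close> has a representative close to \<open>F0(y s)\<close> form an open set, and by the lift they are images of functions
in the ball; the step from \<open>y\<close> to \<open>x\<close> makes the sum over the degrees converge.\<close>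

lemma \<Psi>_open: "open_map (lctop (free_hol_algebra H r)) (lctop L) \<Psi>"
  unfolding open_map_def
proof (intro allI impI)
  fix U :: "('d list \<Rightarrow> complex) set"
  assume U: "openin (lctop (free_hol_algebra H r)) U"
  show "openin (lctop L) (\<Psi> ` U)"
    unfolding openin_subopen[of _ "\<Psi> ` U"]
  proof
    fix X0 assume "X0 \<in> \<Psi> ` U"
    then obtain F0 where F0U: "F0 \<in> U" and X0: "X0 = \<Psi> F0" by blast
    have F0: "has_radius r F0"
      using U F0U openin_free_hol[OF r] free_hol_iff[OF r] by blast
    obtain x e where x: "0 < x" "x < r" "0 < e"
      and sub: "\<And>G. G \<in> free_hol H r \<Longrightarrow> wnorm x (\<lambda>w. G w - F0 w) < e \<Longrightarrow> G \<in> U"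
      using U F0U unfolding openin_free_hol[OF r] by meson
    obtain y where y: "x < y" "y < r" using dense[OF x(2)] by blast
    then have y0: "0 < y" using x by simp
    define C where "C = 1 - x / y"
    have C: "0 < C" using x y by (simp add: C_def)
    \<comment> \<open>The lift costs \<open>2 \<delta>\<close> and the change of radius a factor \<open>1 / C\<close>.\<close>
    define \<delta> where "\<delta> = e * C / 3"
    have \<delta>: "0 < \<delta>" using x C by (simp add: \<delta>_def)
    define a0 where "a0 = series_op y F0"
    have a0: "a0 \<in> closure fock_polys" unfolding a0_def by (rule series_op_of_radius(2)[OF y0 y(2) F0])
    define V where "V = q ` (closure fock_polys \<inter> ball a0 \<delta>)"
    define W where "W = {X \<in> topspace (lctop L). X y \<in> V}"
    have "openin (lctop B) V"
      unfolding V_def using q_open open_map_def openin_open_Int[OF open_ball] by blast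
    moreover have "continuous_map (lctop L) (lctop B) (\<lambda>X. X y)"
      unfolding inverse_limit_simps(6)
      by (intro continuous_map_from_subtopology continuous_map_product_projection) (use y y0 in auto)
    ultimately have "openin (lctop L) W"
      unfolding W_def by (intro openin_continuous_map_preimage)
    moreover have "X0 \<in> W"
      using \<Psi>_mem[OF F0] a0 \<delta> y y0
      by (auto simp: W_def topspace_L X0 V_def \<Psi>_def a0_def[symmetric] intro!: imageI)
    moreover have "W \<subseteq> \<Psi> ` U"
    proof
      fix X assume "X \<in> W"
      then have X: "X \<in> carrier L" and "X y \<in> V" by (simp_all add: W_def topspace_L)
      then obtain a where a: "a \<in> closure fock_polys" "dist a0 a < \<delta>" "q a = X y"
        by (auto simp: V_def)
      obtain G where G: "has_radius r G" "\<Psi> G = X"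
        and bound: "\<And>y a k. \<lbrakk>0 < y; y < r; a \<in> closure fock_polys; q a = X y\<rbrakk>
          \<Longrightarrow> y ^ k * hnorm (\<lambda>w. G w - F0 w) k \<le> norm (a - series_op y F0) + \<delta>"
        by (rule \<Psi>_lift[OF X F0 \<delta>], rule that)
      have "y ^ k * hnorm (\<lambda>w. G w - F0 w) k \<le> 2 * \<delta>" for k
        using bound[OF y0 y(2) a(1,3), of k] a(2) by (simp add: a0_def dist_norm norm_minus_commute)
      then have "wnorm x (\<lambda>w. G w - F0 w) \<le> 2 * \<delta> / C"
        unfolding C_def by (rule geometric_bound(2)[OF x(1) y(1)])
      also have "\<dots> < e"
        using C x by (simp add: \<delta>_def)
      finally have "G \<in> U"
        using sub G free_hol_iff[OF r] by blast
      then show "X \<in> \<Psi> ` U" using G by blast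
    qed
    ultimately show "\<exists>T. openin (lctop L) T \<and> X0 \<in> T \<and> T \<subseteq> \<Psi> ` U" by blast
  qed
qed

lemma \<Psi>_eq_iff:
  assumes F: "has_radius r F" and G: "has_radius r G"
  shows "\<Psi> F = \<Psi> G \<longleftrightarrow> (\<forall>k. homog_eval (\<lambda>w. F w - G w) creation k \<in> J)"
proof -
  have iff: "q (series_op x F) = q (series_op x G) \<longleftrightarrow> (\<forall>k. homog_eval (\<lambda>w. F w - G w) creation k \<in> J)"
    if x: "0 < x" "x < r" for x
  proof -
    note FG = has_radius_diff[OF F G]
    have cancel: "x ^ k *\<^sub>R a \<in> J \<longleftrightarrow> a \<in> J" for k a
      using x scaleR[of a "x ^ k"] scaleR[of "x ^ k *\<^sub>R a" "inverse (x ^ k)"] by auto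
    have "q (series_op x F) = q (series_op x G) \<longleftrightarrow> series_op x (\<lambda>w. F w - G w) \<in> J"
      by (simp add: q_eq series_op_of_radius(2)[OF x] F G series_op_linear[OF x F G])
    also have "\<dots> \<longleftrightarrow> (\<forall>k. x ^ k *\<^sub>R homog_eval (\<lambda>w. F w - G w) creation k \<in> J)"
      by (simp only: mem_iff_components[OF series_op_of_radius(2)[OF x FG]] series_op_of_radius(3)[OF x FG] homog_eval_weight)
    finally show ?thesis
      by (simp only: cancel)
  qed
  have "\<Psi> F = \<Psi> G \<longleftrightarrow> (\<forall>x. 0 < x \<longrightarrow> x < r \<longrightarrow> q (series_op x F) = q (series_op x G))"
    by (auto simp: \<Psi>_def fun_eq_iff restrict_def) 
  then show ?thesis
    using iff dense[OF r] by blast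
qed

sublocale \<Psi>: open_alg_epi "free_hol_algebra H r" L \<Psi>
proof (rule open_alg_epi.intro)
  show "ring (free_hol_algebra H r :: ('d list \<Rightarrow> complex) lc_algebra)"
    by (rule ring_free_hol_algebra[OF r])
qed (use \<Psi>_alg_hom \<Psi>_surj topspace_free_hol[OF r] topspace_L \<Psi>_continuous \<Psi>_open
    in \<open>auto simp: free_hol_iff[OF r] intro: has_radius_scale\<close>)

end

section \<open>Closures of graded ideals and the isomorphisms\<close>

lemma fock_homog_component:
  assumes a: "a \<in> fock_homog k"
  shows "homog_eval (symb a) creation j = (if j = k then a else 0)"
proof -
  have "a \<in> fock_polys \<and> (\<forall>w. length w \<noteq> k \<longrightarrow> symb a w = 0)"
    using a unfolding fock_homog_def
  proof (induction rule: complex_vector.span_induct_alt)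
    case base
    show ?case by (simp add: fock_polys_zero symb_zero)
  next
    case (step c x y)
    then show ?case
      by (auto simp: symb_add symb_scaleC symb_word_op intro: fock_polys.add fock_polys.scale word_op_mem_fock_polys)
  qed
  then have "a \<in> fock_polys" "symb (homog_eval (symb a) creation j) = symb (if j = k then a else 0)"
    by (auto simp: symb_homog_eval symb_zero fun_eq_iff)
  then show ?thesis
    by (intro conv_op_eqI fock_polys_conv_op homog_eval_mem_fock_polys) (auto simp: fock_polys_zero)
qed

lemma homog_eval_symb_add:
  "homog_eval (symb (a + b)) creation k = homog_eval (symb a) creation k + homog_eval (symb b) creation k"
  by (simp add: symb_add homog_eval_add)

lemma homog_eval_symb_zero [simp]: "homog_eval (symb 0) creation k = 0"
  by (simp add: symb_zero homog_eval_def)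

lemma homog_eval_symb_sum:
  "homog_eval (symb (\<Sum>i\<in>I. f i)) creation k = (\<Sum>i\<in>I. homog_eval (symb (f i)) creation k)"
  by (induction I rule: infinite_finite_induct) (simp_all add: homog_eval_symb_add)

text \<open>The last claim is where the grading enters: the homogeneous parts of a finite sum of members of the \<open>J k\<close> are its
summands, because the spaces \<open>fock_homog k\<close> are independent.\<close>

lemma graded_idealD:
  fixes I :: "('d::finite fock \<Rightarrow>\<^sub>L 'd fock) set"
  assumes "graded_ideal I"
  shows "I \<subseteq> fock_polys" "0 \<in> I" "a \<in> I \<Longrightarrow> b \<in> I \<Longrightarrow> a + b \<in> I" "a \<in> I \<Longrightarrow> c *\<^sub>C a \<in> I"
    "a \<in> I \<Longrightarrow> p \<in> fock_polys \<Longrightarrow> a o\<^sub>L p \<in> I" "a \<in> I \<Longrightarrow> p \<in> fock_polys \<Longrightarrow> p o\<^sub>L a \<in> I"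
    "a \<in> I \<Longrightarrow> homog_eval (symb a) creation k \<in> I"
proof -
  interpret ideal I "operator_algebra fock_polys"
    using assms by (simp add: graded_ideal_def)
  have simps: "carrier (operator_algebra fock_polys) = fock_polys"
    "mult (operator_algebra fock_polys) = (o\<^sub>L)" "add (operator_algebra fock_polys) = (+)"
    "zero (operator_algebra fock_polys) = 0"
    by (simp_all add: operator_algebra_def)
  show "I \<subseteq> fock_polys" and zero: "0 \<in> I" and "a \<in> I \<Longrightarrow> b \<in> I \<Longrightarrow> a + b \<in> I"
    using a_subset additive_subgroup.zero_closed[OF additive_subgroup_axioms]
      additive_subgroup.a_closed[OF additive_subgroup_axioms, of a b] by (simp_all add: simps)
  show mult: "a \<in> I \<Longrightarrow> p \<in> fock_polys \<Longrightarrow> a o\<^sub>L p \<in> I" "a \<in> I \<Longrightarrow> p \<in> fock_polys \<Longrightarrow> p o\<^sub>L a \<in> I" for a p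
    using I_l_closed[of a p] I_r_closed[of a p] by (simp_all add: simps)
  show "c *\<^sub>C a \<in> I" if "a \<in> I"
  proof -
    have "id_blinfun o\<^sub>L a = a"
      by (rule blinfun_eqI) simp
    then show ?thesis
      using mult(2)[OF that fock_polys.scale[OF fock_polys.one, of c]] by simp
  qed
  obtain J where J: "\<And>k. k \<ge> 1 \<Longrightarrow> complex_vector.subspace (J k) \<and> J k \<subseteq> fock_homog k"
    and I: "I = {\<Sum>k\<in>K. p k | K p. finite K \<and> K \<subseteq> {1..} \<and> (\<forall>k\<in>K. p k \<in> J k)}"
    using assms unfolding graded_ideal_def by blast
  assume "a \<in> I"
  then obtain K p where a: "a = (\<Sum>k\<in>K. p k)" and K: "finite K" "K \<subseteq> {1..}" "\<And>k. k \<in> K \<Longrightarrow> p k \<in> J k"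
    unfolding I by blast
  have "homog_eval (symb a) creation k = (\<Sum>j\<in>K. if k = j then p j else 0)"
    unfolding a homog_eval_symb_sum
    by (rule sum.cong) (use J K in \<open>auto intro!: fock_homog_component[THEN trans]\<close>)
  also have "\<dots> = (if k \<in> K then p k else 0)"
    using K(1) by (simp add: sum.delta)
  finally have eq: "homog_eval (symb a) creation k = (if k \<in> K then p k else 0)" .
  show "homog_eval (symb a) creation k \<in> I"
  proof (cases "k \<in> K")
    case True
    then have "\<exists>K' p'. p k = (\<Sum>k\<in>K'. p' k) \<and> finite K' \<and> K' \<subseteq> {1..} \<and> (\<forall>k\<in>K'. p' k \<in> J k)"
      using K by (intro exI[of _ "{k}"] exI[of _ p]) auto
    then show ?thesis
      using True unfolding eq I by simp
  next
    case False
    then show ?thesis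
      using zero by (simp add: eq)
  qed
qed

lemma closed_graded_ideal_closure:
  fixes I :: "('d::finite fock \<Rightarrow>\<^sub>L 'd fock) set"
  assumes I: "graded_ideal I"
  shows "closed_graded_ideal (closure I)"
proof
  note I' = graded_idealD[OF I]
  show "closure I \<subseteq> closure fock_polys" "0 \<in> closure I"
    using I'(1,2) closure_mono closure_subset by blast+
  show "a + b \<in> closure I" if "a \<in> closure I" "b \<in> closure I" for a b
    using that by (rule closure_binop[of "(+)", rotated 2]) (auto intro!: continuous_intros I')
  show "c *\<^sub>C a \<in> closure I" if "a \<in> closure I" for a c
    using that by (rule closure_scale[rotated]) (rule I')
  show "a o\<^sub>L b \<in> closure I" if "a \<in> closure I" "b \<in> closure fock_polys" for a b
    using that by (rule closure_binop[of "(o\<^sub>L)", rotated 2]) (rule continuous_compose_blinfun I'(5); assumption)+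
  show "b o\<^sub>L a \<in> closure I" if "a \<in> closure I" "b \<in> closure fock_polys" for a b
    using that(2,1) by (rule closure_binop[of "(o\<^sub>L)", rotated 2]) (rule continuous_compose_blinfun I'(6); assumption)+
  show "homog_eval (symb a) creation k \<in> closure I" if "a \<in> closure I" for a k
  proof -
    have lin: "bounded_linear (\<lambda>a :: 'd fock \<Rightarrow>\<^sub>L 'd fock. homog_eval (symb a) creation k)"
    proof (rule bounded_linear_intro[where K = 1])
      show "homog_eval (symb (t *\<^sub>R a)) creation k = t *\<^sub>R homog_eval (symb a) creation k"
        for t and a :: "'d fock \<Rightarrow>\<^sub>L 'd fock"
        by (simp add: symb_scaleR homog_eval_scale scaleC_of_real)
      show "norm (homog_eval (symb a) creation k) \<le> norm a * 1" for a :: "'d fock \<Rightarrow>\<^sub>L 'd fock"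
        using norm_homog_eval_creation_le[of "symb a" k] hnorm_symb_le[of a k] by simp
    qed (rule homog_eval_symb_add)
    have "(\<lambda>a. homog_eval (symb a) creation k) ` closure I \<subseteq> closure I"
      by (rule image_closure_subset)
        (auto intro!: bounded_linear.continuous_on[OF lin] subsetD[OF closure_subset] I')
    then show ?thesis using that by blast
  qed
qed simp

lemma ring_disc_algebra: "ring (disc_algebra :: ('d fock \<Rightarrow>\<^sub>L 'd fock) lc_algebra)"
proof (rule ringI)
  have one: "(id_blinfun :: 'd fock \<Rightarrow>\<^sub>L 'd fock) \<in> closure fock_polys"
    by (intro disc_poly fock_polys.one)
  show "abelian_group (disc_algebra :: ('d fock \<Rightarrow>\<^sub>L 'd fock) lc_algebra)"
  proof (rule abelian_groupI)
    fix a :: "'d fock \<Rightarrow>\<^sub>L 'd fock" assume "a \<in> carrier disc_algebra"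
    then show "\<exists>b\<in>carrier disc_algebra. b \<oplus>\<^bsub>disc_algebra\<^esub> a = \<zero>\<^bsub>disc_algebra\<^esub>"
      using disc_scale[of a "-1"] by (intro bexI[of _ "- a"]) simp_all
  qed (auto simp: disc_add disc_poly fock_polys_zero algebra_simps)
  show "monoid (disc_algebra :: ('d fock \<Rightarrow>\<^sub>L 'd fock) lc_algebra)"
    by (rule monoidI) (auto simp: disc_mult one intro!: blinfun_eqI)
qed (auto intro!: blinfun_eqI simp: blinfun.bilinear_simps)

context closed_graded_ideal
begin

lemma ideal: "ideal J disc_algebra"
proof (rule idealI[OF ring_disc_algebra])
  show "subgroup J (add_monoid disc_algebra)"
  proof
    interpret D: ring "disc_algebra :: ('d fock \<Rightarrow>\<^sub>L 'd fock) lc_algebra"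
      by (rule ring_disc_algebra)
    fix a assume a: "a \<in> J"
    have "\<ominus>\<^bsub>disc_algebra\<^esub> a = - a"
      using a subset disc_scale[of a "-1"] by (intro D.minus_equality) auto
    then show "inv\<^bsub>add_monoid disc_algebra\<^esub> a \<in> J"
      using scale[OF a, of "-1"] by (simp add: a_inv_def)
  qed (use subset zero add in auto)
qed (simp_all add: mult_left mult_right)

lemma coset: "J +>\<^bsub>disc_algebra\<^esub> a = (\<lambda>j. j + a) ` J"
  by (auto simp: a_r_coset_def r_coset_def)

lemma coset_eq_iff: "J +>\<^bsub>disc_algebra\<^esub> a = J +>\<^bsub>disc_algebra\<^esub> b \<longleftrightarrow> a - b \<in> J"
proof
  assume "J +>\<^bsub>disc_algebra\<^esub> a = J +>\<^bsub>disc_algebra\<^esub> b"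
  then have "0 + a \<in> (\<lambda>j. j + b) ` J"
    using zero unfolding coset by blast
  then show "a - b \<in> J" by auto
next
  assume ab: "a - b \<in> J"
  have "j + a \<in> (\<lambda>j. j + b) ` J" if "j \<in> J" for j
    using add[OF that ab] by (intro image_eqI[of _ _ "j + (a - b)"]) simp_all
  moreover have "j + b \<in> (\<lambda>j. j + a) ` J" if "j \<in> J" for j
    using diff[OF that ab] by (intro image_eqI[of _ _ "j - (a - b)"]) simp_all
  ultimately show "J +>\<^bsub>disc_algebra\<^esub> a = J +>\<^bsub>disc_algebra\<^esub> b"
    unfolding coset by blast
qed

text \<open>The preimage of the image of \<open>U\<close> is \<open>U + J\<close>, a union of translates of \<open>U\<close>.\<close>

lemma coset_map_open:
  "open_map (top_of_set (closure fock_polys)) (lctop (lca_quotient disc_algebra J)) (\<lambda>a. J +>\<^bsub>disc_algebra\<^esub> a)"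
  unfolding open_map_def
proof (intro allI impI)
  fix U :: "('d fock \<Rightarrow>\<^sub>L 'd fock) set"
  assume U: "openin (top_of_set (closure fock_polys)) U"
  have "openin (top_of_set (closure fock_polys))
      {a \<in> closure fock_polys. J +>\<^bsub>disc_algebra\<^esub> a \<in> (\<lambda>a. J +>\<^bsub>disc_algebra\<^esub> a) ` U}"
    unfolding openin_euclidean_subtopology_iff
  proof (intro conjI ballI)
    fix a assume "a \<in> {a \<in> closure fock_polys. J +>\<^bsub>disc_algebra\<^esub> a \<in> (\<lambda>a. J +>\<^bsub>disc_algebra\<^esub> a) ` U}"
    then obtain u where a: "a \<in> closure fock_polys" and u: "u \<in> U" "a - u \<in> J"
      by (auto simp: coset_eq_iff)
    obtain e where e: "0 < e" "\<And>b. b \<in> closure fock_polys \<Longrightarrow> dist b u < e \<Longrightarrow> b \<in> U"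
      using U u(1) unfolding openin_euclidean_subtopology_iff by blast
    have "J +>\<^bsub>disc_algebra\<^esub> b \<in> (\<lambda>a. J +>\<^bsub>disc_algebra\<^esub> a) ` U"
      if b: "b \<in> closure fock_polys" "dist b a < e" for b
    proof -
      have "b - (a - u) \<in> U"
        by (rule e(2)) (use disc_diff[OF b(1) subsetD[OF subset u(2)]] b(2) in \<open>simp_all add: dist_norm\<close>)
      moreover have "J +>\<^bsub>disc_algebra\<^esub> b = J +>\<^bsub>disc_algebra\<^esub> (b - (a - u))"
        using u by (simp add: coset_eq_iff)
      ultimately show ?thesis by blast
    qed
    then show "\<exists>e>0. \<forall>b\<in>closure fock_polys. dist b a < e \<longrightarrow>
        b \<in> {a \<in> closure fock_polys. J +>\<^bsub>disc_algebra\<^esub> a \<in> (\<lambda>a. J +>\<^bsub>disc_algebra\<^esub> a) ` U}"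
      using e(1) by blast
  qed auto
  then show "openin (lctop (lca_quotient disc_algebra J)) ((\<lambda>a. J +>\<^bsub>disc_algebra\<^esub> a) ` U)"
    using openin_subset[OF U] by (auto simp: openin_quotient_topology)
qed

lemma coset_map_continuous:
  "continuous_map (top_of_set (closure fock_polys)) (lctop (lca_quotient disc_algebra J)) (\<lambda>a. J +>\<^bsub>disc_algebra\<^esub> a)"
  by (auto simp: continuous_map_def openin_quotient_topology)

lemma induced_map_coset:
  assumes "0 < x" "x < y" and a: "a \<in> closure fock_polys"
  shows "induced_map disc_algebra J (dilation x y) (J +>\<^bsub>disc_algebra\<^esub> a) = J +>\<^bsub>disc_algebra\<^esub> dilation x y a"
proof -
  have t: "0 < x / y" "x / y < 1" using assms by simp_all
  have "J +>\<^bsub>disc_algebra\<^esub> dilation x y (j + a) = J +>\<^bsub>disc_algebra\<^esub> dilation x y a" if "j \<in> J" for j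
  proof -
    have "dilation x y (j + a) - dilation x y a = dil (x / y) j"
      using that subset a assms by (subst (1 2) dilation_eq) (auto simp: disc_add dil_linear[OF t])
    then show ?thesis
      by (simp add: coset_eq_iff dil_mem[OF t that])
  qed
  then show ?thesis
    using zero by (auto simp: induced_map_def coset)
qed

lemma coset_map_limit:
  assumes "infinite_dimensional TYPE('h::complex_hilbert)" "0 < r"
  shows "disc_quotient_limit TYPE('h) J r (lca_quotient disc_algebra J) (\<lambda>a. J +>\<^bsub>disc_algebra\<^esub> a)
    (\<lambda>x y. induced_map disc_algebra J (dilation x y))"
proof (intro disc_quotient_limit.intro disc_quotient_limit_axioms.intro)
  show "(\<lambda>a. J +>\<^bsub>disc_algebra\<^esub> a) \<in> alg_hom disc_algebra (lca_quotient disc_algebra J)"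
  proof (rule coset_map_alg_hom[OF ideal])
    fix c a b
    assume "J +>\<^bsub>disc_algebra\<^esub> a = J +>\<^bsub>disc_algebra\<^esub> b"
    then have "c *\<^sub>C (a - b) \<in> J"
      by (simp add: coset_eq_iff scale)
    then show "J +>\<^bsub>disc_algebra\<^esub> (c \<odot>\<^bsub>disc_algebra\<^esub> a) = J +>\<^bsub>disc_algebra\<^esub> (c \<odot>\<^bsub>disc_algebra\<^esub> b)"
      by (simp add: coset_eq_iff complex_vector.scale_right_diff_distrib)
  qed (simp add: disc_scale)
  show "open_map (top_of_set (closure fock_polys)) (lctop (lca_quotient disc_algebra J)) (\<lambda>a. J +>\<^bsub>disc_algebra\<^esub> a)"
    by (rule coset_map_open)
  show "continuous_map (top_of_set (closure fock_polys)) (lctop (lca_quotient disc_algebra J)) (\<lambda>a. J +>\<^bsub>disc_algebra\<^esub> a)"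
    by (rule coset_map_continuous)
qed (simp_all add: assms closed_graded_ideal_axioms carrier_quotient coset_eq_iff induced_map_coset)

end

lemma closed_graded_ideal_zero: "closed_graded_ideal {0 :: 'd::finite fock \<Rightarrow>\<^sub>L 'd fock}"
  by unfold_locales (auto simp: disc_poly fock_polys_zero intro: blinfun_eqI)

lemma identity_limit:
  assumes "infinite_dimensional TYPE('h::complex_hilbert)" "0 < r"
  shows "disc_quotient_limit TYPE('h) {0 :: 'd::finite fock \<Rightarrow>\<^sub>L 'd fock} r disc_algebra (\<lambda>a. a) dilation"
  by (intro disc_quotient_limit.intro disc_quotient_limit_axioms.intro)
    (simp_all add: assms closed_graded_ideal_zero alg_hom_def ring_hom_def open_map_def
      disc_add disc_mult disc_scale disc_poly fock_polys.one)

lemma symb_finite_sum: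
  assumes "finite {w. F w \<noteq> 0}"
  shows "symb (\<Sum>w | F w \<noteq> 0. F w *\<^sub>C word_op creation w) = F"
proof
  fix v
  have "symb (\<Sum>w | F w \<noteq> 0. F w *\<^sub>C word_op creation w) v = (\<Sum>w | F w \<noteq> 0. if w = v then F w else 0)"
    unfolding symb_sum by (rule sum.cong) (auto simp: symb_scaleC symb_word_op)
  then show "symb (\<Sum>w | F w \<noteq> 0. F w *\<^sub>C word_op creation w) v = F v"
    using assms by (simp add: sum.delta)
qed

text \<open>Taking a homogeneous part is continuous on free holomorphic functions and maps \<open>I\<close> to itself, which gives one inclusion.
For the other, \<open>F(y s)\<close> lies in the closure of \<open>I\<close> and is therefore close to some \<open>p\<close> in \<open>I\<close>; the polynomial \<open>G\<close> with
\<open>G(y s) = p\<close> is in \<open>I\<close> too, since \<open>I\<close> is graded, and it is close to \<open>F\<close> at every radius \<open>x < y\<close>.\<close>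

lemma (in infinite_dimensional) closure_free_polys_of:
  fixes I :: "('d::finite fock \<Rightarrow>\<^sub>L 'd fock) set"
  assumes I: "graded_ideal I" and r: "0 < r"
  shows "lctop (free_hol_algebra H r) closure_of free_polys_of I
    = {F \<in> free_hol H r. \<forall>k. homog_eval F creation k \<in> closure I}"
proof (intro Set.set_eqI iffI)
  note I' = graded_idealD[OF I]
  interpret closed_graded_ideal "closure I" by (rule closed_graded_ideal_closure[OF I])
  fix F assume F_cl: "F \<in> lctop (free_hol_algebra H r) closure_of free_polys_of I"
  then have F: "has_radius r F" "F \<in> free_hol H r"
    by (auto simp: in_closure_of topspace_free_hol[OF r] free_hol_iff[OF r])
  have "\<exists>b\<in>I. dist b (homog_eval F creation k) < e" if "0 < e" for e k
  proof -
    define x where "x = r / 2"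
    have x: "0 < x" "x < r" using r by (simp_all add: x_def)
    define U where "U = {G \<in> free_hol H r. wnorm x (\<lambda>w. G w - F w) < e * x ^ k}"
    have "openin (lctop (free_hol_algebra H r)) U"
      unfolding openin_free_hol[OF r]
    proof (intro conjI ballI)
      fix G assume "G \<in> U"
      then have G: "has_radius r G" and lt: "wnorm x (\<lambda>w. G w - F w) < e * x ^ k"
        by (simp_all add: U_def free_hol_iff[OF r])
      have "G' \<in> U" if G': "has_radius r G'"
        and "wnorm x (\<lambda>w. G' w - G w) < e * x ^ k - wnorm x (\<lambda>w. G w - F w)" for G'
        using has_radius_add(2)[OF has_radius_diff[OF G' G] has_radius_diff[OF G F(1)] x] that
        by (simp add: U_def free_hol_iff[OF r])
      then show "\<exists>x e. 0 < x \<and> x < r \<and> 0 < e \<and> (\<forall>G'\<in>free_hol H r. wnorm x (\<lambda>w. G' w - G w) < e \<longrightarrow> G' \<in> U)"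
        using x lt free_hol_iff[OF r]
        by (intro exI[of _ x] exI[of _ "e * x ^ k - wnorm x (\<lambda>w. G w - F w)"]) auto
    qed (auto simp: U_def)
    moreover have "F \<in> U"
      using F \<open>0 < e\<close> x by (simp add: U_def)
    ultimately obtain G where G: "G \<in> free_polys_of I" "G \<in> U"
      using F_cl unfolding in_closure_of by blast
    define p where "p = (\<Sum>w | G w \<noteq> 0. G w *\<^sub>C word_op creation w)"
    have p: "p \<in> I" "symb p = G"
      using G(1) symb_finite_sum[of G] by (simp_all add: free_polys_of_def p_def)
    have FG: "has_radius r (\<lambda>w. G w - F w)"
      using G(2) F has_radius_diff by (auto simp: U_def free_hol_iff[OF r])
    have "x ^ k * norm (homog_eval G creation k - homog_eval F creation k)
        \<le> x ^ k * hnorm (\<lambda>w. G w - F w) k"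
      using norm_homog_eval_creation_le[of "\<lambda>w. G w - F w" k] x
      by (intro mult_left_mono) (simp_all add: homog_eval_diff)
    also have "\<dots> \<le> wnorm x (\<lambda>w. G w - F w)"
      by (rule term_le_wnorm[OF FG x])
    also have "\<dots> < x ^ k * e"
      using G(2) by (simp add: U_def mult.commute)
    finally have "norm (homog_eval G creation k - homog_eval F creation k) < e"
      using x by simp
    then show ?thesis
      using I'(7)[OF p(1), of k] by (auto simp: p(2) dist_norm)
  qed
  then show "F \<in> {F \<in> free_hol H r. \<forall>k. homog_eval F creation k \<in> closure I}"
    using F(2) by (simp add: closure_approachable)
next
  note I' = graded_idealD[OF I]
  interpret closed_graded_ideal "closure I" by (rule closed_graded_ideal_closure[OF I])
  fix F assume "F \<in> {F \<in> free_hol H r. \<forall>k. homog_eval F creation k \<in> closure I}"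
  then have F: "has_radius r F" "F \<in> free_hol H r" and FI: "\<And>k. homog_eval F creation k \<in> closure I"
    by (auto simp: free_hol_iff[OF r])
  show "F \<in> lctop (free_hol_algebra H r) closure_of free_polys_of I"
    unfolding in_closure_of topspace_free_hol[OF r]
  proof (intro conjI allI impI F(2))
    fix U assume "F \<in> U \<and> openin (lctop (free_hol_algebra H r)) U"
    then obtain x e where x: "0 < x" "x < r" and e: "0 < e"
      and sub: "\<And>G. G \<in> free_hol H r \<Longrightarrow> wnorm x (\<lambda>w. G w - F w) < e \<Longrightarrow> G \<in> U"
      unfolding openin_free_hol[OF r] by meson
    obtain y where y: "x < y" "y < r" using dense[OF x(2)] by blast
    then have y0: "0 < y" using x by simp
    define C where "C = 1 - x / y"
    have C: "0 < C" using x y by (simp add: C_def)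
    note Fy = series_op_of_radius[OF y0 y(2) F(1)]
    have "series_op y F \<in> closure I"
      unfolding mem_iff_components[OF Fy(2)] Fy(3) homog_eval_weight
      using FI scaleR by blast
    moreover have "0 < e * C / 2" using e C by simp
    ultimately have "\<exists>p\<in>I. dist p (series_op y F) < e * C / 2"
      unfolding closure_approachable by blast
    then obtain p where p: "p \<in> I" and dist: "norm (p - series_op y F) < e * C / 2"
      by (auto simp: dist_norm)
    have p_poly: "p \<in> fock_polys" using p I'(1) by blast
    define G where "G w = complex_of_real (inverse y ^ length w) * symb p w" for w
    have symb_p: "symb p w = complex_of_real (y ^ length w) * G w" for w
      using y0 by (simp add: G_def power_inverse)
    have finG: "finite {w. G w \<noteq> 0}"
      by (rule finite_subset[OF _ fock_polys_finite_symb[OF p_poly]]) (auto simp: G_def)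
    have "(\<Sum>w | G w \<noteq> 0. G w *\<^sub>C word_op creation w) \<in> I"
    proof -
      obtain n where n: "p = (\<Sum>k<n. homog_eval (symb p) creation k)"
        by (rule poly_expansion[OF p_poly], rule that)
      have "symb (\<Sum>k<n. inverse y ^ k *\<^sub>R homog_eval (symb p) creation k) w = G w" for w
      proof -
        have "symb (\<Sum>k<n. inverse y ^ k *\<^sub>R homog_eval (symb p) creation k) w
            = complex_of_real (inverse y ^ length w) * symb (\<Sum>k<n. homog_eval (symb p) creation k) w"
          unfolding symb_sum sum_distrib_left
          by (rule sum.cong) (auto simp: symb_scaleR symb_homog_eval)
        then show ?thesis
          using n by (simp add: G_def)
      qed
      moreover have "(\<Sum>k<n. inverse y ^ k *\<^sub>R homog_eval (symb p) creation k) \<in> I"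
      proof (induction n)
        case (Suc n)
        then show ?case
          using I'(3)[OF Suc I'(4)[OF I'(7)[OF p], of "complex_of_real (inverse y ^ n)" n]]
          by (simp only: sum.lessThan_Suc scaleC_of_real)
      qed (simp add: I')
      moreover have "(\<Sum>w | G w \<noteq> 0. G w *\<^sub>C word_op creation w) \<in> fock_polys"
        by (intro fock_polys_sum fock_polys.scale word_op_mem_fock_polys)
      ultimately show ?thesis
        using conv_op_eqI fock_polys_conv_op I'(1) symb_finite_sum[OF finG]
        by (metis (no_types, lifting) ext subsetD)
    qed
    then have "G \<in> free_polys_of I"
      using finG by (simp add: free_polys_of_def)
    moreover have "G \<in> U"
    proof (rule sub)
      have G: "has_radius r G" by (rule has_radius_finite_support[OF finG])
      then show "G \<in> free_hol H r" using free_hol_iff[OF r] by blast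
      have "y ^ k * hnorm (\<lambda>w. G w - F w) k \<le> e * C / 2" for k
      proof -
        have "y ^ k * hnorm (\<lambda>w. G w - F w) k
            = hnorm (\<lambda>w. complex_of_real (y ^ length w) * (G w - F w)) k"
          using y0 by (subst hnorm_dilate) simp
        also have "\<dots> = hnorm (symb (p - series_op y F)) k"
          by (simp only: symb_diff symb_p Fy(3) right_diff_distrib)
        also have "\<dots> \<le> e * C / 2"
          using hnorm_symb_le[of "p - series_op y F" k] dist by simp
        finally show ?thesis .
      qed
      then have "wnorm x (\<lambda>w. G w - F w) \<le> (e * C / 2) / C"
        unfolding C_def by (rule geometric_bound(2)[OF x(1) y(1)])
      then show "wnorm x (\<lambda>w. G w - F w) < e"
        using C e by simp
    qed
    ultimately show "\<exists>G. G \<in> free_polys_of I \<and> G \<in> U" by blast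
  qed
qed

lemma closure_of_disc_algebra:
  assumes "I \<subseteq> fock_polys"
  shows "lctop disc_algebra closure_of I = closure I"
proof -
  have "I \<subseteq> closure fock_polys" "closure I \<subseteq> closure fock_polys"
    using assms closure_subset closure_mono by blast+
  then show ?thesis
    by (simp add: closure_of_subtopology Int_absorb1)
qed

theorem theorem5:
  fixes r :: real
  assumes "r > 0"
    and "\<not> (\<exists>B :: 'h::complex_hilbert set. finite B \<and> complex_vector.span B = UNIV)"
  shows "(\<forall>I :: ('d::finite fock \<Rightarrow>\<^sub>L 'd fock) set. graded_ideal I \<longrightarrow>
      (let A = disc_algebra;
           J = lctop A closure_of I;
           F = free_hol_algebra TYPE('h) r;
           K = lctop F closure_of free_polys_of I
       in \<exists>\<Phi>. \<Phi> \<in> lca_iso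
            (inverse_limit {0<..<r} (\<lambda>x. lca_quotient A J) (\<lambda>x y. induced_map A J (dilation x y)))
            (lca_quotient F K)))
    \<and> (\<exists>\<Phi>. \<Phi> \<in> lca_iso
          (inverse_limit {0<..<r} (\<lambda>x. disc_algebra :: ('d fock \<Rightarrow>\<^sub>L 'd fock) lc_algebra) dilation)
          (free_hol_algebra TYPE('h) r :: ('d list \<Rightarrow> complex) lc_algebra))"
proof (intro conjI allI impI)
  have inf: "infinite_dimensional TYPE('h)"
    using assms(2) by unfold_locales
  interpret infinite_dimensional "TYPE('h)" by (rule inf)
  {
    fix I :: "('d fock \<Rightarrow>\<^sub>L 'd fock) set"
    assume I: "graded_ideal I"
    interpret J: closed_graded_ideal "closure I" by (rule closed_graded_ideal_closure[OF I])
    interpret Q: disc_quotient_limit "TYPE('h)" "closure I" r "lca_quotient disc_algebra (closure I)"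
      "\<lambda>a. closure I +>\<^bsub>disc_algebra\<^esub> a" "\<lambda>x y. induced_map disc_algebra (closure I) (dilation x y)"
      by (rule J.coset_map_limit[OF inf assms(1)])
    have zero: "has_radius r (\<lambda>w::'d list. 0)"
      by (rule has_radius_finite_support) simp
    have "lctop (free_hol_algebra TYPE('h) r) closure_of free_polys_of I
      = {F \<in> carrier (free_hol_algebra TYPE('h) r). Q.\<Psi> F = Q.\<Psi> \<zero>\<^bsub>free_hol_algebra TYPE('h) r\<^esub>}"
      unfolding closure_free_polys_of[OF I assms(1)]
      by (auto simp: free_hol_iff[OF assms(1)] Q.\<Psi>_eq_iff[OF _ zero])
    from Q.\<Psi>.fibre_lca_iso[OF this]
    show "let A = disc_algebra;
           J = lctop A closure_of I;
           F = free_hol_algebra TYPE('h) r;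
           K = lctop F closure_of free_polys_of I
       in \<exists>\<Phi>. \<Phi> \<in> lca_iso
            (inverse_limit {0<..<r} (\<lambda>x. lca_quotient A J) (\<lambda>x y. induced_map A J (dilation x y)))
            (lca_quotient F K)"
      unfolding Let_def closure_of_disc_algebra[OF graded_idealD(1)[OF I]] by blast
  }
  interpret Q: disc_quotient_limit "TYPE('h)" "{0 :: 'd fock \<Rightarrow>\<^sub>L 'd fock}" r disc_algebra "\<lambda>a. a" dilation
    by (rule identity_limit[OF inf assms(1)])
  have "inj_on Q.\<Psi> (carrier (free_hol_algebra TYPE('h) r))"
  proof (rule inj_onI)
    fix F G :: "'d list \<Rightarrow> complex"
    assume "F \<in> carrier (free_hol_algebra TYPE('h) r)" "G \<in> carrier (free_hol_algebra TYPE('h) r)"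
      and "Q.\<Psi> F = Q.\<Psi> G"
    then have zero: "homog_eval (\<lambda>w. F w - G w) creation k = 0" for k
      using Q.\<Psi>_eq_iff[of F G] by (simp add: free_hol_iff[OF assms(1)])
    have "F w - G w = 0" for w
      using arg_cong[OF zero[of "length w"], of "\<lambda>a. symb a w"] by (simp add: symb_homog_eval symb_zero)
    then show "F = G" by (simp add: fun_eq_iff)
  qed
  from Q.\<Psi>.inverse_lca_iso[OF this]
  show "\<exists>\<Phi>. \<Phi> \<in> lca_iso
          (inverse_limit {0<..<r} (\<lambda>x. disc_algebra :: ('d fock \<Rightarrow>\<^sub>L 'd fock) lc_algebra) dilation)
          (free_hol_algebra TYPE('h) r :: ('d list \<Rightarrow> complex) lc_algebra)"
    by blast
qed

end
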